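(* Let $d\ge2$ and let $X=(X_j)_{j\in\mathbb{Z}^d}$ be a stationary Gaussian field with $\mathbb{E}[X_o]=0$, $\mathbb{E}[X_o^2]=1$ and covariance $\rho(u)=\mathbb{E}[X_oX_u]$, $u\in\mathbb{Z}^d$, where $o$ denotes the origin. Let $H:\mathbb{R}\to\mathbb{R}$ be a measurable function with $\operatorname{Var}[H(X_o)]<\infty$ and $\mathbb{E}[H(X_o)]=0$, with Hermite expansion $H=\sum_{q=m}^\infty c_qH_q$ and Hermite rank $m\ge1$, and suppose that $\sum_{u\in\mathbb{Z}^d}|\rho(u)|^m<\infty$. Let $\alpha>d/2$ and $f\in\mathcal{H}^\alpha(D)$, where $D=[-1/2,1/2]^d$. For $q\ge m$ and $N\ge2$ set $$S_{N,q}(f)=N^{-d/2}\,c_q\sum_{j\in B_N}H_q(X_j)\,f\!\left(\tfrac jN\right).$$ Then for every $q\ge m$, $$\operatorname{Var}(S_{N,q}(f))=q!\,c_q^2\,N^{-d}\sum_{u\in\mathbb{Z}^d}\rho(u)^q\sum_{\substack{j,k\in B_N\\ j-k=u}}f\!\left(\tfrac jN\right)f\!\left(\tfrac kN\right),$$ and, as $N\to\infty$, $S_{N,q}(f)$ converges in distribution to $$\mathcal{N}\Big(0,\ \sigma_q^2\int_Df^2(x)\,dx\Big),\qquad\text{where}\quad \sigma_q^2=q!\,c_q^2\sum_{u\in\mathbb{Z}^d}\rho(u)^q<\infty .$$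
   Context: $B_N=\{j\in\mathbb{Z}^d:|j|\le N/2\}$ is the box of size $N$ centered at the origin, with $|\cdot|$ the sup norm, so that $j/N\in D$ for $j\in B_N$. $(H_q)_{q\ge0}$ are the (probabilists') Hermite polynomials, normalized so that $\mathbb{E}[H_q(Y)H_q(Z)]=q!\,\mathbb{E}[YZ]^q$ for jointly Gaussian centered unit-variance $Y,Z$. The Hermite expansion converges in $L^2$ of the standard Gaussian measure. The Hermite rank $m$ of $H$ is the smallest $q\ge1$ with $c_q\ne0$. $\{\varphi_k\}_{k\ge1}$ is an orthonormal basis of $L^2(D)$ of eigenfunctions of $-\Delta$ on $D$ with zero (Dirichlet) boundary condition, with eigenvalues $\{\lambda_k\}_{k\ge1}$, and $$\mathcal{H}^\alpha(D)=\Big\{u=\sum_{k\ge1}u_k\varphi_k:\ \sum_{k\ge1}(1+\lambda_k)^\alpha|u_k|^2<\infty\Big\}.$$ For $\alpha>d/2$ elements of $\mathcal{H}^\alpha(D)$ are identified with their (bounded) continuous representatives. A Gaussian law with variance $0$ is the point mass at $0$. *)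

theory Defs
  imports "HOL-Probability.Probability" "HOL-Computational_Algebra.Polynomial"
begin

subsection \<open>Square-integrable functions and orthonormal bases\<close>

definition L2 :: "'a measure \<Rightarrow> ('a \<Rightarrow> real) set" where
  "L2 M = {g \<in> borel_measurable M. integrable M (\<lambda>x. (g x)\<^sup>2)}"

definition L2_sums :: "'a measure \<Rightarrow> (nat \<Rightarrow> 'a \<Rightarrow> real) \<Rightarrow> (nat \<Rightarrow> real) \<Rightarrow> ('a \<Rightarrow> real) \<Rightarrow> bool" where
  "L2_sums M e u g \<longleftrightarrow> (\<forall>k. e k \<in> L2 M) \<and> g \<in> L2 M \<and>
     (\<lambda>n. LINT x|M. (g x - (\<Sum>k<n. u k * e k x))\<^sup>2) \<longlonglongrightarrow> 0"

definition L2_orthonormal_basis :: "'a measure \<Rightarrow> (nat \<Rightarrow> 'a \<Rightarrow> real) \<Rightarrow> bool" where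
  "L2_orthonormal_basis M e \<longleftrightarrow> (\<forall>k. e k \<in> L2 M) \<and>
     (\<forall>j k. (LINT x|M. e j x * e k x) = (if j = k then 1 else 0)) \<and>
     (\<forall>g\<in>L2 M. L2_sums M e (\<lambda>k. LINT x|M. g x * e k x) g)"


subsection \<open>Gaussian laws and stationary Gaussian fields\<close>

text \<open>The second parameter is the variance, not the standard deviation.\<close>

definition gaussian_law :: "real \<Rightarrow> real \<Rightarrow> real measure" where
  "gaussian_law \<mu> v =
     (if v = 0 then return borel \<mu> else density lborel (normal_density \<mu> (sqrt v)))"

definition gaussian_field :: "'a measure \<Rightarrow> ('i \<Rightarrow> 'a \<Rightarrow> real) \<Rightarrow> bool" where
  "gaussian_field M X \<longleftrightarrow> (\<forall>j. X j \<in> borel_measurable M) \<and>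
     (\<forall>J a. finite J \<longrightarrow>
        (\<exists>\<mu> v. 0 \<le> v \<and> distr M borel (\<lambda>\<omega>. \<Sum>j\<in>J. a j * X j \<omega>) = gaussian_law \<mu> v))"

definition stationary_field :: "'a measure \<Rightarrow> ('i::ab_group_add \<Rightarrow> 'a \<Rightarrow> real) \<Rightarrow> bool" where
  "stationary_field M X \<longleftrightarrow>
     (\<forall>J h. finite J \<longrightarrow>
        distr M (PiM J (\<lambda>_. borel)) (\<lambda>\<omega>. \<lambda>j\<in>J. X (j + h) \<omega>) =
        distr M (PiM J (\<lambda>_. borel)) (\<lambda>\<omega>. \<lambda>j\<in>J. X j \<omega>))"


subsection \<open>Hermite polynomials, expansion and rank\<close>

text \<open>Probabilists' normalization: the recursion results from differentiating
  \<open>(-1)^n * hermite n * exp (- x^2 / 2)\<close>, the \<open>n\<close>-th derivative of \<open>exp (- x^2 / 2)\<close>.\<close>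

fun hermite :: "nat \<Rightarrow> real poly" where
  "hermite 0 = 1"
| "hermite (Suc n) = [:0, 1:] * hermite n - pderiv (hermite n)"

definition hermite_expansion :: "(real \<Rightarrow> real) \<Rightarrow> (nat \<Rightarrow> real) \<Rightarrow> bool" where
  "hermite_expansion H c \<longleftrightarrow> L2_sums (gaussian_law 0 1) (\<lambda>q. poly (hermite q)) c H"

definition hermite_rank :: "(nat \<Rightarrow> real) \<Rightarrow> nat \<Rightarrow> bool" where
  "hermite_rank c m \<longleftrightarrow> 1 \<le> m \<and> c m \<noteq> 0 \<and> (\<forall>q. 1 \<le> q \<and> q < m \<longrightarrow> c q = 0)"


subsection \<open>Dirichlet eigenfunctions and the associated Sobolev spaces\<close>

text \<open>Classical eigenfunctions of the negative Laplacian: \<open>g\<close> is twice continuously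
  differentiable in the interior with gradient \<open>G\<close> and Hessian \<open>A\<close>, so that
  \<open>trace (A x)\<close> is the Laplacian of \<open>g\<close> at \<open>x\<close>.\<close>

definition dirichlet_eigenfunction ::
    "(real ^ 'd) set \<Rightarrow> real \<Rightarrow> (real ^ 'd \<Rightarrow> real) \<Rightarrow> bool" where
  "dirichlet_eigenfunction D l g \<longleftrightarrow>
     continuous_on D g \<and> (\<forall>x\<in>frontier D. g x = 0) \<and> (\<exists>x\<in>D. g x \<noteq> 0) \<and>
     (\<exists>(G :: real ^ 'd \<Rightarrow> real ^ 'd) (A :: real ^ 'd \<Rightarrow> real ^ 'd ^ 'd).
        continuous_on (interior D) A \<and>
        (\<forall>x\<in>interior D.
           (g has_derivative (\<lambda>h. G x \<bullet> h)) (at x) \<and>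
           (G has_derivative (\<lambda>h. A x *v h)) (at x) \<and>
           - trace (A x) = l * g x))"

definition dirichlet_eigenbasis ::
    "(real ^ 'd) set \<Rightarrow> (nat \<Rightarrow> real) \<Rightarrow> (nat \<Rightarrow> real ^ 'd \<Rightarrow> real) \<Rightarrow> bool" where
  "dirichlet_eigenbasis D eig \<phi> \<longleftrightarrow>
     (\<forall>k. dirichlet_eigenfunction D (eig k) (\<phi> k)) \<and> L2_orthonormal_basis (lebesgue_on D) \<phi>"

text \<open>Elements are functions rather than classes modulo null sets, so the continuous
  representative of a class has to be selected separately.\<close>

definition sobolev_space ::
    "(real ^ 'd) set \<Rightarrow> (nat \<Rightarrow> real) \<Rightarrow> (nat \<Rightarrow> real ^ 'd \<Rightarrow> real) \<Rightarrow> real \<Rightarrow>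
     (real ^ 'd \<Rightarrow> real) set" where
  "sobolev_space D eig \<phi> \<alpha> =
     {f. \<exists>u. summable (\<lambda>k. (1 + eig k) powr \<alpha> * (u k)\<^sup>2) \<and> L2_sums (lebesgue_on D) \<phi> u f}"


subsection \<open>Lattice boxes and the rescaled sums\<close>

definition unit_cube :: "(real ^ 'd) set" where
  "unit_cube = cbox (vec (- 1 / 2)) (vec (1 / 2))"

definition lattice_vec :: "int ^ 'd \<Rightarrow> real ^ 'd" where
  "lattice_vec j = (\<chi> i. real_of_int (j $ i))"

definition lattice_box :: "nat \<Rightarrow> (int ^ 'd) set" where
  "lattice_box N = {j. infnorm (lattice_vec j) \<le> real N / 2}"

definition chaos_sum ::
    "(int ^ 'd \<Rightarrow> 'a \<Rightarrow> real) \<Rightarrow> (nat \<Rightarrow> real) \<Rightarrow> (real ^ 'd \<Rightarrow> real) \<Rightarrow> nat \<Rightarrow> nat \<Rightarrow> 'a \<Rightarrow> real" where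
  "chaos_sum X c f N q \<omega> = real N powr (- real CARD('d) / 2) * c q *
     (\<Sum>j\<in>lattice_box N. poly (hermite q) (X j \<omega>) * f (lattice_vec j /\<^sub>R real N))"

definition limit_variance :: "('i \<Rightarrow> real) \<Rightarrow> (nat \<Rightarrow> real) \<Rightarrow> nat \<Rightarrow> real" where
  "limit_variance \<rho> c q = fact q * (c q)\<^sup>2 * (\<Sum>\<^sub>\<infinity>u. \<rho> u ^ q)"

end

theory Submission
  imports Defs
begin

text \<open>Stein's method replaces the diagram formula for all but four factors. Write
  \<open>F = \<Sum>k. a k * H\<^sub>q(X k)\<close> and \<open>q = p + 1\<close>. Since \<open>H\<^sub>q = x H\<^sub>p - H\<^sub>p'\<close>, one Gaussian integration by parts gives
  \<open>E[F g(F)] = E[\<Gamma> g'(F)]\<close> with \<open>\<Gamma> = q * \<Sum>j k. a j * a k * \<rho>(j - k) * H\<^sub>p(X j) * H\<^sub>p(X k)\<close>. Hence the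
  characteristic function \<open>G\<close> of \<open>F\<close> satisfies \<open>G'(t) = - v t G(t)\<close> with \<open>v = Var F = E \<Gamma>\<close>, up to an error
  \<open>|t| E|\<Gamma> - v|\<close>, so that \<open>|G(t) - exp(- v t\<^sup>2 / 2)|\<close> is at most of order \<open>t\<^sup>2 sqrt(Var \<Gamma>)\<close>. The same integration
  by parts, used as a recursion on products of four Hermite polynomials, bounds \<open>Var \<Gamma>\<close> by sums of
  \<open>|\<rho>(i - j) \<rho>(k - l)|\<^sup>r |\<rho>(i - k) \<rho>(j - l)|\<^sup>s\<close> with \<open>r + s = q\<close> and \<open>r, s \<ge> 1\<close>, which are of order \<open>o(N\<^sup>2\<^sup>d)\<close>
  because \<open>|\<rho>|\<^sup>q\<close> is summable. Riemann sums give the limit of \<open>v\<close>.\<close>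

section \<open>Random vectors and characteristic functions\<close>

text \<open>\<open>gaussian_field\<close> speaks only of one-dimensional laws of finite linear
  combinations, whereas the integration by parts rests on the independence of \<open>X j\<close> and
  the whole family of its regression residuals. This independence is extracted from real cosine and
  sine transforms, with nonnegative weights in the place of joint laws. The exponents r and s are
  positive for two different reasons: the covariance factor in \<Gamma> adds one edge inside each of
  the pairs {1, 2} and {3, 4}, and subtracting the product of pair expectations cancels all diagrams
  that do not link the two pairs. Both matter on the lattice: summability of
  \<open>|\<rho>| ^ q\<close> does not give summability of \<open>|\<rho>| ^ r\<close> for r < q, so
  the sums of \<open>|\<rho>| ^ r\<close> over growing boxes may diverge, and only the product of
  the sums with exponents r and s is shown to be of smaller order than the box. For q = 1 there are
  no such exponents and \<Gamma> is constant, in accordance with a sum of jointly Gaussian variables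
  being exactly Gaussian.\<close>

lemma char_distr_cos_sin:
  assumes "finite_measure N" and [measurable]: "Y \<in> borel_measurable N"
  shows "char (distr N borel Y) t =
    complex_of_real (LINT \<omega>|N. cos (t * Y \<omega>)) + \<i> * complex_of_real (LINT \<omega>|N. sin (t * Y \<omega>))"
proof -
  interpret finite_measure N by fact
  have c: "integrable N (\<lambda>\<omega>. cos (t * Y \<omega>))" and s: "integrable N (\<lambda>\<omega>. sin (t * Y \<omega>))"
    by (auto intro!: integrable_const_bound[where B=1])
  have "char (distr N borel Y) t = (CLINT \<omega>|N. iexp (t * Y \<omega>))"
    unfolding char_def by (subst integral_distr) auto
  also have "\<dots> = (CLINT \<omega>|N. complex_of_real (cos (t * Y \<omega>)) + \<i> * complex_of_real (sin (t * Y \<omega>)))"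
    by (intro Bochner_Integration.integral_cong refl)
      (simp add: exp_Euler cos_of_real sin_of_real del: of_real_mult)
  also have "\<dots> = (CLINT \<omega>|N. complex_of_real (cos (t * Y \<omega>))) + (CLINT \<omega>|N. \<i> * complex_of_real (sin (t * Y \<omega>)))"
    by (intro Bochner_Integration.integral_add integrable_mult_right) 
      (auto intro!: integrable_of_real c s)
  finally show ?thesis by simp
qed

text \<open>Applied with cosines as weights, this peels off one coordinate at a time, so that the
  one-dimensional uniqueness theorem suffices for random vectors.\<close>

lemma (in prob_space) weighted_law_eqI:
  fixes w1 w2 Y :: "'a \<Rightarrow> real"
  assumes [measurable]: "w1 \<in> borel_measurable M" "w2 \<in> borel_measurable M" "Y \<in> borel_measurable M"
    and i1: "integrable M w1" and i2: "integrable M w2"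
    and n1: "\<And>\<omega>. 0 \<le> w1 \<omega>" and n2: "\<And>\<omega>. 0 \<le> w2 \<omega>"
    and c: "\<And>t. expectation (\<lambda>\<omega>. w1 \<omega> * cos (t * Y \<omega>)) = expectation (\<lambda>\<omega>. w2 \<omega> * cos (t * Y \<omega>))"
    and s: "\<And>t. expectation (\<lambda>\<omega>. w1 \<omega> * sin (t * Y \<omega>)) = expectation (\<lambda>\<omega>. w2 \<omega> * sin (t * Y \<omega>))"
    and A[measurable]: "A \<in> sets borel"
  shows "expectation (\<lambda>\<omega>. w1 \<omega> * indicator A (Y \<omega>)) = expectation (\<lambda>\<omega>. w2 \<omega> * indicator A (Y \<omega>))"
proof -
  define m where "m = expectation w1"
  have m2: "m = expectation w2" using c[of 0] by (simp add: m_def)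
  have m0: "0 \<le> m" unfolding m_def using integral_nonneg_AE[of w1 M] n1 by simp
  show ?thesis
  proof (cases "m = 0")
    \<comment> \<open>Zero total mass cannot be normalised; in that case both weights vanish almost
      surely.\<close>
    case True
    have "AE \<omega> in M. w1 \<omega> = 0" "AE \<omega> in M. w2 \<omega> = 0"
      using True integral_nonneg_eq_0_iff_AE[OF i1] integral_nonneg_eq_0_iff_AE[OF i2] n1 n2 m2 m_def
      by auto
    then have "AE \<omega> in M. w1 \<omega> * indicator A (Y \<omega>) = w2 \<omega> * indicator A (Y \<omega>)" by auto
    then show ?thesis by (intro integral_cong_AE) auto
  next
    case False
    with m0 have mp: "m > 0" by simp
    \<comment> \<open>Divided by the common mass (equal by \<open>c\<close> at t = 0), both weights
      become probability densities, and the hypotheses say that \<open>Y\<close> has the same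
      characteristic function under each.\<close>
    define \<mu> where "\<mu> w = density M (\<lambda>\<omega>. ennreal (w \<omega> / m))" for w
    have ps: "prob_space (\<mu> w)" if "integrable M w" "\<And>\<omega>. 0 \<le> w \<omega>" "expectation w = m" for w
    proof
      have [measurable]: "w \<in> borel_measurable M" using that by auto
      have "emeasure (\<mu> w) (space (\<mu> w)) = (\<integral>\<^sup>+\<omega>. ennreal (w \<omega> / m) \<partial>M)"
        unfolding \<mu>_def by (subst emeasure_density) (auto intro!: nn_integral_cong simp: indicator_def)
      also have "\<dots> = ennreal (expectation (\<lambda>\<omega>. w \<omega> / m))"
        using that mp by (intro nn_integral_eq_integral) auto
      also have "\<dots> = 1" using that mp by simp
      finally show "emeasure (\<mu> w) (space (\<mu> w)) = 1" .
    qed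
    have int: "(LINT \<omega>|\<mu> w. g \<omega>) = expectation (\<lambda>\<omega>. w \<omega> * g \<omega>) / m"
      if [measurable]: "g \<in> borel_measurable M" "w \<in> borel_measurable M" and "\<And>\<omega>. 0 \<le> w \<omega>"
      for w and g :: "_ \<Rightarrow> real"
      unfolding \<mu>_def using that(3) mp by (subst integral_density) auto
    have p1: "prob_space (\<mu> w1)" and p2: "prob_space (\<mu> w2)"
      using ps[OF i1 n1] ps[OF i2 n2] m2 m_def by auto
    interpret P1: prob_space "\<mu> w1" by fact
    interpret P2: prob_space "\<mu> w2" by fact
    have [measurable]: "Y \<in> borel_measurable (\<mu> w)" for w unfolding \<mu>_def by simp
    have "distr (\<mu> w1) borel Y = distr (\<mu> w2) borel Y"
    proof (rule Levy_uniqueness)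
      show "real_distribution (distr (\<mu> w1) borel Y)" "real_distribution (distr (\<mu> w2) borel Y)"
        by (auto intro: P1.real_distribution_distr P2.real_distribution_distr)
      show "char (distr (\<mu> w1) borel Y) = char (distr (\<mu> w2) borel Y)"
        by (intro ext, subst (1 2) char_distr_cos_sin)
          (auto simp: int n1 n2 c s P1.finite_measure_axioms P2.finite_measure_axioms)
    qed
    then have "(LINT y|distr (\<mu> w1) borel Y. indicator A y) = (LINT y|distr (\<mu> w2) borel Y. indicator A y :: real)"
      by simp
    then have "(LINT \<omega>|\<mu> w1. indicator A (Y \<omega>)) = (LINT \<omega>|\<mu> w2. indicator A (Y \<omega>) :: real)"
      by (subst (asm) (1 2) integral_distr) auto
    then show ?thesis using mp by (simp add: int n1 n2)
  qed
qed

text \<open>Induction on \<open>J\<close> with the weights left free: once coordinate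
  \<open>k\<close> is treated, its indicator becomes a factor of the weight. The new weights must
  again have equal transforms in the remaining coordinates, and \<open>Wc\<close> supplies
  this.\<close>

lemma (in prob_space) weighted_vector_law_eqI:
  fixes Y :: "'i \<Rightarrow> 'a \<Rightarrow> real" and w1 w2 :: "'a \<Rightarrow> real"
  assumes "finite J" and Ym[measurable]: "\<And>i. Y i \<in> borel_measurable M"
    and "integrable M w1" "integrable M w2"
    and "\<And>\<omega>. 0 \<le> w1 \<omega>" "\<And>\<omega>. 0 \<le> w2 \<omega>"
    and "\<And>s. expectation (\<lambda>\<omega>. w1 \<omega> * cos (\<Sum>i\<in>J. s i * Y i \<omega>)) =
              expectation (\<lambda>\<omega>. w2 \<omega> * cos (\<Sum>i\<in>J. s i * Y i \<omega>))"
    and "\<And>s. expectation (\<lambda>\<omega>. w1 \<omega> * sin (\<Sum>i\<in>J. s i * Y i \<omega>)) =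
              expectation (\<lambda>\<omega>. w2 \<omega> * sin (\<Sum>i\<in>J. s i * Y i \<omega>))"
    and "\<And>i. i \<in> J \<Longrightarrow> A i \<in> sets borel"
  shows "expectation (\<lambda>\<omega>. w1 \<omega> * (\<Prod>i\<in>J. indicator (A i) (Y i \<omega>))) =
         expectation (\<lambda>\<omega>. w2 \<omega> * (\<Prod>i\<in>J. indicator (A i) (Y i \<omega>)))"
  using assms(1,3-)
proof (induction J arbitrary: w1 w2 rule: finite_induct)
  case empty
  from empty(5)[of undefined] show ?case by simp
next
  case (insert k J)
  note i1 = insert.prems(1) and i2 = insert.prems(2)
  note n1 = insert.prems(3) and n2 = insert.prems(4)
  have Ak[measurable]: "A k \<in> sets borel" using insert.prems by auto
  have [measurable]: "w1 \<in> borel_measurable M" "w2 \<in> borel_measurable M" using i1 i2 by auto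
  have ib: "integrable M (\<lambda>\<omega>. w \<omega> * g \<omega>)" if "integrable M w" "g \<in> borel_measurable M" "\<And>\<omega>. \<bar>g \<omega>\<bar> \<le> 1"
    for w g :: "'a \<Rightarrow> real"
    using that by (intro Bochner_Integration.integrable_bound[OF that(1)])
      (auto simp: abs_mult intro!: mult_left_le)
  have cs: "expectation (\<lambda>\<omega>. w1 \<omega> * cos (t * Y k \<omega> + (\<Sum>i\<in>J. s i * Y i \<omega>))) =
           expectation (\<lambda>\<omega>. w2 \<omega> * cos (t * Y k \<omega> + (\<Sum>i\<in>J. s i * Y i \<omega>)))"
       "expectation (\<lambda>\<omega>. w1 \<omega> * sin (t * Y k \<omega> + (\<Sum>i\<in>J. s i * Y i \<omega>))) =
           expectation (\<lambda>\<omega>. w2 \<omega> * sin (t * Y k \<omega> + (\<Sum>i\<in>J. s i * Y i \<omega>)))" for t s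
  proof -
    have e: "t * Y k \<omega> + (\<Sum>i\<in>J. s i * Y i \<omega>) = (\<Sum>i\<in>insert k J. (s(k := t)) i * Y i \<omega>)" for \<omega>
      using insert.hyps by (auto intro!: sum.cong)
    show "expectation (\<lambda>\<omega>. w1 \<omega> * cos (t * Y k \<omega> + (\<Sum>i\<in>J. s i * Y i \<omega>))) =
           expectation (\<lambda>\<omega>. w2 \<omega> * cos (t * Y k \<omega> + (\<Sum>i\<in>J. s i * Y i \<omega>)))"
      unfolding e by (rule insert.prems(5))
    show "expectation (\<lambda>\<omega>. w1 \<omega> * sin (t * Y k \<omega> + (\<Sum>i\<in>J. s i * Y i \<omega>))) =
           expectation (\<lambda>\<omega>. w2 \<omega> * sin (t * Y k \<omega> + (\<Sum>i\<in>J. s i * Y i \<omega>)))"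
      unfolding e by (rule insert.prems(6))
  qed
  define I where "I w = expectation (\<lambda>\<omega>. w \<omega> * indicator (A k) (Y k \<omega>))" for w :: "'a \<Rightarrow> real"
  have lin: "expectation (\<lambda>\<omega>. (w \<omega> * (1 + g \<omega>)) * h \<omega>) =
      expectation (\<lambda>\<omega>. w \<omega> * h \<omega>) + expectation (\<lambda>\<omega>. w \<omega> * (g \<omega> * h \<omega>))"
    if "integrable M w" "g \<in> borel_measurable M" "\<And>\<omega>. \<bar>g \<omega>\<bar> \<le> 1"
       "h \<in> borel_measurable M" "\<And>\<omega>. \<bar>h \<omega>\<bar> \<le> 1" for w g h :: "'a \<Rightarrow> real"
  proof -
    have "expectation (\<lambda>\<omega>. (w \<omega> * (1 + g \<omega>)) * h \<omega>) = expectation (\<lambda>\<omega>. w \<omega> * h \<omega> + w \<omega> * (g \<omega> * h \<omega>))"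
      by (simp add: algebra_simps)
    also have "\<dots> = expectation (\<lambda>\<omega>. w \<omega> * h \<omega>) + expectation (\<lambda>\<omega>. w \<omega> * (g \<omega> * h \<omega>))"
      using that by (intro Bochner_Integration.integral_add ib) (auto simp: abs_mult intro: mult_le_one)
    finally show ?thesis .
  qed
  have W0: "I w1 = I w2" unfolding I_def
    by (rule weighted_law_eqI) (use i1 i2 n1 n2 cs[of _ "\<lambda>_. 0"] in auto)
  have Wc: "expectation (\<lambda>\<omega>. w1 \<omega> * indicator (A k) (Y k \<omega>) * g (\<Sum>i\<in>J. s i * Y i \<omega>)) =
        expectation (\<lambda>\<omega>. w2 \<omega> * indicator (A k) (Y k \<omega>) * g (\<Sum>i\<in>J. s i * Y i \<omega>))"
    if g: "g = cos \<or> g = sin" for s g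
  proof -
    define L where "L \<omega> = (\<Sum>i\<in>J. s i * Y i \<omega>)" for \<omega>
    have [measurable]: "L \<in> borel_measurable M" unfolding L_def by simp
    have [measurable]: "g \<in> borel_measurable borel" using g by auto
    have gb: "\<bar>g x\<bar> \<le> 1" for x using g by auto
    have gb': "-1 \<le> g x" for x using gb[of x] by linarith
    \<comment> \<open>A weight \<open>w * cos L\<close> may be negative. Adding 1 to the cosine
      makes \<open>weighted_law_eqI\<close> applicable, and the surplus is removed afterwards by
      \<open>W0\<close>.\<close>
    have tilt: "expectation (\<lambda>\<omega>. (w1 \<omega> * (1 + g (L \<omega>))) * h (t * Y k \<omega>)) =
          expectation (\<lambda>\<omega>. (w2 \<omega> * (1 + g (L \<omega>))) * h (t * Y k \<omega>))"
      if h: "h = cos \<or> h = sin" for t h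
    proof -
      have [measurable]: "h \<in> borel_measurable borel" using h by auto
      have hb: "\<bar>h x\<bar> \<le> 1" for x using h by auto
      have cc: "expectation (\<lambda>\<omega>. w1 \<omega> * f (t * Y k \<omega> + L \<omega>)) = expectation (\<lambda>\<omega>. w2 \<omega> * f (t * Y k \<omega> + L \<omega>))"
        "expectation (\<lambda>\<omega>. w1 \<omega> * f (t * Y k \<omega> - L \<omega>)) = expectation (\<lambda>\<omega>. w2 \<omega> * f (t * Y k \<omega> - L \<omega>))"
        "expectation (\<lambda>\<omega>. w1 \<omega> * f (t * Y k \<omega>)) = expectation (\<lambda>\<omega>. w2 \<omega> * f (t * Y k \<omega>))"
        if "f = cos \<or> f = sin" for f
        using that cs[of t s] cs[of t "\<lambda>i. - s i"] cs[of t "\<lambda>i. 0"]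
        by (auto simp: L_def sum_negf)
      \<comment> \<open>Product-to-sum formulas turn the tilted transform into transforms of
        \<open>t * Y k + L\<close> and \<open>t * Y k - L\<close>, which the hypotheses
        cover.\<close>
      have "\<exists>f a b. (f = cos \<or> f = sin) \<and> (\<forall>x y. g y * h x = a * f (x + y) + b * f (x - y))"
      proof -
        have 1: "cos y * cos x = (1/2) * cos (x + y) + (1/2) * cos (x - y)" for x y :: real by (simp add: cos_add cos_diff field_simps)
        have 2: "cos y * sin x = (1/2) * sin (x + y) + (1/2) * sin (x - y)" for x y :: real by (simp add: sin_add sin_diff field_simps)
        have 3: "sin y * cos x = (1/2) * sin (x + y) + (-1/2) * sin (x - y)" for x y :: real by (simp add: sin_add sin_diff field_simps)
        have 4: "sin y * sin x = (-1/2) * cos (x + y) + (1/2) * cos (x - y)" for x y :: real by (simp add: cos_add cos_diff field_simps)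
        show ?thesis using g h 1 2 3 4 by metis
      qed
      then obtain f a b where f: "f = cos \<or> f = sin" and pr: "\<And>x y. g y * h x = a * f (x + y) + b * f (x - y)"
        by blast
      have [measurable]: "f \<in> borel_measurable borel" using f by auto
      have fb: "\<bar>f x\<bar> \<le> 1" for x using f by auto
      have ex: "expectation (\<lambda>\<omega>. w \<omega> * (g (L \<omega>) * h (t * Y k \<omega>))) =
         a * expectation (\<lambda>\<omega>. w \<omega> * f (t * Y k \<omega> + L \<omega>)) + b * expectation (\<lambda>\<omega>. w \<omega> * f (t * Y k \<omega> - L \<omega>))"
        if w: "integrable M w" for w
      proof -
        have "expectation (\<lambda>\<omega>. w \<omega> * (g (L \<omega>) * h (t * Y k \<omega>))) =
           expectation (\<lambda>\<omega>. a * (w \<omega> * f (t * Y k \<omega> + L \<omega>)) + b * (w \<omega> * f (t * Y k \<omega> - L \<omega>)))"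
          by (simp add: pr algebra_simps)
        also have "\<dots> = a * expectation (\<lambda>\<omega>. w \<omega> * f (t * Y k \<omega> + L \<omega>)) + b * expectation (\<lambda>\<omega>. w \<omega> * f (t * Y k \<omega> - L \<omega>))"
          using w fb by (subst Bochner_Integration.integral_add) (auto intro!: integrable_mult_right ib)
        finally show ?thesis .
      qed
      show ?thesis
        using lin[OF i1, of "\<lambda>\<omega>. g (L \<omega>)" "\<lambda>\<omega>. h (t * Y k \<omega>)"] lin[OF i2, of "\<lambda>\<omega>. g (L \<omega>)" "\<lambda>\<omega>. h (t * Y k \<omega>)"]
          gb hb cc[OF f] cc(3)[OF h] ex[OF i1] ex[OF i2] by simp
    qed
    have "expectation (\<lambda>\<omega>. (w1 \<omega> * (1 + g (L \<omega>))) * indicator (A k) (Y k \<omega>)) =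
          expectation (\<lambda>\<omega>. (w2 \<omega> * (1 + g (L \<omega>))) * indicator (A k) (Y k \<omega>))"
    proof (rule weighted_law_eqI)
      show "integrable M (\<lambda>\<omega>. w1 \<omega> * (1 + g (L \<omega>)))" "integrable M (\<lambda>\<omega>. w2 \<omega> * (1 + g (L \<omega>)))"
        using ib[OF i1, of "\<lambda>\<omega>. g (L \<omega>)"] ib[OF i2, of "\<lambda>\<omega>. g (L \<omega>)"] i1 i2 gb
        by (auto simp: algebra_simps)
      show "0 \<le> w1 \<omega> * (1 + g (L \<omega>))" "0 \<le> w2 \<omega> * (1 + g (L \<omega>))" for \<omega>
        using n1[of \<omega>] n2[of \<omega>] gb'[of "L \<omega>"] by auto
    qed (use tilt in auto)
    then have "expectation (\<lambda>\<omega>. w1 \<omega> * (g (L \<omega>) * indicator (A k) (Y k \<omega>))) =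
               expectation (\<lambda>\<omega>. w2 \<omega> * (g (L \<omega>) * indicator (A k) (Y k \<omega>)))"
      using lin[OF i1, of "\<lambda>\<omega>. g (L \<omega>)" "\<lambda>\<omega>. indicator (A k) (Y k \<omega>)"]
        lin[OF i2, of "\<lambda>\<omega>. g (L \<omega>)" "\<lambda>\<omega>. indicator (A k) (Y k \<omega>)"] gb W0
      by (simp add: I_def indicator_def)
    then show ?thesis by (simp add: L_def mult_ac)
  qed
  have "expectation (\<lambda>\<omega>. (w1 \<omega> * indicator (A k) (Y k \<omega>)) * (\<Prod>i\<in>J. indicator (A i) (Y i \<omega>))) =
        expectation (\<lambda>\<omega>. (w2 \<omega> * indicator (A k) (Y k \<omega>)) * (\<Prod>i\<in>J. indicator (A i) (Y i \<omega>)))"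
  proof (rule insert.IH)
    show "integrable M (\<lambda>\<omega>. w1 \<omega> * indicator (A k) (Y k \<omega>))" "integrable M (\<lambda>\<omega>. w2 \<omega> * indicator (A k) (Y k \<omega>))"
      using i1 i2 by (auto intro!: ib simp: indicator_def)
  qed (use insert.prems Wc n1 n2 in auto)
  then show ?case using insert.hyps by (simp add: mult.assoc)
qed

section \<open>Gaussian laws on the line, the point mass for variance 0 included\<close>

lemma integrable_std_normal_poly:
  "integrable std_normal_distribution (poly p)"
  unfolding poly_altdef
  by (intro Bochner_Integration.integrable_sum integrable_mult_right integrable_std_normal_distribution_moment)

lemma prob_space_gaussian_law: "0 \<le> v \<Longrightarrow> prob_space (gaussian_law \<mu> v)"
  by (auto simp: gaussian_law_def intro: prob_space_return prob_space_normal_density)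

lemma real_distribution_gaussian_law: "0 \<le> v \<Longrightarrow> real_distribution (gaussian_law \<mu> v)"
  using prob_space_gaussian_law[of v \<mu>]
  by (auto simp: real_distribution_def real_distribution_axioms_def gaussian_law_def)

lemma sets_gaussian_law[measurable_cong, simp]: "sets (gaussian_law \<mu> v) = sets borel"
  by (auto simp: gaussian_law_def)

lemma space_gaussian_law[simp]: "space (gaussian_law \<mu> v) = UNIV"
  by (auto simp: gaussian_law_def)

text \<open>Reduces every nondegenerate law to the standard one, whose moments and characteristic
  function are known.\<close>

lemma distr_gaussian_law_standardize:
  assumes "0 < v"
  shows "distr (gaussian_law \<mu> v) borel (\<lambda>x. (x - \<mu>) / sqrt v) = std_normal_distribution"
proof -
  interpret prob_space "gaussian_law \<mu> v" using assms by (intro prob_space_gaussian_law) simp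
  have "distributed (gaussian_law \<mu> v) lborel (\<lambda>x. x) (normal_density \<mu> (sqrt v))"
    using assms unfolding distributed_def
    by (auto simp: gaussian_law_def intro!: distr_id2)
  then have "distributed (gaussian_law \<mu> v) lborel (\<lambda>x. (x - \<mu>) / sqrt v) std_normal_density"
    using normal_standard_normal_convert[of "sqrt v" "\<lambda>x. x" \<mu>] assms by simp
  then have "distr (gaussian_law \<mu> v) lborel (\<lambda>x. (x - \<mu>) / sqrt v) = std_normal_distribution"
    by (simp add: distributed_def)
  moreover have "distr (gaussian_law \<mu> v) lborel (\<lambda>x. (x - \<mu>) / sqrt v) =
      distr (gaussian_law \<mu> v) borel (\<lambda>x. (x - \<mu>) / sqrt v)"
    by (intro distr_cong) auto
  ultimately show ?thesis by simp
qed

lemma integral_gaussian_law: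
  fixes g :: "real \<Rightarrow> 'b::{banach, second_countable_topology}"
  assumes "0 < v" and [measurable]: "g \<in> borel_measurable borel"
  shows "integrable (gaussian_law \<mu> v) g \<longleftrightarrow> integrable std_normal_distribution (\<lambda>y. g (sqrt v * y + \<mu>))"
    and "integral\<^sup>L (gaussian_law \<mu> v) g = integral\<^sup>L std_normal_distribution (\<lambda>y. g (sqrt v * y + \<mu>))"
proof -
  have e: "g (sqrt v * ((x - \<mu>) / sqrt v) + \<mu>) = g x" for x using assms(1) by simp
  have m: "(\<lambda>x. (x - \<mu>) / sqrt v) \<in> borel_measurable (gaussian_law \<mu> v)" by simp
  have m2: "(\<lambda>y. g (sqrt v * y + \<mu>)) \<in> borel_measurable borel" by simp
  show "integrable (gaussian_law \<mu> v) g \<longleftrightarrow> integrable std_normal_distribution (\<lambda>y. g (sqrt v * y + \<mu>))"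
    unfolding distr_gaussian_law_standardize[OF assms(1), of \<mu>, symmetric]
    by (subst integrable_distr_eq[OF m m2]) (simp only: e)
  show "integral\<^sup>L (gaussian_law \<mu> v) g = integral\<^sup>L std_normal_distribution (\<lambda>y. g (sqrt v * y + \<mu>))"
    unfolding distr_gaussian_law_standardize[OF assms(1), of \<mu>, symmetric]
    by (subst integral_distr[OF m m2]) (simp only: e)
qed

lemma integrable_gaussian_law_power:
  assumes "0 \<le> v" shows "integrable (gaussian_law \<mu> v) (\<lambda>x. x ^ k)"
proof (cases "v = 0")
  case True
  then show ?thesis unfolding gaussian_law_def
    by (simp add: integrable_iff_bounded nn_integral_return del: power_abs ennreal_power)
next
  case False
  with assms have v: "0 < v" by simp
  have "(\<lambda>y. (sqrt v * y + \<mu>) ^ k) = poly ([:\<mu>, sqrt v:] ^ k)" by (auto simp: algebra_simps)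
  then show ?thesis by (subst integral_gaussian_law(1)[OF v]) (simp_all only: integrable_std_normal_poly, simp)
qed

lemma mean_gaussian_law:
  assumes "0 \<le> v" shows "(LINT x|gaussian_law \<mu> v. x) = \<mu>"
proof (cases "v = 0")
  case True
  then show ?thesis unfolding gaussian_law_def by (simp add: integral_return)
next
  case False
  with assms have v: "0 < v" by simp
  interpret prob_space std_normal_distribution by (rule prob_space_normal_density) simp
  have i: "integrable std_normal_distribution (\<lambda>y. y)" and z: "(LINT y|std_normal_distribution. y) = 0"
    using integrable_std_normal_distribution_moment[of 1] integral_std_normal_distribution_moment_odd[of 1]
    unfolding power_one_right by simp_all
  have "(LINT x|gaussian_law \<mu> v. x) = (LINT y|std_normal_distribution. sqrt v * y + \<mu>)"
    by (rule integral_gaussian_law(2)[OF v]) simp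
  also have "\<dots> = (LINT y|std_normal_distribution. sqrt v * y) + (LINT y|std_normal_distribution. \<mu>)"
    by (intro Bochner_Integration.integral_add integrable_mult_right i) simp
  also have "\<dots> = \<mu>" using z prob_space by (simp only: integral_mult_right_zero lebesgue_integral_const) simp
  finally show ?thesis .
qed

lemma second_moment_gaussian_law:
  assumes "0 \<le> v" shows "(LINT x|gaussian_law 0 v. x\<^sup>2) = v"
proof (cases "v = 0")
  case True
  then show ?thesis unfolding gaussian_law_def by (simp add: integral_return)
next
  case False
  with assms have v: "0 < v" by simp
  show ?thesis using std_normal_distribution_even_moments(1)[of 1] v
    by (subst integral_gaussian_law(2)[OF v]) (auto simp: power_mult_distrib fact_numeral)
qed

lemma char_gaussian_law:
  assumes "0 \<le> v"
  shows "char (gaussian_law 0 v) t = complex_of_real (exp (- v * t\<^sup>2 / 2))"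
proof (cases "v = 0")
  case True
  then show ?thesis unfolding gaussian_law_def char_def by (simp add: integral_return)
next
  case False
  with assms have v: "0 < v" by simp
  have "char (gaussian_law 0 v) t = char std_normal_distribution (t * sqrt v)"
    unfolding char_def by (subst integral_gaussian_law(2)[OF v]) (auto simp: mult.assoc)
  also have "\<dots> = complex_of_real (exp (- v * t\<^sup>2 / 2))"
    using v by (simp add: char_std_normal_distribution power_mult_distrib mult.commute)
  finally show ?thesis .
qed

text \<open>The index set is arbitrary: the estimates in this locale see the covariance only through
  the kernel \<open>R\<close>. Stationarity enters when \<open>R j k\<close> is identified with
  \<open>\<rho> (j - k)\<close>.\<close>

locale std_gaussian_field = prob_space M for M :: "'a measure" +
  fixes X :: "'i \<Rightarrow> 'a \<Rightarrow> real"
  assumes gauss: "gaussian_field M X"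
    and mean0: "\<And>i. expectation (X i) = 0"
    and var1: "\<And>i. expectation (\<lambda>\<omega>. (X i \<omega>)\<^sup>2) = 1"
begin

definition R :: "'i \<Rightarrow> 'i \<Rightarrow> real" where
  "R i j = expectation (\<lambda>\<omega>. X i \<omega> * X j \<omega>)"

lemma R_commute: "R i j = R j i"
  unfolding R_def by (simp add: mult.commute)

lemma R_refl[simp]: "R i i = 1"
  unfolding R_def using var1[of i] by (simp add: power2_eq_square)

lemma X_measurable[measurable]: "X i \<in> borel_measurable M"
  using gauss by (auto simp: gaussian_field_def)

lemma lin_comb_law_ex:
  "finite J \<Longrightarrow> \<exists>\<mu> v. 0 \<le> v \<and> distr M borel (\<lambda>\<omega>. \<Sum>j\<in>J. a j * X j \<omega>) = gaussian_law \<mu> v"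
  using gauss by (auto simp: gaussian_field_def)

lemma integrable_X_power: "integrable M (\<lambda>\<omega>. X i \<omega> ^ k)"
proof -
  obtain \<mu> v where v: "0 \<le> v" "distr M borel (\<lambda>\<omega>. \<Sum>j\<in>{i}. 1 * X j \<omega>) = gaussian_law \<mu> v"
    using lin_comb_law_ex[of "{i}" "\<lambda>_. 1"] by blast
  then have "integrable (distr M borel (X i)) (\<lambda>x. x ^ k)"
    using integrable_gaussian_law_power[of v \<mu> k] by simp
  then show ?thesis by (subst (asm) integrable_distr_eq) auto
qed

lemma integrable_X: "integrable M (X i)"
  using integrable_X_power[of i 1] by simp

lemma integrable_XX: "integrable M (\<lambda>\<omega>. X i \<omega> * X j \<omega>)"
proof (rule Bochner_Integration.integrable_bound)
  show "integrable M (\<lambda>\<omega>. X i \<omega> ^ 2 + X j \<omega> ^ 2)"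
    by (intro Bochner_Integration.integrable_add integrable_X_power)
  have "\<bar>x * y\<bar> \<le> x\<^sup>2 + y\<^sup>2" for x y :: real
    using zero_le_power2[of "\<bar>x\<bar> - \<bar>y\<bar>"] zero_le_power2[of x] zero_le_power2[of y]
    unfolding power2_diff abs_mult power2_abs by linarith
  then show "AE \<omega> in M. norm (X i \<omega> * X j \<omega>) \<le> norm (X i \<omega> ^ 2 + X j \<omega> ^ 2)" by simp
qed simp

text \<open>The squares of \<open>X i - X j\<close> and \<open>X i + X j\<close> have nonnegative
  expectation, and both variances are 1.\<close>

lemma abs_R_le_1: "\<bar>R i j\<bar> \<le> 1"
proof -
  have "2 * \<bar>R i j\<bar> \<le> 2"
  proof -
    have "2 * R i j = expectation (\<lambda>\<omega>. 2 * (X i \<omega> * X j \<omega>))" by (simp add: R_def)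
    also have "\<dots> \<le> expectation (\<lambda>\<omega>. X i \<omega> ^ 2 + X j \<omega> ^ 2)"
      using sum_squares_bound
      by (intro integral_mono Bochner_Integration.integrable_add integrable_X_power integrable_mult_right integrable_XX) (simp add: mult.assoc[symmetric])
    also have "\<dots> = 2" using integrable_X_power var1 by simp
    finally have 1: "2 * R i j \<le> 2" .
    have "- 2 = expectation (\<lambda>\<omega>. - (X i \<omega> ^ 2 + X j \<omega> ^ 2))" using integrable_X_power var1 by simp
    also have "\<dots> \<le> expectation (\<lambda>\<omega>. 2 * (X i \<omega> * X j \<omega>))"
    proof (intro integral_mono Bochner_Integration.integrable_minus Bochner_Integration.integrable_add integrable_X_power integrable_mult_right integrable_XX)
      fix \<omega> show "- ((X i \<omega>)\<^sup>2 + (X j \<omega>)\<^sup>2) \<le> 2 * (X i \<omega> * X j \<omega>)"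
        using zero_le_power2[of "X i \<omega> + X j \<omega>"] by (simp add: power2_sum)
    qed
    also have "\<dots> = 2 * R i j" by (simp add: R_def)
    finally show ?thesis using 1 by linarith
  qed
  then show ?thesis by simp
qed

text \<open>\<open>gaussian_field\<close> only asserts that some mean and variance exist; comparing
  the first two moments identifies them.\<close>

lemma lin_comb_law:
  assumes "finite J"
  shows "distr M borel (\<lambda>\<omega>. \<Sum>j\<in>J. a j * X j \<omega>) = gaussian_law 0 (expectation (\<lambda>\<omega>. (\<Sum>j\<in>J. a j * X j \<omega>)\<^sup>2))"
proof -
  let ?L = "\<lambda>\<omega>. \<Sum>j\<in>J. a j * X j \<omega>"
  obtain \<mu> v where v: "0 \<le> v" and d: "distr M borel ?L = gaussian_law \<mu> v"
    using lin_comb_law_ex[OF assms] by blast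
  have "\<mu> = (LINT x|distr M borel ?L. x)" unfolding d using mean_gaussian_law[OF v] by simp
  also have "\<dots> = expectation ?L" by (subst integral_distr) auto
  also have "\<dots> = 0" by (simp add: mean0 integrable_X)
  finally have \<mu>: "\<mu> = 0" .
  have "v = (LINT x|distr M borel ?L. x\<^sup>2)" unfolding d \<mu> using second_moment_gaussian_law[OF v] by simp
  also have "\<dots> = expectation (\<lambda>\<omega>. (?L \<omega>)\<^sup>2)" by (subst integral_distr) auto
  finally show ?thesis using d \<mu> by simp
qed

text \<open>The characteristic function at the single point 1 suffices, because a frequency can be
  absorbed into the coefficients \<open>a\<close>.\<close>

lemma lin_comb_cos_sin:
  assumes "finite J"
  shows "expectation (\<lambda>\<omega>. cos (\<Sum>j\<in>J. a j * X j \<omega>)) = exp (- expectation (\<lambda>\<omega>. (\<Sum>j\<in>J. a j * X j \<omega>)\<^sup>2) / 2)"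
    and "expectation (\<lambda>\<omega>. sin (\<Sum>j\<in>J. a j * X j \<omega>)) = 0"
proof -
  let ?L = "\<lambda>\<omega>. \<Sum>j\<in>J. a j * X j \<omega>"
  have "char (distr M borel ?L) 1 = complex_of_real (exp (- expectation (\<lambda>\<omega>. (?L \<omega>)\<^sup>2) / 2))"
    unfolding lin_comb_law[OF assms] by (subst char_gaussian_law) (auto intro: Bochner_Integration.integral_nonneg)
  moreover have "char (distr M borel ?L) 1 =
      complex_of_real (expectation (\<lambda>\<omega>. cos (?L \<omega>))) + \<i> * complex_of_real (expectation (\<lambda>\<omega>. sin (?L \<omega>)))"
    by (subst char_distr_cos_sin) (auto simp: finite_measure_axioms)
  ultimately show "expectation (\<lambda>\<omega>. cos (?L \<omega>)) = exp (- expectation (\<lambda>\<omega>. (?L \<omega>)\<^sup>2) / 2)"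
    and "expectation (\<lambda>\<omega>. sin (?L \<omega>)) = 0"
    by (auto simp: complex_eq_iff)
qed

text \<open>What is left of \<open>X i\<close> after linear regression on \<open>X j\<close>. As
  \<open>X j\<close> has unit variance, the regression coefficient is the covariance
  \<open>R j i\<close>.\<close>

definition residual :: "'i \<Rightarrow> 'i \<Rightarrow> 'a \<Rightarrow> real" where
  "residual j i \<omega> = X i \<omega> - R j i * X j \<omega>"

lemma residual_measurable[measurable]: "residual j i \<in> borel_measurable M"
  unfolding residual_def by simp

lemma residual_lin_comb:
  assumes "finite J"
  shows "\<exists>b. \<forall>\<omega>. t * X j \<omega> + (\<Sum>i\<in>J. s i * residual j i \<omega>) = (\<Sum>i\<in>insert j J. b i * X i \<omega>)"
proof (intro exI allI)
  fix \<omega>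
  \<comment> \<open>\<open>j\<close> may or may not belong to \<open>J\<close>; its two
    contributions are added instead of being distinguished by cases.\<close>
  let ?b = "\<lambda>i. (if i \<in> J then s i else 0) + (if i = j then t - (\<Sum>i\<in>J. s i * R j i) else 0)"
  have "(\<Sum>i\<in>insert j J. ?b i * X i \<omega>) =
     (\<Sum>i\<in>insert j J. (if i \<in> J then s i else 0) * X i \<omega>) +
     (\<Sum>i\<in>insert j J. (if i = j then t - (\<Sum>i\<in>J. s i * R j i) else 0) * X i \<omega>)"
    by (simp add: algebra_simps sum.distrib)
  also have "(\<Sum>i\<in>insert j J. (if i \<in> J then s i else 0) * X i \<omega>) = (\<Sum>i\<in>J. s i * X i \<omega>)"
    using assms by (intro sum.mono_neutral_cong_right) auto
  also have "(\<Sum>i\<in>insert j J. (if i = j then t - (\<Sum>i\<in>J. s i * R j i) else 0) * X i \<omega>) =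
      (t - (\<Sum>i\<in>J. s i * R j i)) * X j \<omega>"
    using assms by (subst sum.mono_neutral_cong_right[of _ "{j}"]) auto
  finally show "t * X j \<omega> + (\<Sum>i\<in>J. s i * residual j i \<omega>) = (\<Sum>i\<in>insert j J. ?b i * X i \<omega>)"
    by (simp add: residual_def algebra_simps sum_subtractf sum_distrib_left)
qed

text \<open>Residuals are uncorrelated with \<open>X j\<close>, so the variances add and the
  Gaussian characteristic function factorises. This is the point where joint Gaussianity turns
  vanishing correlation into independence.\<close>

lemma residual_cos_sin:
  fixes j :: 'i and s :: "'i \<Rightarrow> real"
  assumes "finite J"
  defines "L \<equiv> \<lambda>\<omega>. \<Sum>i\<in>J. s i * residual j i \<omega>"
  shows "expectation (\<lambda>\<omega>. cos (t * X j \<omega> + L \<omega>)) = exp (- t\<^sup>2 / 2) * expectation (\<lambda>\<omega>. cos (L \<omega>))"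
    and "expectation (\<lambda>\<omega>. sin (t * X j \<omega> + L \<omega>)) = 0"
proof -
  \<comment> \<open>\<open>b0\<close> belongs to t = 0 and represents \<open>L\<close> itself, for
    the integrability of its square and for its transform.\<close>
  obtain b b0 where b: "\<And>\<omega>. t * X j \<omega> + L \<omega> = (\<Sum>i\<in>insert j J. b i * X i \<omega>)"
    and b0: "\<And>\<omega>. 0 * X j \<omega> + L \<omega> = (\<Sum>i\<in>insert j J. b0 i * X i \<omega>)"
    using residual_lin_comb[OF assms(1), of t j s] residual_lin_comb[OF assms(1), of 0 j s]
    unfolding L_def by blast
  have ir: "integrable M (\<lambda>\<omega>. X j \<omega> * residual j i \<omega>)" for i
  proof -
    have "X j \<omega> * residual j i \<omega> = X j \<omega> * X i \<omega> - R j i * (X j \<omega> * X j \<omega>)" for \<omega>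
      by (simp add: residual_def algebra_simps)
    then show ?thesis using integrable_XX by simp
  qed
  have er: "expectation (\<lambda>\<omega>. X j \<omega> * residual j i \<omega>) = 0" for i
  proof -
    have "expectation (\<lambda>\<omega>. X j \<omega> * residual j i \<omega>) = expectation (\<lambda>\<omega>. X j \<omega> * X i \<omega> - R j i * (X j \<omega>)\<^sup>2)"
      unfolding residual_def by (simp add: algebra_simps power2_eq_square)
    also have "\<dots> = R j i - R j i * 1"
      using integrable_XX[of j i] integrable_X_power[of j 2] by (simp add: R_def var1)
    finally show ?thesis by simp
  qed
  have XL: "integrable M (\<lambda>\<omega>. X j \<omega> * L \<omega>)" "expectation (\<lambda>\<omega>. X j \<omega> * L \<omega>) = 0"
  proof -
    have e: "X j \<omega> * L \<omega> = (\<Sum>i\<in>J. s i * (X j \<omega> * residual j i \<omega>))" for \<omega>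
      by (simp add: L_def sum_distrib_left mult_ac)
    show "integrable M (\<lambda>\<omega>. X j \<omega> * L \<omega>)" "expectation (\<lambda>\<omega>. X j \<omega> * L \<omega>) = 0"
      unfolding e using ir er by auto
  qed
  have L2: "integrable M (\<lambda>\<omega>. (L \<omega>)\<^sup>2)"
  proof -
    have "(L \<omega>)\<^sup>2 = (\<Sum>i\<in>insert j J. \<Sum>k\<in>insert j J. b0 i * b0 k * (X i \<omega> * X k \<omega>))" for \<omega>
      using b0[of \<omega>] by (simp add: power2_eq_square sum_product mult_ac del: sum.insert_if sum.insert)
    then show ?thesis using integrable_XX by auto
  qed
  have "(t * X j \<omega> + L \<omega>)\<^sup>2 = t\<^sup>2 * (X j \<omega>)\<^sup>2 + 2 * t * (X j \<omega> * L \<omega>) + (L \<omega>)\<^sup>2" for \<omega>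
    by (simp add: power2_eq_square algebra_simps)
  then have v: "expectation (\<lambda>\<omega>. (t * X j \<omega> + L \<omega>)\<^sup>2) = t\<^sup>2 + expectation (\<lambda>\<omega>. (L \<omega>)\<^sup>2)"
    using XL L2 integrable_X_power[of j 2] by (simp add: var1)
  have fin: "finite (insert j J)" using assms by simp
  show "expectation (\<lambda>\<omega>. cos (t * X j \<omega> + L \<omega>)) = exp (- t\<^sup>2 / 2) * expectation (\<lambda>\<omega>. cos (L \<omega>))"
    using lin_comb_cos_sin(1)[OF fin, of b, folded b] lin_comb_cos_sin(1)[OF fin, of b0, folded b0] v
    by (simp add: exp_add[symmetric] add_divide_distrib diff_divide_distrib)
  show "expectation (\<lambda>\<omega>. sin (t * X j \<omega> + L \<omega>)) = 0"
    using lin_comb_cos_sin(2)[OF fin, of b, folded b] by simp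
qed

text \<open>Passes from trigonometric functions of \<open>X j\<close> to indicators of
  \<open>X j\<close>: under the weights 1 + g(L) and 1 + E g(L) the variable \<open>X j\<close> has
  the same transforms, hence the same weighted law. The summand 1 again keeps the weights
  nonnegative.\<close>

lemma residual_indep_trig:
  fixes j :: 'i and s :: "'i \<Rightarrow> real"
  assumes "finite J" and B[measurable]: "B \<in> sets borel" and g: "g = cos \<or> g = sin"
  defines "L \<equiv> \<lambda>\<omega>. \<Sum>i\<in>J. s i * residual j i \<omega>"
  shows "expectation (\<lambda>\<omega>. indicator B (X j \<omega>) * g (L \<omega>)) =
    expectation (\<lambda>\<omega>. indicator B (X j \<omega>)) * expectation (\<lambda>\<omega>. g (L \<omega>))"
proof -
  note cs = residual_cos_sin[OF assms(1), where s=s and j=j, folded L_def]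
  have cs': "expectation (\<lambda>\<omega>. cos (t * X j \<omega> - L \<omega>)) = exp (- t\<^sup>2 / 2) * expectation (\<lambda>\<omega>. cos (L \<omega>))"
    "expectation (\<lambda>\<omega>. sin (t * X j \<omega> - L \<omega>)) = 0" for t
    using residual_cos_sin[OF assms(1), of t j "\<lambda>i. - s i"] by (simp_all add: L_def sum_negf)
  have [measurable]: "L \<in> borel_measurable M" unfolding L_def by simp
  have [measurable]: "g \<in> borel_measurable borel" using g by auto
  have gb: "\<bar>g x\<bar> \<le> 1" for x using g by auto
  have gb': "0 \<le> 1 + g x" for x using gb[of x] by linarith
  have ib: "integrable M h" if "h \<in> borel_measurable M" "\<And>\<omega>. \<bar>h \<omega>\<bar> \<le> 1" for h :: "'a \<Rightarrow> real"
    using that by (intro integrable_const_bound[where B=1]) auto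
  have exp_t: "expectation (\<lambda>\<omega>. cos (t * X j \<omega>)) = exp (- t\<^sup>2 / 2)" "expectation (\<lambda>\<omega>. sin (t * X j \<omega>)) = 0" for t
    using residual_cos_sin[of "{}" t j] by (auto simp: prob_space)
  have exp_gh: "expectation (\<lambda>\<omega>. g (L \<omega>) * h (t * X j \<omega>)) =
      expectation (\<lambda>\<omega>. g (L \<omega>)) * expectation (\<lambda>\<omega>. h (t * X j \<omega>))" if h: "h = cos \<or> h = sin" for h t
  proof -
    have exp_comb: "expectation (\<lambda>\<omega>. a * f (t * X j \<omega> + L \<omega>) + b * f (t * X j \<omega> - L \<omega>)) =
      a * expectation (\<lambda>\<omega>. f (t * X j \<omega> + L \<omega>)) + b * expectation (\<lambda>\<omega>. f (t * X j \<omega> - L \<omega>))"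
      if "f = cos \<or> f = sin" for f :: "real \<Rightarrow> real" and a b
      using that by (auto intro!: Bochner_Integration.integral_add[THEN trans] integrable_mult_right ib)
    have t: "expectation (\<lambda>\<omega>. cos (t * X j \<omega> + L \<omega>)) = exp (- t\<^sup>2 / 2) * expectation (\<lambda>\<omega>. cos (L \<omega>))"
      "expectation (\<lambda>\<omega>. sin (t * X j \<omega> + L \<omega>)) = 0"
      "expectation (\<lambda>\<omega>. cos (t * X j \<omega> - L \<omega>)) = exp (- t\<^sup>2 / 2) * expectation (\<lambda>\<omega>. cos (L \<omega>))"
      "expectation (\<lambda>\<omega>. sin (t * X j \<omega> - L \<omega>)) = 0"
      using cs[of t] cs'[of t] by (simp_all only: L_def)
    have s0: "expectation (\<lambda>\<omega>. sin (L \<omega>)) = 0" using cs(2)[of 0] by (simp add: L_def)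
    have 1: "cos y * cos x = (1/2) * cos (x + y) + (1/2) * cos (x - y)" for x y :: real by (simp add: cos_add cos_diff field_simps)
    have 2: "cos y * sin x = (1/2) * sin (x + y) + (1/2) * sin (x - y)" for x y :: real by (simp add: sin_add sin_diff field_simps)
    have 3: "sin y * cos x = (1/2) * sin (x + y) + (-1/2) * sin (x - y)" for x y :: real by (simp add: sin_add sin_diff field_simps)
    have 4: "sin y * sin x = (-1/2) * cos (x + y) + (1/2) * cos (x - y)" for x y :: real by (simp add: cos_add cos_diff field_simps)
    consider "g = cos" "h = cos" | "g = cos" "h = sin" | "g = sin" "h = cos" | "g = sin" "h = sin" using g h by blast
    then show ?thesis
    proof cases
      case 1 then show ?thesis using exp_comb[of cos "1/2" "1/2"] t exp_t[of t]
        by (simp only: \<open>\<And>x y. cos y * cos x = _\<close>) simp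
    next
      case 2 then show ?thesis using exp_comb[of sin "1/2" "1/2"] t exp_t[of t]
        by (simp only: \<open>\<And>x y. cos y * sin x = _\<close>) simp
    next
      case 3 then show ?thesis using exp_comb[of sin "1/2" "-1/2"] t exp_t[of t] s0
        by (simp only: \<open>\<And>x y. sin y * cos x = _\<close>) simp
    next
      case 4 then show ?thesis using exp_comb[of cos "-1/2" "1/2"] t exp_t[of t] s0
        by (simp only: \<open>\<And>x y. sin y * sin x = _\<close>) simp
    qed
  qed
  let ?G = "expectation (\<lambda>\<omega>. g (L \<omega>))"
  have ig: "integrable M (\<lambda>\<omega>. g (L \<omega>))" by (rule ib) (auto simp: gb)
  have G1: "\<bar>?G\<bar> \<le> 1"
    using gb by (intro order_trans[OF integral_abs_bound] integral_le_const integrable_abs ig) auto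
  have lin: "expectation (\<lambda>\<omega>. (1 + g (L \<omega>)) * h \<omega>) = expectation h + expectation (\<lambda>\<omega>. g (L \<omega>) * h \<omega>)"
    if [measurable]: "h \<in> borel_measurable M" and hb: "\<And>\<omega>. \<bar>h \<omega>\<bar> \<le> 1" for h
  proof -
    have "expectation (\<lambda>\<omega>. (1 + g (L \<omega>)) * h \<omega>) = expectation (\<lambda>\<omega>. h \<omega> + g (L \<omega>) * h \<omega>)"
      by (simp add: algebra_simps)
    also have "\<dots> = expectation h + expectation (\<lambda>\<omega>. g (L \<omega>) * h \<omega>)"
      using hb gb by (intro Bochner_Integration.integral_add ib) (auto simp: abs_mult intro: mult_le_one)
    finally show ?thesis .
  qed
  have "expectation (\<lambda>\<omega>. (1 + g (L \<omega>)) * indicator B (X j \<omega>)) =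
        expectation (\<lambda>\<omega>. (1 + ?G) * indicator B (X j \<omega>))"
  proof (rule weighted_law_eqI)
    show "integrable M (\<lambda>\<omega>. 1 + g (L \<omega>))" using ig by simp
    fix t
    show "expectation (\<lambda>\<omega>. (1 + g (L \<omega>)) * cos (t * X j \<omega>)) = expectation (\<lambda>\<omega>. (1 + ?G) * cos (t * X j \<omega>))"
      by (subst lin) (simp_all add: exp_gh, simp_all add: algebra_simps)
    show "expectation (\<lambda>\<omega>. (1 + g (L \<omega>)) * sin (t * X j \<omega>)) = expectation (\<lambda>\<omega>. (1 + ?G) * sin (t * X j \<omega>))"
      by (subst lin) (simp_all add: exp_gh, simp_all add: algebra_simps)
  qed (use gb' G1 in auto)
  then have "expectation (\<lambda>\<omega>. g (L \<omega>) * indicator B (X j \<omega>)) = ?G * expectation (\<lambda>\<omega>. indicator B (X j \<omega>))"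
    by (subst (asm) lin) (simp_all, simp add: algebra_simps)
  then show ?thesis by (simp add: mult.commute)
qed

text \<open>The same passage with exchanged roles: the indicator of \<open>X j\<close> and its
  constant expectation are now the two weights, and the residuals form the vector.\<close>

lemma residual_indep_rect:
  assumes J: "finite J" and B[measurable]: "B \<in> sets borel" and A: "\<And>i. i \<in> J \<Longrightarrow> A i \<in> sets borel"
  shows "expectation (\<lambda>\<omega>. indicator B (X j \<omega>) * (\<Prod>i\<in>J. indicator (A i) (residual j i \<omega>))) =
     expectation (\<lambda>\<omega>. indicator B (X j \<omega>)) * expectation (\<lambda>\<omega>. \<Prod>i\<in>J. indicator (A i) (residual j i \<omega>) :: real)"
proof -
  have "expectation (\<lambda>\<omega>. indicator B (X j \<omega>) * (\<Prod>i\<in>J. indicator (A i) (residual j i \<omega>) :: real)) =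
     expectation (\<lambda>\<omega>. expectation (\<lambda>\<omega>. indicator B (X j \<omega>)) * (\<Prod>i\<in>J. indicator (A i) (residual j i \<omega>)))"
    by (rule weighted_vector_law_eqI[OF J, where Y="residual j" and A=A and ?w1.0="\<lambda>\<omega>. indicator B (X j \<omega>)"
          and ?w2.0="\<lambda>\<omega>. expectation (\<lambda>\<omega>. indicator B (X j \<omega>))"])
      (use A residual_indep_trig[OF J B] in \<open>auto intro!: integrable_const_bound[where B=1] Bochner_Integration.integral_nonneg\<close>)
  then show ?thesis by simp
qed

lemma distr_X: "distr M borel (X j) = std_normal_distribution"
proof -
  have "distr M borel (X j) = gaussian_law 0 1"
    using lin_comb_law[of "{j}" "\<lambda>_. 1"] var1[of j] by simp
  also have "\<dots> = std_normal_distribution" by (simp add: gaussian_law_def)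
  finally show ?thesis .
qed

text \<open>Preimages of Borel sets under \<open>X j\<close> and of cylinder sets under the
  residuals form intersection-stable generators, so independence on rectangles passes to the
  generated sigma-algebras. The product form over all indices at once is what Fubini needs in
  \<open>stein\<close>.\<close>

lemma distr_X_residual:
  "distr M (borel \<Otimes>\<^sub>M PiM UNIV (\<lambda>_. borel)) (\<lambda>\<omega>. (X j \<omega>, \<lambda>i. residual j i \<omega>)) =
     std_normal_distribution \<Otimes>\<^sub>M distr M (PiM UNIV (\<lambda>_. borel)) (\<lambda>\<omega> i. residual j i \<omega>)"
proof -
  let ?P = "PiM UNIV (\<lambda>_::'i. borel :: real measure)"
  let ?Y = "\<lambda>\<omega> i. residual j i \<omega>"
  have Ym[measurable]: "?Y \<in> measurable M ?P"
    by (rule measurable_PiM_single') auto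
  let ?A = "{X j -` A \<inter> space M |A. A \<in> sets borel}"
  let ?E = "{?Y -` A \<inter> space M |A. A \<in> prod_algebra UNIV (\<lambda>_::'i. borel :: real measure)}"
  have E: "{?Y -` A \<inter> space M |A. A \<in> sets ?P} = sigma_sets (space M) ?E"
    unfolding sets_PiM by (rule sigma_sets_vimage_commute) auto
  have ind: "indep_set ?A ?E"
    unfolding indep_sets2_eq
  proof (intro conjI ballI)
    show "?A \<subseteq> events" by (auto intro: measurable_sets)
    show "?E \<subseteq> events" using Ym
      by (auto simp: sets_PiM intro!: measurable_sets[OF Ym])
    fix a b assume "a \<in> ?A" "b \<in> ?E"
    then obtain B K where B[measurable]: "B \<in> sets borel" and a: "a = X j -` B \<inter> space M"
      and K: "K \<in> prod_algebra UNIV (\<lambda>_::'i. borel :: real measure)" and b: "b = ?Y -` K \<inter> space M" by auto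
    from K obtain J A where KA: "K = prod_emb UNIV (\<lambda>_. borel) J (Pi\<^sub>E J A)" and J: "finite J"
      and A: "\<And>i. i \<in> J \<Longrightarrow> A i \<in> sets borel"
      by (auto elim!: prod_algebraE)
    have [measurable]: "a \<in> events" "b \<in> events" using \<open>a \<in> ?A\<close> \<open>b \<in> ?E\<close> \<open>?A \<subseteq> events\<close> \<open>?E \<subseteq> events\<close> by auto
    have ia: "indicator a \<omega> = (indicator B (X j \<omega>) :: real)" if "\<omega> \<in> space M" for \<omega>
      using that by (auto simp: a indicator_def)
    have ib: "indicator b \<omega> = (\<Prod>i\<in>J. indicator (A i) (residual j i \<omega>) :: real)" if "\<omega> \<in> space M" for \<omega>
      using that J by (auto simp: b KA indicator_def prod_emb_def PiE_iff if_distrib[of "\<lambda>x. x = _"] intro!: prod.neutral)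
    have "prob (a \<inter> b) = expectation (\<lambda>\<omega>. indicator a \<omega> * indicator b \<omega>)"
      by (simp add: indicator_inter_arith[symmetric])
    also have "\<dots> = expectation (\<lambda>\<omega>. indicator B (X j \<omega>) * (\<Prod>i\<in>J. indicator (A i) (residual j i \<omega>)))"
      by (intro Bochner_Integration.integral_cong) (auto simp: ia ib)
    also have "\<dots> = expectation (\<lambda>\<omega>. indicator B (X j \<omega>)) * expectation (\<lambda>\<omega>. \<Prod>i\<in>J. indicator (A i) (residual j i \<omega>))"
      by (rule residual_indep_rect[OF J B A])
    also have "expectation (\<lambda>\<omega>. indicator B (X j \<omega>)) = (expectation (indicator a) :: real)"
      by (intro Bochner_Integration.integral_cong) (auto simp: ia)
    also have "expectation (\<lambda>\<omega>. \<Prod>i\<in>J. indicator (A i) (residual j i \<omega>)) = (expectation (indicator b) :: real)"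
      by (intro Bochner_Integration.integral_cong) (auto simp: ib)
    finally show "prob (a \<inter> b) = prob a * prob b" by simp
  qed
  have iA: "Int_stable ?A"
  proof (rule Int_stableI)
    fix a b assume "a \<in> ?A" "b \<in> ?A"
    then obtain B C where "B \<in> sets borel" "a = X j -` B \<inter> space M" "C \<in> sets borel" "b = X j -` C \<inter> space M" by auto
    then show "a \<inter> b \<in> ?A" by (intro CollectI exI[of _ "B \<inter> C"]) auto
  qed
  have iE: "Int_stable ?E"
  proof (rule Int_stableI)
    fix a b assume "a \<in> ?E" "b \<in> ?E"
    then obtain B C where "B \<in> prod_algebra UNIV (\<lambda>_::'i. borel :: real measure)" "a = ?Y -` B \<inter> space M"
       "C \<in> prod_algebra UNIV (\<lambda>_::'i. borel :: real measure)" "b = ?Y -` C \<inter> space M" by auto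
    then show "a \<inter> b \<in> ?E"
      using Int_stable_prod_algebra[of UNIV "\<lambda>_::'i. borel :: real measure"]
      by (intro CollectI exI[of _ "B \<inter> C"]) (auto simp: Int_stable_def)
  qed
  have iA': "sigma_sets (space M) ?A = ?A"
    using sigma_sets_vimage_commute[of "X j" "space M" UNIV "sets borel"] sets.sigma_sets_eq[of "borel :: real measure"]
    by simp
  have ind2: "indep_set ?A (sigma_sets (space M) ?E)"
    using indep_set_sigma_sets[OF ind iA iE] iA' by simp
  have *: "prob ((X j -` A \<inter> space M) \<inter> (?Y -` B \<inter> space M)) = prob (X j -` A \<inter> space M) * prob (?Y -` B \<inter> space M)"
    if "A \<in> sets borel" "B \<in> sets ?P" for A B
    using that by (intro indep_setD[OF ind2]) (auto simp: E[symmetric])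
  interpret Z: prob_space "distr M borel (X j)" by (rule prob_space_distr) simp
  interpret V: prob_space "distr M ?P ?Y" by (rule prob_space_distr) simp
  have "distr M borel (X j) \<Otimes>\<^sub>M distr M ?P ?Y = distr M (borel \<Otimes>\<^sub>M ?P) (\<lambda>\<omega>. (X j \<omega>, ?Y \<omega>))"
  proof (rule pair_measure_eqI)
    fix A B assume AB: "A \<in> sets (distr M borel (X j))" "B \<in> sets (distr M ?P ?Y)"
    have e: "(\<lambda>\<omega>. (X j \<omega>, ?Y \<omega>)) -` (A \<times> B) \<inter> space M = (X j -` A \<inter> space M) \<inter> (?Y -` B \<inter> space M)" by auto
    have "emeasure (distr M (borel \<Otimes>\<^sub>M ?P) (\<lambda>\<omega>. (X j \<omega>, ?Y \<omega>))) (A \<times> B) =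
       ennreal (prob ((X j -` A \<inter> space M) \<inter> (?Y -` B \<inter> space M)))"
      using AB by (subst emeasure_distr) (auto simp: e emeasure_eq_measure)
    also have "\<dots> = ennreal (prob (X j -` A \<inter> space M)) * ennreal (prob (?Y -` B \<inter> space M))"
      using AB by (subst *) (auto simp: ennreal_mult)
    also have "\<dots> = emeasure (distr M borel (X j)) A * emeasure (distr M ?P ?Y) B"
      using AB by (auto simp: emeasure_distr emeasure_eq_measure)
    finally show "emeasure (distr M borel (X j)) A * emeasure (distr M ?P ?Y) B =
       emeasure (distr M (borel \<Otimes>\<^sub>M ?P) (\<lambda>\<omega>. (X j \<omega>, ?Y \<omega>))) (A \<times> B)" by simp
  qed (auto intro: Z.sigma_finite_measure_axioms V.sigma_finite_measure_axioms cong: sets_pair_measure_cong)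
  then show ?thesis by (simp add: distr_X)
qed

end

section \<open>Gaussian integration by parts\<close>

text \<open>Removes a boundary term in the integration by parts.\<close>

lemma poly_std_normal_density_tendsto_0_at_top:
  "((\<lambda>x. poly p x * std_normal_density x) \<longlongrightarrow> 0) at_top"
proof -
  have *: "((\<lambda>x. x ^ k * std_normal_density x) \<longlongrightarrow> 0) at_top" for k
  proof (rule Lim_null_comparison)
    show "((\<lambda>x::real. x ^ k / exp x) \<longlongrightarrow> 0) at_top" by (rule tendsto_power_div_exp_0)
    show "\<forall>\<^sub>F x in at_top. norm (x ^ k * std_normal_density x) \<le> x ^ k / exp x"
      \<comment> \<open>From 2 on, x^2 / 2 is at least x, so the density stays below exp (-
        x).\<close>
      using eventually_ge_at_top[of "2::real"]
    proof eventually_elim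
      case (elim x)
      have "sqrt (2 * pi) \<ge> 1" using pi_ge_two by (intro real_le_rsqrt) simp
      then have "1 / sqrt (2 * pi) \<le> 1" by simp
      moreover have "exp (- x\<^sup>2 / 2) \<le> exp (- x)"
        using elim by (simp add: power2_eq_square)
      ultimately have "std_normal_density x \<le> 1 * exp (- x)"
        unfolding std_normal_density_def by (intro mult_mono) auto
      then show ?case
        using elim by (simp add: abs_mult exp_minus divide_inverse mult_left_mono)
    qed
  qed
  show ?thesis
    unfolding poly_altdef sum_distrib_right mult.assoc by (intro tendsto_null_sum tendsto_mult_right_zero *)
qed

lemma poly_std_normal_density_tendsto_0_at_bot:
  "((\<lambda>x. poly p x * std_normal_density x) \<longlongrightarrow> 0) at_bot"
proof -
  have "poly p (- x) * std_normal_density (- x) = poly (pcompose p [:0, -1:]) x * std_normal_density x" for x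
    by (simp add: poly_pcompose std_normal_density_def)
  then show ?thesis
    using poly_std_normal_density_tendsto_0_at_top[of "pcompose p [:0, -1:]"]
    by (simp add: filterlim_at_bot_mirror)
qed

lemma integrable_std_normal_poly_bound:
  assumes [measurable]: "h \<in> borel_measurable borel" and "\<And>z::real. \<bar>h z :: real\<bar> \<le> poly p z"
  shows "integrable std_normal_distribution h"
  using assms(2) abs_ge_self order_trans
  by (intro Bochner_Integration.integrable_bound[OF integrable_std_normal_poly[of p]]) (auto intro!: AE_I2, blast)

text \<open>The fundamental theorem of calculus for \<open>h * std_normal_density\<close>, whose
  derivative is \<open>(h' - z * h) * std_normal_density\<close>. The polynomial bounds secure
  integrability and make both boundary terms vanish.\<close>

lemma std_normal_integration_by_parts:
  fixes h h' :: "real \<Rightarrow> real"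
  assumes D: "\<And>z. (h has_real_derivative h' z) (at z)" and c: "continuous_on UNIV h'"
    and p: "\<And>z. \<bar>h z\<bar> \<le> poly p z" and p': "\<And>z. \<bar>h' z\<bar> \<le> poly p' z"
  shows "(LINT z|std_normal_distribution. z * h z) = (LINT z|std_normal_distribution. h' z)"
proof -
  have ch: "continuous_on UNIV h" using D by (auto intro!: DERIV_continuous_on)
  have [measurable]: "h \<in> borel_measurable borel" "h' \<in> borel_measurable borel"
    using ch c by (auto intro: borel_measurable_continuous_onI)
  have i': "integrable std_normal_distribution h'" by (rule integrable_std_normal_poly_bound[OF _ p']) simp
  have iz: "integrable std_normal_distribution (\<lambda>z. z * h z)"
  proof (rule integrable_std_normal_poly_bound)
    fix z :: real
    \<comment> \<open>The absolute value is not a polynomial; majorising it by 1 + z^2 yields the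
      polynomial bound \<open>[:1, 0, 1:] * p\<close>.\<close>
    have "\<bar>z\<bar> \<le> 1 + z\<^sup>2" using zero_le_power2[of "\<bar>z\<bar> - 1"] by (simp add: power2_diff)
    then have "\<bar>z\<bar> * \<bar>h z\<bar> \<le> (1 + z\<^sup>2) * poly p z"
      using p[of z] by (intro mult_mono) auto
    then show "\<bar>z * h z\<bar> \<le> poly ([:1, 0, 1:] * p) z"
      by (simp add: abs_mult power2_eq_square algebra_simps)
  qed simp
  let ?F = "\<lambda>z. h z * std_normal_density z"
  let ?f = "\<lambda>z. (h' z - z * h z) * std_normal_density z"
  have Fb: "\<bar>?F z\<bar> \<le> poly p z * std_normal_density z" for z
    using p[of z] by (auto simp: abs_mult intro!: mult_right_mono)
  have int: "integrable lborel ?f"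
    using Bochner_Integration.integrable_diff[OF i' iz] by (subst (asm) integrable_density) (auto simp: mult.commute)
  have "(LBINT z=-\<infinity>..\<infinity>. ?f z) = 0 - 0"
  proof (rule interval_integral_FTC_integrable)
    fix z :: real
    have "(std_normal_density has_real_derivative (- z * std_normal_density z)) (at z)"
    proof -
      have "((\<lambda>x. exp (- x\<^sup>2 / 2)) has_real_derivative (- z * exp (- z\<^sup>2 / 2))) (at z)"
        by (auto intro!: derivative_eq_intros)
      from DERIV_cmult[OF this, of "1 / sqrt (2 * pi)"] show ?thesis
        unfolding std_normal_density_def[abs_def] by (rule DERIV_cong) simp
    qed
    from DERIV_mult[OF D[of z] this]
    show "(?F has_vector_derivative ?f z) (at z)"
      unfolding has_real_derivative_iff_has_vector_derivative[symmetric]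
      by (rule DERIV_cong) (simp add: algebra_simps)
    show "isCont ?f z"
      using c ch unfolding std_normal_density_def
      by (intro continuous_intros) (auto simp: continuous_on_eq_continuous_at)
  next
    show "set_integrable lborel (einterval (- \<infinity>) \<infinity>) ?f" using int by (simp add: set_integrable_def)
    show "((?F \<circ> real_of_ereal) \<longlongrightarrow> 0) (at_right (- \<infinity>))"
      unfolding ereal_tendsto_simps
      by (rule Lim_null_comparison[OF _ poly_std_normal_density_tendsto_0_at_bot[of p]]) (use Fb in auto)
    show "((?F \<circ> real_of_ereal) \<longlongrightarrow> 0) (at_left \<infinity>)"
      unfolding ereal_tendsto_simps
      by (rule Lim_null_comparison[OF _ poly_std_normal_density_tendsto_0_at_top[of p]]) (use Fb in auto)
  qed simp
  then have "integral\<^sup>L lborel ?f = 0"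
    by (simp add: interval_lebesgue_integral_def set_lebesgue_integral_def)
  then have "(LINT z|std_normal_distribution. h' z - z * h z) = 0"
    by (subst integral_density) (auto simp: mult.commute)
  then show ?thesis using i' iz by simp
qed

lemma integrable_nonneg_le:
  fixes f g :: "'a \<Rightarrow> real"
  assumes "integrable M g" "f \<in> borel_measurable M" "\<And>\<omega>. 0 \<le> f \<omega>" "\<And>\<omega>. f \<omega> \<le> g \<omega>"
  shows "integrable M f"
proof (rule Bochner_Integration.integrable_bound[OF assms(1,2)], rule AE_I2)
  fix \<omega> show "norm (f \<omega>) \<le> norm (g \<omega>)"
    using assms(3)[of \<omega>] assms(4)[of \<omega>] by simp
qed

context std_gaussian_field
begin

text \<open>Functions of the whole path to which the one-dimensional formula applies conditionally:
  with the residuals of \<open>X j\<close> frozen at \<open>y\<close>, only the coordinate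
  \<open>z\<close> moves, along a line in direction \<open>R j\<close>. The polynomial bound may
  depend on \<open>y\<close>, since it is applied to one \<open>y\<close> at a time. Moments of all
  orders are included so that products stay in the class.\<close>

definition tame :: "'i \<Rightarrow> (('i \<Rightarrow> real) \<Rightarrow> real) \<Rightarrow> bool" where
  "tame j \<psi> \<longleftrightarrow> \<psi> \<in> borel_measurable (PiM UNIV (\<lambda>_. borel)) \<and>
     (\<forall>y. continuous_on UNIV (\<lambda>z. \<psi> (\<lambda>i. y i + z * R j i))) \<and>
     (\<forall>y. \<exists>p. \<forall>z. \<bar>\<psi> (\<lambda>i. y i + z * R j i)\<bar> \<le> poly p z) \<and>
     (\<forall>n. integrable M (\<lambda>\<omega>. \<bar>\<psi> (\<lambda>i. X i \<omega>)\<bar> ^ n))"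

lemma field_measurable[measurable]: "(\<lambda>\<omega> i. X i \<omega>) \<in> measurable M (PiM UNIV (\<lambda>_. borel))"
  by (rule measurable_PiM_single') auto

lemma tame_measurable: "tame j \<psi> \<Longrightarrow> \<psi> \<in> borel_measurable (PiM UNIV (\<lambda>_. borel))"
  by (simp add: tame_def)

lemma tame_field_measurable: "tame j \<psi> \<Longrightarrow> (\<lambda>\<omega>. \<psi> (\<lambda>i. X i \<omega>)) \<in> borel_measurable M"
  using measurable_compose[OF field_measurable tame_measurable] .

lemma tame_continuous: "tame j \<psi> \<Longrightarrow> continuous_on UNIV (\<lambda>z. \<psi> (\<lambda>i. y i + z * R j i))"
  by (simp add: tame_def)

lemma tame_growth: "tame j \<psi> \<Longrightarrow> \<exists>p. \<forall>z. \<bar>\<psi> (\<lambda>i. y i + z * R j i)\<bar> \<le> poly p z"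
  by (simp add: tame_def)

lemma tame_moments: "tame j \<psi> \<Longrightarrow> integrable M (\<lambda>\<omega>. \<bar>\<psi> (\<lambda>i. X i \<omega>)\<bar> ^ n)"
  by (simp add: tame_def)

lemma tame_const: "tame j (\<lambda>_. c)"
  unfolding tame_def by (auto intro!: exI[of _ "[:\<bar>c\<bar>:]"])

lemma tame_coord: "tame j (\<lambda>x. x i)"
  unfolding tame_def
proof (intro conjI allI)
  fix y :: "'i \<Rightarrow> real" and n :: nat
  show "continuous_on UNIV (\<lambda>z. y i + z * R j i)" by (intro continuous_intros)
  have "\<bar>u\<bar> \<le> 1 + u\<^sup>2" for u :: real using zero_le_power2[of "\<bar>u\<bar> - 1"] by (simp add: power2_diff)
  then show "\<exists>p. \<forall>z. \<bar>y i + z * R j i\<bar> \<le> poly p z"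
    by (intro exI[of _ "[:1:] + [:y i, R j i:]^2"]) simp
  show "integrable M (\<lambda>\<omega>. \<bar>X i \<omega>\<bar> ^ n)"
    using integrable_abs[OF integrable_X_power[of i n]] by (simp add: power_abs)
qed simp

lemma tame_add:
  assumes "tame j f" "tame j g" shows "tame j (\<lambda>x. f x + g x)"
proof -
  note [measurable] = assms[THEN tame_measurable] assms[THEN tame_field_measurable]
  show ?thesis unfolding tame_def
  proof (intro conjI allI)
    fix y :: "'i \<Rightarrow> real" and n :: nat
    show "continuous_on UNIV (\<lambda>z. f (\<lambda>i. y i + z * R j i) + g (\<lambda>i. y i + z * R j i))"
      by (intro continuous_intros tame_continuous assms)
    obtain p where p: "\<forall>z. \<bar>f (\<lambda>i. y i + z * R j i)\<bar> \<le> poly p z"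
      using tame_growth[OF assms(1), of y] by blast
    obtain q where q: "\<forall>z. \<bar>g (\<lambda>i. y i + z * R j i)\<bar> \<le> poly q z"
      using tame_growth[OF assms(2), of y] by blast
    from p q show "\<exists>p. \<forall>z. \<bar>f (\<lambda>i. y i + z * R j i) + g (\<lambda>i. y i + z * R j i)\<bar> \<le> poly p z"
      by (intro exI[of _ "p + q"]) (simp add: order_trans[OF abs_triangle_ineq add_mono])
    have "\<bar>a + b\<bar> ^ n \<le> 2 ^ n * (\<bar>a\<bar> ^ n + \<bar>b\<bar> ^ n)" for a b :: real
    proof -
      have "\<bar>a + b\<bar> ^ n \<le> (2 * max \<bar>a\<bar> \<bar>b\<bar>) ^ n" by (intro power_mono) auto
      also have "\<dots> = 2 ^ n * max \<bar>a\<bar> \<bar>b\<bar> ^ n" by (simp add: power_mult_distrib)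
      also have "\<dots> \<le> 2 ^ n * (\<bar>a\<bar> ^ n + \<bar>b\<bar> ^ n)" by (intro mult_left_mono) (auto simp: max_def)
      finally show ?thesis .
    qed
    then show "integrable M (\<lambda>\<omega>. \<bar>f (\<lambda>i. X i \<omega>) + g (\<lambda>i. X i \<omega>)\<bar> ^ n)"
      by (intro integrable_nonneg_le[OF integrable_mult_right[OF Bochner_Integration.integrable_add[OF
         tame_moments[OF assms(1), of n] tame_moments[OF assms(2), of n]], of "2 ^ n"]])
        (auto simp only: zero_le_power abs_ge_zero, measurable)
  qed simp
qed

lemma tame_mult:
  assumes "tame j f" "tame j g" shows "tame j (\<lambda>x. f x * g x)"
proof -
  note [measurable] = assms[THEN tame_measurable] assms[THEN tame_field_measurable]
  show ?thesis unfolding tame_def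
  proof (intro conjI allI)
    fix y :: "'i \<Rightarrow> real" and n :: nat
    show "continuous_on UNIV (\<lambda>z. f (\<lambda>i. y i + z * R j i) * g (\<lambda>i. y i + z * R j i))"
      by (intro continuous_intros tame_continuous assms)
    obtain p where p: "\<forall>z. \<bar>f (\<lambda>i. y i + z * R j i)\<bar> \<le> poly p z"
      using tame_growth[OF assms(1), of y] by blast
    obtain q where q: "\<forall>z. \<bar>g (\<lambda>i. y i + z * R j i)\<bar> \<le> poly q z"
      using tame_growth[OF assms(2), of y] by blast
    have "0 \<le> poly p z" for z using p abs_ge_zero order_trans by blast
    with p q show "\<exists>p. \<forall>z. \<bar>f (\<lambda>i. y i + z * R j i) * g (\<lambda>i. y i + z * R j i)\<bar> \<le> poly p z"
      by (intro exI[of _ "p * q"]) (simp add: abs_mult mult_mono)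
    have "\<bar>a * b\<bar> ^ n \<le> \<bar>a\<bar> ^ (2 * n) + \<bar>b\<bar> ^ (2 * n)" for a b :: real
    proof -
      have "u * v \<le> u\<^sup>2 + v\<^sup>2" for u v :: real
        using zero_le_power2[of "u - v"] zero_le_power2[of "u"] zero_le_power2[of "v"]
        unfolding power2_diff by linarith
      from this[of "\<bar>a\<bar> ^ n" "\<bar>b\<bar> ^ n"] show ?thesis by (simp add: abs_mult power_mult_distrib power_mult[symmetric] mult.commute)
    qed
    then show "integrable M (\<lambda>\<omega>. \<bar>f (\<lambda>i. X i \<omega>) * g (\<lambda>i. X i \<omega>)\<bar> ^ n)"
      by (intro integrable_nonneg_le[OF Bochner_Integration.integrable_add[OF
         tame_moments[OF assms(1), of "2 * n"] tame_moments[OF assms(2), of "2 * n"]]])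
        (auto simp only: zero_le_power abs_ge_zero, measurable)
  qed simp
qed

lemma tame_sum: "(\<And>k. k \<in> K \<Longrightarrow> tame j (f k)) \<Longrightarrow> tame j (\<lambda>x. \<Sum>k\<in>K. f k x)"
  by (induction K rule: infinite_finite_induct) (auto intro: tame_const tame_add)

lemma tame_poly: "tame j f \<Longrightarrow> tame j (\<lambda>x. poly p (f x))"
  by (induction p) (auto intro!: tame_const tame_add tame_mult)

lemma tame_bounded_comp:
  assumes "tame j f" "continuous_on UNIV g" "\<And>x. \<bar>g x\<bar> \<le> (1::real)" shows "tame j (\<lambda>x. g (f x))"
proof -
  note [measurable] = tame_measurable[OF assms(1)] tame_field_measurable[OF assms(1)]
    borel_measurable_continuous_onI[OF assms(2)]
  show ?thesis unfolding tame_def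
  proof (intro conjI allI)
    fix y :: "'i \<Rightarrow> real" and n :: nat
    show "continuous_on UNIV (\<lambda>z. g (f (\<lambda>i. y i + z * R j i)))"
      using assms by (intro continuous_on_compose2[OF assms(2)]) (auto simp: tame_def)
    show "\<exists>p. \<forall>z. \<bar>g (f (\<lambda>i. y i + z * R j i))\<bar> \<le> poly p z"
      using assms by (intro exI[of _ "[:1:]"]) auto
    show "integrable M (\<lambda>\<omega>. \<bar>g (f (\<lambda>i. X i \<omega>))\<bar> ^ n)"
      using assms(3) by (intro integrable_const_bound[where B=1]) (auto intro!: power_le_one)
  qed simp
qed

lemma tame_integrable: "tame j f \<Longrightarrow> integrable M (\<lambda>\<omega>. f (\<lambda>i. X i \<omega>))"
  using tame_field_measurable[of j f] unfolding tame_def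
  by (subst integrable_abs_iff[symmetric]) (auto dest!: spec[of _ 1])

text \<open>\<open>d\<psi>\<close> is the derivative of \<open>\<psi>\<close> in direction
  \<open>R j\<close>, classically the sum over i of \<open>R j i\<close> times the i-th partial
  derivative. Working with this one directional derivative avoids partial derivatives on the path
  space; the rules below are the usual calculus for it.\<close>

definition stein_pair :: "'i \<Rightarrow> (('i \<Rightarrow> real) \<Rightarrow> real) \<Rightarrow> (('i \<Rightarrow> real) \<Rightarrow> real) \<Rightarrow> bool" where
  "stein_pair j \<psi> d\<psi> \<longleftrightarrow> tame j \<psi> \<and> tame j d\<psi> \<and>
     (\<forall>y z. ((\<lambda>z. \<psi> (\<lambda>i. y i + z * R j i)) has_real_derivative d\<psi> (\<lambda>i. y i + z * R j i)) (at z))"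

lemma stein_pair_cong: "stein_pair j \<psi> d\<psi> \<Longrightarrow> (\<And>x. d\<psi> x = d x) \<Longrightarrow> stein_pair j \<psi> d"
  by (metis ext)

lemma stein_pair_mult:
  assumes "stein_pair j f df" "stein_pair j g dg"
  shows "stein_pair j (\<lambda>x. f x * g x) (\<lambda>x. df x * g x + f x * dg x)"
  using assms unfolding stein_pair_def
  by (auto intro!: tame_add tame_mult derivative_eq_intros simp: algebra_simps)

lemma stein_pair_sum:
  assumes "\<And>k. k \<in> K \<Longrightarrow> stein_pair j (f k) (df k)"
  shows "stein_pair j (\<lambda>x. \<Sum>k\<in>K. f k x) (\<lambda>x. \<Sum>k\<in>K. df k x)"
  using assms unfolding stein_pair_def by (auto intro!: tame_sum derivative_intros)

lemma stein_pair_poly: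
  assumes "stein_pair j f df"
  shows "stein_pair j (\<lambda>x. poly p (f x)) (\<lambda>x. poly (pderiv p) (f x) * df x)"
  using assms unfolding stein_pair_def
  by (auto intro!: tame_poly tame_mult DERIV_chain2[OF poly_DERIV])

lemma stein_pair_coord: "stein_pair j (\<lambda>x. x i) (\<lambda>x. R j i)"
  unfolding stein_pair_def by (auto intro!: tame_coord tame_const derivative_eq_intros)

lemma tame_cos: "tame j f \<Longrightarrow> tame j (\<lambda>x. cos (t * f x))"
  by (rule tame_bounded_comp[where g="\<lambda>x. cos (t * x)"]) (auto intro!: continuous_intros)

lemma tame_sin: "tame j f \<Longrightarrow> tame j (\<lambda>x. sin (t * f x))"
  by (rule tame_bounded_comp[where g="\<lambda>x. sin (t * x)"]) (auto intro!: continuous_intros)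

lemma stein_pair_cos:
  assumes "stein_pair j f df"
  shows "stein_pair j (\<lambda>x. cos (t * f x)) (\<lambda>x. (- t) * (sin (t * f x) * df x))"
  unfolding stein_pair_def
proof (intro conjI allI)
  show "tame j (\<lambda>x. cos (t * f x))" "tame j (\<lambda>x. (- t) * (sin (t * f x) * df x))"
    using assms unfolding stein_pair_def by (intro tame_mult tame_const tame_cos tame_sin; blast)+
qed (use assms in \<open>auto simp: stein_pair_def intro!: derivative_eq_intros\<close>)

lemma stein_pair_sin:
  assumes "stein_pair j f df"
  shows "stein_pair j (\<lambda>x. sin (t * f x)) (\<lambda>x. t * (cos (t * f x) * df x))"
  unfolding stein_pair_def
proof (intro conjI allI)
  show "tame j (\<lambda>x. sin (t * f x))" "tame j (\<lambda>x. t * (cos (t * f x) * df x))"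
    using assms unfolding stein_pair_def by (intro tame_mult tame_const tame_cos tame_sin; blast)+
qed (use assms in \<open>auto simp: stein_pair_def intro!: derivative_eq_intros\<close>)

text \<open>Gaussian integration by parts: writing \<open>X i = residual j i + R j i * X j\<close> with the residual
  independent of \<open>X j\<close> reduces the multivariate identity to the one-dimensional one.\<close>

lemma stein:
  assumes "stein_pair j \<psi> d\<psi>"
  shows "expectation (\<lambda>\<omega>. X j \<omega> * \<psi> (\<lambda>i. X i \<omega>)) = expectation (\<lambda>\<omega>. d\<psi> (\<lambda>i. X i \<omega>))"
proof -
  let ?P = "PiM UNIV (\<lambda>_::'i. borel :: real measure)"
  let ?Y = "\<lambda>\<omega> i. residual j i \<omega>"
  let ?N = "distr M ?P ?Y"
  let ?G = "std_normal_distribution"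
  let ?T = "\<lambda>(z, y) i. y i + z * R j i :: real"
  have t: "tame j \<psi>" "tame j d\<psi>" and D: "\<And>y z. ((\<lambda>z. \<psi> (\<lambda>i. y i + z * R j i)) has_real_derivative d\<psi> (\<lambda>i. y i + z * R j i)) (at z)"
    using assms by (auto simp: stein_pair_def)
  note [measurable] = t[THEN tame_measurable]
  have Ym[measurable]: "?Y \<in> measurable M ?P"
    by (rule measurable_PiM_single') auto
  have Tm[measurable]: "?T \<in> measurable (borel \<Otimes>\<^sub>M ?P) ?P"
    by (rule measurable_PiM_single') (auto simp: split_beta')
  \<comment> \<open>The path is recovered from \<open>X j\<close> and its residuals, affinely in
    \<open>X j\<close>.\<close>
  have rec: "(\<lambda>i. X i \<omega>) = ?T (X j \<omega>, ?Y \<omega>)" for \<omega>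
    by (auto simp: residual_def fun_eq_iff)
  have pm[measurable]: "(\<lambda>\<omega>. (X j \<omega>, ?Y \<omega>)) \<in> measurable M (borel \<Otimes>\<^sub>M ?P)" by simp
  interpret G: prob_space ?G by (rule prob_space_normal_density) simp
  interpret N: prob_space ?N by (rule prob_space_distr) simp
  interpret GN: pair_prob_space ?G ?N ..
  \<comment> \<open>Fubini: by \<open>distr_X_residual\<close> the expectation is an iterated
    integral, the inner one over \<open>X j\<close> with the residuals fixed.\<close>
  have e: "expectation (\<lambda>\<omega>. h (X j \<omega>) (\<lambda>i. X i \<omega>)) = (LINT y|?N. LINT z|?G. h z (\<lambda>i. y i + z * R j i))"
    if i: "integrable M (\<lambda>\<omega>. h (X j \<omega>) (\<lambda>i. X i \<omega>))"
      and m[measurable]: "case_prod h \<in> borel_measurable (borel \<Otimes>\<^sub>M ?P)" for h :: "real \<Rightarrow> ('i \<Rightarrow> real) \<Rightarrow> real"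
  proof -
    have m': "(\<lambda>w. h (fst w) (?T w)) \<in> borel_measurable (borel \<Otimes>\<^sub>M ?P)"
      using measurable_compose[OF measurable_Pair[OF measurable_fst Tm] m] by simp
    have "integrable (?G \<Otimes>\<^sub>M ?N) (\<lambda>w. h (fst w) (?T w))"
      unfolding distr_X_residual[symmetric] using i rec m'
      by (subst integrable_distr_eq[OF pm]) auto
    then have "(LINT y|?N. LINT z|?G. h z (\<lambda>i. y i + z * R j i)) = integral\<^sup>L (?G \<Otimes>\<^sub>M ?N) (\<lambda>w. h (fst w) (?T w))"
      using GN.integral_snd[of "\<lambda>z y. h z (?T (z, y))"] by (simp add: split_beta')
    also have "\<dots> = expectation (\<lambda>\<omega>. h (X j \<omega>) (\<lambda>i. X i \<omega>))"
      unfolding distr_X_residual[symmetric] rec using m'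
      by (subst integral_distr[OF pm]) (auto simp: rec[symmetric])
    finally show ?thesis by simp
  qed
  have "expectation (\<lambda>\<omega>. X j \<omega> * \<psi> (\<lambda>i. X i \<omega>)) = (LINT y|?N. LINT z|?G. z * \<psi> (\<lambda>i. y i + z * R j i))"
    using tame_integrable[OF tame_mult[OF tame_coord[of j j] t(1)]] by (intro e) auto
  also have "\<dots> = (LINT y|?N. LINT z|?G. d\<psi> (\<lambda>i. y i + z * R j i))"
  proof (rule Bochner_Integration.integral_cong[OF refl])
    fix y
    obtain p where "\<forall>z. \<bar>\<psi> (\<lambda>i. y i + z * R j i)\<bar> \<le> poly p z"
      using tame_growth[OF t(1), of y] by blast
    moreover obtain p' where "\<forall>z. \<bar>d\<psi> (\<lambda>i. y i + z * R j i)\<bar> \<le> poly p' z"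
      using tame_growth[OF t(2), of y] by blast
    ultimately show "(LINT z|?G. z * \<psi> (\<lambda>i. y i + z * R j i)) = (LINT z|?G. d\<psi> (\<lambda>i. y i + z * R j i))"
      by (intro std_normal_integration_by_parts D tame_continuous t) auto
  qed
  also have "\<dots> = expectation (\<lambda>\<omega>. d\<psi> (\<lambda>i. X i \<omega>))"
    using tame_integrable[OF t(2)] by (intro e[symmetric]) auto
  finally show ?thesis .
qed

end

section \<open>Products of four Hermite polynomials\<close>

text \<open>Differentiating the recursion gives one copy of \<open>hermite n\<close> plus n times
  \<open>[:0, 1:] * hermite k - pderiv (hermite k)\<close> with n = k + 1, and the latter is
  \<open>hermite n\<close> once more.\<close>

lemma pderiv_hermite_Suc: "pderiv (hermite (Suc n)) = smult (of_nat (Suc n)) (hermite n)"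
proof (induction n rule: less_induct)
  case (less n)
  show ?case
  proof (cases n)
    case 0
    then show ?thesis by (simp add: pderiv_pCons)
  next
    case (Suc k)
    have d: "pderiv (hermite (Suc k)) = smult (of_nat (Suc k)) (hermite k)"
      using less[of k] Suc by simp
    have "pderiv (hermite (Suc n)) = hermite n + [:0, 1:] * pderiv (hermite n) - pderiv (pderiv (hermite n))"
      by (simp add: pderiv_diff pderiv_mult pderiv_pCons)
    also have "\<dots> = hermite n + smult (of_nat n) ([:0, 1:] * hermite k - pderiv (hermite k))"
      unfolding Suc d pderiv_smult smult_diff_right mult_smult_right by (simp add: add_diff_eq)
    also have "\<dots> = hermite n + smult (of_nat n) (hermite n)"
      by (simp add: Suc)
    also have "\<dots> = smult (of_nat (Suc n)) (hermite n)"
      by (simp add: smult_add_left)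
    finally show ?thesis .
  qed
qed

text \<open>For n = 0 the factor vanishes, so the truncated \<open>n - 1\<close> is harmless. The
  recursions below rely on this convention.\<close>

lemma pderiv_hermite: "pderiv (hermite n) = smult (of_nat n) (hermite (n - 1))"
  by (cases n) (simp_all add: pderiv_hermite_Suc pderiv_1 del: hermite.simps(2))

lemma poly_hermite_Suc:
  "poly (hermite (Suc n)) x = x * poly (hermite n) x - real n * poly (hermite (n - 1)) x"
  by (simp add: pderiv_hermite)

context std_gaussian_field
begin

lemma stein_pair_hermite:
  "stein_pair j (\<lambda>x. poly (hermite n) (x i)) (\<lambda>x. real n * R j i * poly (hermite (n - 1)) (x i))"
  by (rule stein_pair_cong[OF stein_pair_poly[OF stein_pair_coord]]) (simp add: pderiv_hermite)

lemma tame_hermite: "tame j (\<lambda>x. poly (hermite n) (x i))"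
  by (intro tame_poly tame_coord)

text \<open>The vertices \<open>i\<close>, \<open>j\<close>, \<open>k\<close>, \<open>l\<close>
  carry \<open>a\<close>, \<open>b\<close>, \<open>c\<close>, \<open>d\<close> legs. The same four
  slots serve for pair moments, with degree 0 in the other two.\<close>

definition hermite_moment ::
    "'i \<Rightarrow> nat \<Rightarrow> 'i \<Rightarrow> nat \<Rightarrow> 'i \<Rightarrow> nat \<Rightarrow> 'i \<Rightarrow> nat \<Rightarrow> real" where
  "hermite_moment i a j b k c l d = expectation (\<lambda>\<omega>. poly (hermite a) (X i \<omega>) * poly (hermite b) (X j \<omega>) *
     poly (hermite c) (X k \<omega>) * poly (hermite d) (X l \<omega>))"

lemma hermite_moment_0[simp]: "hermite_moment i 0 j 0 k 0 l 0 = 1"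
  by (simp add: hermite_moment_def prob_space)

text \<open>One leg at \<open>i\<close> is contracted with a leg of another slot. There is no
  contraction within the slot: the derivative of \<open>hermite a\<close> produced by
  \<open>stein\<close> cancels the second term of \<open>poly_hermite_Suc\<close>, because
  \<open>R i i = 1\<close>.\<close>

lemma hermite_moment_rec1:
  "hermite_moment i (Suc a) j b k c l d =
     real b * R i j * hermite_moment i a j (b - 1) k c l d +
     real c * R i k * hermite_moment i a j b k (c - 1) l d +
     real d * R i l * hermite_moment i a j b k c l (d - 1)"
proof -
  define P where "P a b c d x = poly (hermite a) (x i) * poly (hermite b) (x j) *
     poly (hermite c) (x k) * poly (hermite d) (x l)" for a b c d :: nat and x :: "'i \<Rightarrow> real"
  have tP: "tame i (P a b c d)" for a b c d
    unfolding P_def by (intro tame_mult tame_hermite)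
  note int = tame_integrable[OF tP]
  have sp: "stein_pair i (P a b c d) (\<lambda>x. real a * P (a - 1) b c d x + (real b * R i j) * P a (b - 1) c d x +
      (real c * R i k) * P a b (c - 1) d x + (real d * R i l) * P a b c (d - 1) x)"
    unfolding P_def
    by (rule stein_pair_cong[OF stein_pair_mult[OF stein_pair_mult[OF stein_pair_mult[OF
        stein_pair_hermite stein_pair_hermite] stein_pair_hermite] stein_pair_hermite]])
      (simp add: algebra_simps)
  have ix: "integrable M (\<lambda>\<omega>. X i \<omega> * P a b c d (\<lambda>i. X i \<omega>))"
    by (rule tame_integrable[OF tame_mult[OF tame_coord tP]])
  have "hermite_moment i (Suc a) j b k c l d = expectation (\<lambda>\<omega>. P (Suc a) b c d (\<lambda>i. X i \<omega>))"
    by (simp add: hermite_moment_def P_def)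
  also have "\<dots> = expectation (\<lambda>\<omega>. X i \<omega> * P a b c d (\<lambda>i. X i \<omega>) - real a * P (a - 1) b c d (\<lambda>i. X i \<omega>))"
    unfolding P_def poly_hermite_Suc by (simp add: algebra_simps)
  also have "\<dots> = expectation (\<lambda>\<omega>. X i \<omega> * P a b c d (\<lambda>i. X i \<omega>)) - real a * expectation (\<lambda>\<omega>. P (a - 1) b c d (\<lambda>i. X i \<omega>))"
    using ix int by simp
  also have "expectation (\<lambda>\<omega>. X i \<omega> * P a b c d (\<lambda>i. X i \<omega>)) =
      real a * expectation (\<lambda>\<omega>. P (a - 1) b c d (\<lambda>i. X i \<omega>)) +
      (real b * R i j) * expectation (\<lambda>\<omega>. P a (b - 1) c d (\<lambda>i. X i \<omega>)) +
      (real c * R i k) * expectation (\<lambda>\<omega>. P a b (c - 1) d (\<lambda>i. X i \<omega>)) +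
      (real d * R i l) * expectation (\<lambda>\<omega>. P a b c (d - 1) (\<lambda>i. X i \<omega>))"
    unfolding stein[OF sp] using int by simp
  finally show ?thesis by (simp add: hermite_moment_def P_def)
qed

lemma hermite_moment_swap:
  "hermite_moment i a j b k c l d = hermite_moment j b i a k c l d"
  "hermite_moment i a j b k c l d = hermite_moment k c l d i a j b"
  by (simp_all add: hermite_moment_def mult_ac)

lemma hermite_moment_rec2:
  "hermite_moment i a j (Suc b) k c l d =
     real a * R i j * hermite_moment i (a - 1) j b k c l d +
     real c * R j k * hermite_moment i a j b k (c - 1) l d +
     real d * R j l * hermite_moment i a j b k c l (d - 1)"
  unfolding hermite_moment_swap(1)[of i _ j] hermite_moment_rec1 by (simp add: R_commute)

lemma hermite_moment_rec34:
  "hermite_moment i 0 j 0 k (Suc c) l d = real d * R k l * hermite_moment i 0 j 0 k c l (d - 1)"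
  "hermite_moment i 0 j 0 k 0 l (Suc d) = 0"
  unfolding hermite_moment_swap(2)[of i _ j] hermite_moment_rec1 hermite_moment_rec2 by simp_all

definition edge_monomial :: "'i \<Rightarrow> 'i \<Rightarrow> 'i \<Rightarrow> 'i \<Rightarrow> nat \<Rightarrow> nat \<Rightarrow> nat \<Rightarrow> nat \<Rightarrow> nat \<Rightarrow> nat \<Rightarrow> real" where
  "edge_monomial i j k l n1 n2 n3 n4 n5 n6 =
     \<bar>R i j\<bar> ^ n1 * \<bar>R k l\<bar> ^ n2 * \<bar>R i k\<bar> ^ n3 * \<bar>R j l\<bar> ^ n4 * \<bar>R i l\<bar> ^ n5 * \<bar>R j k\<bar> ^ n6"

text \<open>Diagrams on four vertices with prescribed degrees; \<open>n1, \<dots>, n6\<close> are the multiplicities of the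
  edges 12, 34, 13, 24, 14, 23. The factor \<open>y\<close> accumulates the edges already removed
  by the recursion. A flag \<open>s\<close> restricts to diagrams linking \<open>{1, 2}\<close> with \<open>{3, 4}\<close>.\<close>

definition diagrams_le ::
    "bool \<Rightarrow> 'i \<Rightarrow> nat \<Rightarrow> 'i \<Rightarrow> nat \<Rightarrow> 'i \<Rightarrow> nat \<Rightarrow> 'i \<Rightarrow> nat \<Rightarrow> real \<Rightarrow> real \<Rightarrow> bool" where
  "diagrams_le s i a j b k c l d y V \<longleftrightarrow>
     (\<forall>n1 n2 n3 n4 n5 n6. n1 + n3 + n5 = a \<longrightarrow> n1 + n4 + n6 = b \<longrightarrow> n2 + n3 + n6 = c \<longrightarrow> n2 + n4 + n5 = d \<longrightarrow>
        (s \<longrightarrow> 0 < n3 + n4 + n5 + n6) \<longrightarrow> y * edge_monomial i j k l n1 n2 n3 n4 n5 n6 \<le> V)"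

lemma diagrams_leD:
  "diagrams_le s i a j b k c l d y V \<Longrightarrow> n1 + n3 + n5 = a \<Longrightarrow> n1 + n4 + n6 = b \<Longrightarrow> n2 + n3 + n6 = c \<Longrightarrow>
     n2 + n4 + n5 = d \<Longrightarrow> (s \<Longrightarrow> 0 < n3 + n4 + n5 + n6) \<Longrightarrow> y * edge_monomial i j k l n1 n2 n3 n4 n5 n6 \<le> V"
  unfolding diagrams_le_def by blast

text \<open>Restoring the removed edge turns a diagram of the smaller degrees into one of the larger
  degrees, so the bound \<open>V\<close> is inherited. An edge inside {1, 2} or {3, 4} leaves the
  flag \<open>s\<close> as it is; an edge between the pairs already fulfils the linking condition,
  and what remains is unrestricted. The nonzero degree at the second endpoint guards the truncated
  subtraction.\<close>

lemma diagrams_le_remove_edge: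
  shows diagrams_le_12: "b \<noteq> 0 \<Longrightarrow> diagrams_le s i (Suc a) j b k c l d y V \<Longrightarrow> diagrams_le s i a j (b - 1) k c l d (y * \<bar>R i j\<bar>) V"
    and diagrams_le_34: "d \<noteq> 0 \<Longrightarrow> diagrams_le s i a j b k (Suc c) l d y V \<Longrightarrow> diagrams_le s i a j b k c l (d - 1) (y * \<bar>R k l\<bar>) V"
    and diagrams_le_13: "c \<noteq> 0 \<Longrightarrow> diagrams_le s i (Suc a) j b k c l d y V \<Longrightarrow> diagrams_le False i a j b k (c - 1) l d (y * \<bar>R i k\<bar>) V"
    and diagrams_le_24: "d \<noteq> 0 \<Longrightarrow> diagrams_le s i a j (Suc b) k c l d y V \<Longrightarrow> diagrams_le False i a j b k c l (d - 1) (y * \<bar>R j l\<bar>) V"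
    and diagrams_le_14: "d \<noteq> 0 \<Longrightarrow> diagrams_le s i (Suc a) j b k c l d y V \<Longrightarrow> diagrams_le False i a j b k c l (d - 1) (y * \<bar>R i l\<bar>) V"
    and diagrams_le_23: "c \<noteq> 0 \<Longrightarrow> diagrams_le s i a j (Suc b) k c l d y V \<Longrightarrow> diagrams_le False i a j b k (c - 1) l d (y * \<bar>R j k\<bar>) V"
proof -
  have e: "y * \<bar>R i j\<bar> * edge_monomial i j k l n1 n2 n3 n4 n5 n6 = y * edge_monomial i j k l (Suc n1) n2 n3 n4 n5 n6"
    "y * \<bar>R k l\<bar> * edge_monomial i j k l n1 n2 n3 n4 n5 n6 = y * edge_monomial i j k l n1 (Suc n2) n3 n4 n5 n6"
    "y * \<bar>R i k\<bar> * edge_monomial i j k l n1 n2 n3 n4 n5 n6 = y * edge_monomial i j k l n1 n2 (Suc n3) n4 n5 n6"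
    "y * \<bar>R j l\<bar> * edge_monomial i j k l n1 n2 n3 n4 n5 n6 = y * edge_monomial i j k l n1 n2 n3 (Suc n4) n5 n6"
    "y * \<bar>R i l\<bar> * edge_monomial i j k l n1 n2 n3 n4 n5 n6 = y * edge_monomial i j k l n1 n2 n3 n4 (Suc n5) n6"
    "y * \<bar>R j k\<bar> * edge_monomial i j k l n1 n2 n3 n4 n5 n6 = y * edge_monomial i j k l n1 n2 n3 n4 n5 (Suc n6)"
    for n1 n2 n3 n4 n5 n6
    by (simp_all add: edge_monomial_def mult_ac)
  show "b \<noteq> 0 \<Longrightarrow> diagrams_le s i (Suc a) j b k c l d y V \<Longrightarrow> diagrams_le s i a j (b - 1) k c l d (y * \<bar>R i j\<bar>) V"
    "d \<noteq> 0 \<Longrightarrow> diagrams_le s i a j b k (Suc c) l d y V \<Longrightarrow> diagrams_le s i a j b k c l (d - 1) (y * \<bar>R k l\<bar>) V"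
    "c \<noteq> 0 \<Longrightarrow> diagrams_le s i (Suc a) j b k c l d y V \<Longrightarrow> diagrams_le False i a j b k (c - 1) l d (y * \<bar>R i k\<bar>) V"
    "d \<noteq> 0 \<Longrightarrow> diagrams_le s i a j (Suc b) k c l d y V \<Longrightarrow> diagrams_le False i a j b k c l (d - 1) (y * \<bar>R j l\<bar>) V"
    "d \<noteq> 0 \<Longrightarrow> diagrams_le s i (Suc a) j b k c l d y V \<Longrightarrow> diagrams_le False i a j b k c l (d - 1) (y * \<bar>R i l\<bar>) V"
    "c \<noteq> 0 \<Longrightarrow> diagrams_le s i a j (Suc b) k c l d y V \<Longrightarrow> diagrams_le False i a j b k (c - 1) l d (y * \<bar>R j k\<bar>) V"
    unfolding diagrams_le_def[where y="_ * _"] e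
    by (intro allI impI, erule diagrams_leD; simp)+
qed

text \<open>One step of the recursion: each summand vanishes or removes an edge.\<close>

lemma recursion_step_bound:
  fixes y V :: real
  assumes "0 \<le> y" "0 \<le> V"
    and "m1 \<noteq> 0 \<Longrightarrow> y * \<bar>r1\<bar> * \<bar>e1\<bar> \<le> K1 * V" "m2 \<noteq> 0 \<Longrightarrow> y * \<bar>r2\<bar> * \<bar>e2\<bar> \<le> K2 * V" "m3 \<noteq> 0 \<Longrightarrow> y * \<bar>r3\<bar> * \<bar>e3\<bar> \<le> K3 * V"
  shows "y * \<bar>real m1 * r1 * e1 + real m2 * r2 * e2 + real m3 * r3 * e3\<bar> \<le> (real m1 * K1 + real m2 * K2 + real m3 * K3) * V"
proof -
  \<comment> \<open>With multiplicity 0 there is no edge to remove, hence no bound on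
    \<open>e\<close>; the factor annihilates the term.\<close>
  have *: "y * \<bar>real m * r * e\<bar> \<le> real m * K * V" if "m \<noteq> 0 \<Longrightarrow> y * \<bar>r\<bar> * \<bar>e\<bar> \<le> K * V" for m r e K
  proof (cases "m = 0")
    case False
    have "y * \<bar>real m * r * e\<bar> = real m * (y * \<bar>r\<bar> * \<bar>e\<bar>)" by (simp add: abs_mult)
    also have "\<dots> \<le> real m * (K * V)" using that[OF False] by (intro mult_left_mono) auto
    finally show ?thesis by (simp add: mult.assoc)
  qed simp
  have "y * \<bar>real m1 * r1 * e1 + real m2 * r2 * e2 + real m3 * r3 * e3\<bar> \<le>
     y * (\<bar>real m1 * r1 * e1\<bar> + \<bar>real m2 * r2 * e2\<bar> + \<bar>real m3 * r3 * e3\<bar>)"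
    by (intro mult_left_mono assms) linarith
  also have "\<dots> \<le> real m1 * K1 * V + real m2 * K2 * V + real m3 * K3 * V"
    unfolding distrib_left by (intro add_mono * assms)
  finally show ?thesis by (simp add: distrib_right)
qed

text \<open>\<open>V\<close> is any common bound of the weighted diagrams, so that they need not be
  enumerated: each recursion step moves one edge into \<open>y\<close>. \<open>K\<close> collects
  the multiplicities and depends on the degrees alone, which makes the bound uniform in the
  points.\<close>

lemma hermite_moment_bound:
  "\<exists>K\<ge>0. \<forall>i j k l y V. 0 \<le> y \<longrightarrow> 0 \<le> V \<longrightarrow> diagrams_le False i a j b k c l d y V \<longrightarrow>
     y * \<bar>hermite_moment i a j b k c l d\<bar> \<le> K * V"
proof (induction "a + b + c + d" arbitrary: a b c d rule: less_induct)
  case less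
  consider a' where "a = Suc a'" | b' where "a = 0" "b = Suc b'" | c' where "a = 0" "b = 0" "c = Suc c'"
    | d' where "a = 0" "b = 0" "c = 0" "d = Suc d'" | "a = 0" "b = 0" "c = 0" "d = 0"
    by (metis not0_implies_Suc)
  then show ?case
  proof cases
    case 1
    have lt: "a' + (b - 1) + c + d < a + b + c + d" "a' + b + (c - 1) + d < a + b + c + d" "a' + b + c + (d - 1) < a + b + c + d" using 1 by auto
    obtain K1 where K1: "K1 \<ge> 0" "\<And>i j k l y V. 0 \<le> y \<Longrightarrow> 0 \<le> V \<Longrightarrow> diagrams_le False i a' j (b - 1) k c l d y V \<Longrightarrow>
     y * \<bar>hermite_moment i a' j (b - 1) k c l d\<bar> \<le> K1 * V" using less[OF lt(1)] by blast
    obtain K2 where K2: "K2 \<ge> 0" "\<And>i j k l y V. 0 \<le> y \<Longrightarrow> 0 \<le> V \<Longrightarrow> diagrams_le False i a' j b k (c - 1) l d y V \<Longrightarrow>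
     y * \<bar>hermite_moment i a' j b k (c - 1) l d\<bar> \<le> K2 * V" using less[OF lt(2)] by blast
    obtain K3 where K3: "K3 \<ge> 0" "\<And>i j k l y V. 0 \<le> y \<Longrightarrow> 0 \<le> V \<Longrightarrow> diagrams_le False i a' j b k c l (d - 1) y V \<Longrightarrow>
     y * \<bar>hermite_moment i a' j b k c l (d - 1)\<bar> \<le> K3 * V" using less[OF lt(3)] by blast
    show ?thesis unfolding 1 hermite_moment_rec1
    proof (intro exI[of _ "real b * K1 + real c * K2 + real d * K3"] conjI allI impI recursion_step_bound)
      fix i j k l and y V :: real
      assume y: "0 \<le> y" and V: "0 \<le> V" and T: "diagrams_le False i (Suc a') j b k c l d y V"
      show "b \<noteq> 0 \<Longrightarrow> y * \<bar>R i j\<bar> * \<bar>hermite_moment i a' j (b - 1) k c l d\<bar> \<le> K1 * V"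
        using y V T by (intro K1(2) diagrams_le_12) auto
      show "c \<noteq> 0 \<Longrightarrow> y * \<bar>R i k\<bar> * \<bar>hermite_moment i a' j b k (c - 1) l d\<bar> \<le> K2 * V"
        using y V T by (intro K2(2) diagrams_le_13) auto
      show "d \<noteq> 0 \<Longrightarrow> y * \<bar>R i l\<bar> * \<bar>hermite_moment i a' j b k c l (d - 1)\<bar> \<le> K3 * V"
        using y V T by (intro K3(2) diagrams_le_14) auto
    qed (use K1 K2 K3 in auto)
  next
    case 2
    have lt: "0 + b' + (c - 1) + d < a + b + c + d" "0 + b' + c + (d - 1) < a + b + c + d" using 2 by auto
    obtain K2 where K2: "K2 \<ge> 0" "\<And>i j k l y V. 0 \<le> y \<Longrightarrow> 0 \<le> V \<Longrightarrow> diagrams_le False i 0 j b' k (c - 1) l d y V \<Longrightarrow>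
     y * \<bar>hermite_moment i 0 j b' k (c - 1) l d\<bar> \<le> K2 * V" using less[OF lt(1)] by blast
    obtain K3 where K3: "K3 \<ge> 0" "\<And>i j k l y V. 0 \<le> y \<Longrightarrow> 0 \<le> V \<Longrightarrow> diagrams_le False i 0 j b' k c l (d - 1) y V \<Longrightarrow>
     y * \<bar>hermite_moment i 0 j b' k c l (d - 1)\<bar> \<le> K3 * V" using less[OF lt(2)] by blast
    show ?thesis unfolding 2 hermite_moment_rec2
    proof (intro exI[of _ "real 0 * 0 + real c * K2 + real d * K3"] conjI allI impI recursion_step_bound)
      fix i j k l and y V :: real
      assume y: "0 \<le> y" and V: "0 \<le> V" and T: "diagrams_le False i 0 j (Suc b') k c l d y V"
      show "c \<noteq> 0 \<Longrightarrow> y * \<bar>R j k\<bar> * \<bar>hermite_moment i 0 j b' k (c - 1) l d\<bar> \<le> K2 * V"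
        using y V T by (intro K2(2) diagrams_le_23) auto
      show "d \<noteq> 0 \<Longrightarrow> y * \<bar>R j l\<bar> * \<bar>hermite_moment i 0 j b' k c l (d - 1)\<bar> \<le> K3 * V"
        using y V T by (intro K3(2) diagrams_le_24) auto
    qed (use K2 K3 in auto)
  next
    case 3
    have lt: "0 + 0 + c' + (d - 1) < a + b + c + d" using 3 by auto
    obtain K3 where K3: "K3 \<ge> 0" "\<And>i j k l y V. 0 \<le> y \<Longrightarrow> 0 \<le> V \<Longrightarrow> diagrams_le False i 0 j 0 k c' l (d - 1) y V \<Longrightarrow>
     y * \<bar>hermite_moment i 0 j 0 k c' l (d - 1)\<bar> \<le> K3 * V" using less[OF lt(1)] by blast
    show ?thesis unfolding 3 hermite_moment_rec34
    proof (intro exI[of _ "real d * K3"] conjI allI impI)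
      fix i j k l and y V :: real
      assume y: "0 \<le> y" and V: "0 \<le> V" and T: "diagrams_le False i 0 j 0 k (Suc c') l d y V"
      have "d \<noteq> 0 \<Longrightarrow> y * \<bar>R k l\<bar> * \<bar>hermite_moment i 0 j 0 k c' l (d - 1)\<bar> \<le> K3 * V"
        using y V T by (intro K3(2) diagrams_le_34) auto
      then show "y * \<bar>real d * R k l * hermite_moment i 0 j 0 k c' l (d - 1)\<bar> \<le> real d * K3 * V"
        using recursion_step_bound[OF y V, of 0 0 0 0 0 0 0 0 d "R k l" "hermite_moment i 0 j 0 k c' l (d - 1)" K3] by simp
    qed (use K3 in auto)
  next
    case 4
    then show ?thesis by (auto simp: hermite_moment_rec34 intro!: exI[of _ 0])
  next
    case 5
    \<comment> \<open>No legs are left: only the empty diagram remains, and \<open>y\<close> has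
      absorbed all edges.\<close>
    have "y \<le> V" if "diagrams_le False i 0 j 0 k 0 l 0 y V" for i j k l y V
      using diagrams_leD[OF that, of 0 0 0 0 0 0] by (simp add: edge_monomial_def)
    then show ?thesis using 5 by (auto intro!: exI[of _ 1])
  qed
qed

text \<open>The covariance obeys the recursion of the fourth moment. For an edge inside {1, 2} the
  product of pair moments has a matching term; for an edge into {3, 4} it has none. So the flag
  stays \<open>True\<close> until a linking edge appears, and from there on
  \<open>hermite_moment_bound\<close> takes over.\<close>

lemma hermite_moment_cov_bound:
  "\<exists>K\<ge>0. \<forall>i j k l y V. 0 \<le> y \<longrightarrow> 0 \<le> V \<longrightarrow> diagrams_le True i a j b k c l d y V \<longrightarrow>
     y * \<bar>hermite_moment i a j b k c l d - hermite_moment i a j b k 0 l 0 * hermite_moment i 0 j 0 k c l d\<bar> \<le> K * V"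
proof (induction a arbitrary: b)
  case 0
  show ?case
  proof (cases b)
    case 0
    then show ?thesis by (auto intro!: exI[of _ 0])
  next
    case (Suc b')
    obtain K2 where K2: "K2 \<ge> 0" "\<And>i j k l y V. 0 \<le> y \<Longrightarrow> 0 \<le> V \<Longrightarrow> diagrams_le False i 0 j b' k (c - 1) l d y V \<Longrightarrow>
     y * \<bar>hermite_moment i 0 j b' k (c - 1) l d\<bar> \<le> K2 * V" using hermite_moment_bound[of 0 b' "c - 1" d] by blast
    obtain K3 where K3: "K3 \<ge> 0" "\<And>i j k l y V. 0 \<le> y \<Longrightarrow> 0 \<le> V \<Longrightarrow> diagrams_le False i 0 j b' k c l (d - 1) y V \<Longrightarrow>
     y * \<bar>hermite_moment i 0 j b' k c l (d - 1)\<bar> \<le> K3 * V" using hermite_moment_bound[of 0 b' c "d - 1"] by blast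
    \<comment> \<open>Legs at \<open>j\<close> without any at \<open>i\<close> make the pair moment
      vanish, so the fourth moment alone remains and every contraction at \<open>j\<close> is a
      link.\<close>
    have e: "hermite_moment i 0 j (Suc b') k c l d - hermite_moment i 0 j (Suc b') k 0 l 0 * hermite_moment i 0 j 0 k c l d
      = real 0 * 0 * 0 + real c * R j k * hermite_moment i 0 j b' k (c - 1) l d + real d * R j l * hermite_moment i 0 j b' k c l (d - 1)"
      for i j k l by (simp add: hermite_moment_rec2)
    show ?thesis unfolding Suc e
    proof (intro exI[of _ "real 0 * 0 + real c * K2 + real d * K3"] conjI allI impI recursion_step_bound)
      fix i j k l and y V :: real
      assume y: "0 \<le> y" and V: "0 \<le> V" and T: "diagrams_le True i 0 j (Suc b') k c l d y V"
      show "c \<noteq> 0 \<Longrightarrow> y * \<bar>R j k\<bar> * \<bar>hermite_moment i 0 j b' k (c - 1) l d\<bar> \<le> K2 * V"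
        using y V T by (intro K2(2) diagrams_le_23) auto
      show "d \<noteq> 0 \<Longrightarrow> y * \<bar>R j l\<bar> * \<bar>hermite_moment i 0 j b' k c l (d - 1)\<bar> \<le> K3 * V"
        using y V T by (intro K3(2) diagrams_le_24) auto
    qed (use K2 K3 in auto)
  qed
next
  case (Suc a)
  define D where "D i j k l a b = hermite_moment i a j b k c l d - hermite_moment i a j b k 0 l 0 * hermite_moment i 0 j 0 k c l d" for i j k l a b
  obtain K1 where K1: "K1 \<ge> 0" "\<And>i j k l y V. 0 \<le> y \<Longrightarrow> 0 \<le> V \<Longrightarrow> diagrams_le True i a j (b - 1) k c l d y V \<Longrightarrow>
     y * \<bar>D i j k l a (b - 1)\<bar> \<le> K1 * V" using Suc.IH[of "b - 1"] unfolding D_def by blast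
  obtain K2 where K2: "K2 \<ge> 0" "\<And>i j k l y V. 0 \<le> y \<Longrightarrow> 0 \<le> V \<Longrightarrow> diagrams_le False i a j b k (c - 1) l d y V \<Longrightarrow>
     y * \<bar>hermite_moment i a j b k (c - 1) l d\<bar> \<le> K2 * V" using hermite_moment_bound[of a b "c - 1" d] by blast
  obtain K3 where K3: "K3 \<ge> 0" "\<And>i j k l y V. 0 \<le> y \<Longrightarrow> 0 \<le> V \<Longrightarrow> diagrams_le False i a j b k c l (d - 1) y V \<Longrightarrow>
     y * \<bar>hermite_moment i a j b k c l (d - 1)\<bar> \<le> K3 * V" using hermite_moment_bound[of a b c "d - 1"] by blast
  have e: "D i j k l (Suc a) b = real b * R i j * D i j k l a (b - 1) +
      real c * R i k * hermite_moment i a j b k (c - 1) l d + real d * R i l * hermite_moment i a j b k c l (d - 1)"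
    for i j k l by (simp add: D_def hermite_moment_rec1 algebra_simps)
  show ?case unfolding D_def[symmetric] e
  proof (intro exI[of _ "real b * K1 + real c * K2 + real d * K3"] conjI allI impI recursion_step_bound)
    fix i j k l and y V :: real
    assume y: "0 \<le> y" and V: "0 \<le> V" and T: "diagrams_le True i (Suc a) j b k c l d y V"
    show "b \<noteq> 0 \<Longrightarrow> y * \<bar>R i j\<bar> * \<bar>D i j k l a (b - 1)\<bar> \<le> K1 * V"
      using y V T by (intro K1(2) diagrams_le_12) auto
    show "c \<noteq> 0 \<Longrightarrow> y * \<bar>R i k\<bar> * \<bar>hermite_moment i a j b k (c - 1) l d\<bar> \<le> K2 * V"
      using y V T by (intro K2(2) diagrams_le_13) auto
    show "d \<noteq> 0 \<Longrightarrow> y * \<bar>R i l\<bar> * \<bar>hermite_moment i a j b k c l (d - 1)\<bar> \<le> K3 * V"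
      using y V T by (intro K3(2) diagrams_le_14) auto
  qed (use K1 K2 K3 in auto)
qed

text \<open>Equal degrees force opposite edges to have equal multiplicity, which leaves the products
  \<open>A\<^sup>r B\<^sup>s C\<^sup>t\<close> with \<open>r + s + t = p\<close> and \<open>r < p\<close>.\<close>

lemma hermite_cov_bound:
  "\<exists>K\<ge>0. \<forall>i j k l.
     \<bar>expectation (\<lambda>\<omega>. poly (hermite p) (X i \<omega>) * poly (hermite p) (X j \<omega>) * poly (hermite p) (X k \<omega>) * poly (hermite p) (X l \<omega>))
      - expectation (\<lambda>\<omega>. poly (hermite p) (X i \<omega>) * poly (hermite p) (X j \<omega>)) *
        expectation (\<lambda>\<omega>. poly (hermite p) (X k \<omega>) * poly (hermite p) (X l \<omega>))\<bar>
     \<le> K * (\<Sum>r<p. (\<bar>R i j\<bar> * \<bar>R k l\<bar>) ^ r * (\<bar>R i k\<bar> * \<bar>R j l\<bar>) ^ (p - r) +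
                  (\<bar>R i j\<bar> * \<bar>R k l\<bar>) ^ r * (\<bar>R i l\<bar> * \<bar>R j k\<bar>) ^ (p - r))"
proof -
  obtain K where K: "K \<ge> 0" "\<And>i j k l y V. 0 \<le> y \<Longrightarrow> 0 \<le> V \<Longrightarrow> diagrams_le True i p j p k p l p y V \<Longrightarrow>
     y * \<bar>hermite_moment i p j p k p l p - hermite_moment i p j p k 0 l 0 * hermite_moment i 0 j 0 k p l p\<bar> \<le> K * V"
    using hermite_moment_cov_bound[of p p p p] by blast
  show ?thesis
  proof (intro exI[of _ K] conjI allI K(1))
    fix i j k l
    define A B C where "A = \<bar>R i j\<bar> * \<bar>R k l\<bar>" and "B = \<bar>R i k\<bar> * \<bar>R j l\<bar>" and "C = \<bar>R i l\<bar> * \<bar>R j k\<bar>"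
    have nn: "0 \<le> A" "0 \<le> B" "0 \<le> C" by (auto simp: A_def B_def C_def)
    let ?V = "\<Sum>r<p. A ^ r * B ^ (p - r) + A ^ r * C ^ (p - r)"
    have "1 * \<bar>hermite_moment i p j p k p l p - hermite_moment i p j p k 0 l 0 * hermite_moment i 0 j 0 k p l p\<bar> \<le> K * ?V"
    proof (rule K(2))
      show "0 \<le> ?V" using nn by (intro sum_nonneg add_nonneg_nonneg mult_nonneg_nonneg zero_le_power)
      show "diagrams_le True i p j p k p l p 1 ?V"
        unfolding diagrams_le_def
      proof (intro allI impI)
        fix n1 n2 n3 n4 n5 n6
        assume n: "n1 + n3 + n5 = p" "n1 + n4 + n6 = p" "n2 + n3 + n6 = p" "n2 + n4 + n5 = p"
          and "True \<longrightarrow> 0 < n3 + n4 + n5 + n6"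
        \<comment> \<open>The equalities come from comparing sums of degree conditions; a link then
          forces n1 below p.\<close>
        then have eq: "n2 = n1" "n4 = n3" "n6 = n5" and lt: "n1 < p" by auto
        have "1 * edge_monomial i j k l n1 n2 n3 n4 n5 n6 = A ^ n1 * (B ^ n3 * C ^ n5)"
          by (simp add: edge_monomial_def eq A_def B_def C_def power_mult_distrib)
        \<comment> \<open>Both linking pairings \<open>B\<close> and \<open>C\<close> may occur; the
          larger one takes over all their powers.\<close>
        also have "\<dots> \<le> A ^ n1 * (max B C ^ n3 * max B C ^ n5)"
          using nn by (intro mult_left_mono mult_mono power_mono) auto
        also have "\<dots> = A ^ n1 * max B C ^ (p - n1)"
        proof -
          have "n3 + n5 = p - n1" using n by simp
          then show ?thesis by (simp only: power_add[symmetric])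
        qed
        also have "\<dots> \<le> A ^ n1 * B ^ (p - n1) + A ^ n1 * C ^ (p - n1)"
          using nn by (auto simp: max_def)
        also have "\<dots> \<le> ?V"
          using lt nn by (intro member_le_sum[of n1 _ "\<lambda>r. A ^ r * B ^ (p - r) + A ^ r * C ^ (p - r)"]) auto
        finally show "1 * edge_monomial i j k l n1 n2 n3 n4 n5 n6 \<le> ?V" .
      qed
    qed simp
    then show "\<bar>expectation (\<lambda>\<omega>. poly (hermite p) (X i \<omega>) * poly (hermite p) (X j \<omega>) * poly (hermite p) (X k \<omega>) * poly (hermite p) (X l \<omega>))
      - expectation (\<lambda>\<omega>. poly (hermite p) (X i \<omega>) * poly (hermite p) (X j \<omega>)) *
        expectation (\<lambda>\<omega>. poly (hermite p) (X k \<omega>) * poly (hermite p) (X l \<omega>))\<bar>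
     \<le> K * (\<Sum>r<p. (\<bar>R i j\<bar> * \<bar>R k l\<bar>) ^ r * (\<bar>R i k\<bar> * \<bar>R j l\<bar>) ^ (p - r) +
                  (\<bar>R i j\<bar> * \<bar>R k l\<bar>) ^ r * (\<bar>R i l\<bar> * \<bar>R j k\<bar>) ^ (p - r))"
      by (simp add: hermite_moment_def A_def B_def C_def)
  qed
qed

text \<open>The last two slots are dummies of degree 0. Each leg at \<open>i\<close> must be
  contracted with one at \<open>j\<close>; the factorial counts the pairings.\<close>

lemma hermite_orthogonality:
  "expectation (\<lambda>\<omega>. poly (hermite n) (X i \<omega>) * poly (hermite n) (X j \<omega>)) = fact n * R i j ^ n"
proof -
  have "hermite_moment i n j n i 0 i 0 = fact n * R i j ^ n"
    by (induction n) (simp_all add: hermite_moment_rec1 mult_ac)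
  then show ?thesis by (simp add: hermite_moment_def)
qed

lemma hermite_mean:
  assumes "0 < n" shows "expectation (\<lambda>\<omega>. poly (hermite n) (X i \<omega>)) = 0"
proof -
  have "hermite_moment i n i 0 i 0 i 0 = 0"
    using assms by (cases n) (simp_all add: hermite_moment_rec1)
  then show ?thesis by (simp add: hermite_moment_def)
qed

end

section \<open>Normal approximation in a fixed chaos\<close>

text \<open>Sine and cosine are 1-Lipschitz, so \<open>|F|\<close> dominates all difference
  quotients and dominated convergence applies.\<close>

lemma (in prob_space) has_derivative_expectation_trig:
  assumes F: "integrable M F"
  shows "((\<lambda>t. expectation (\<lambda>\<omega>. cos (t * F \<omega>))) has_real_derivative - expectation (\<lambda>\<omega>. F \<omega> * sin (t * F \<omega>))) (at t)"
    and "((\<lambda>t. expectation (\<lambda>\<omega>. sin (t * F \<omega>))) has_real_derivative expectation (\<lambda>\<omega>. F \<omega> * cos (t * F \<omega>))) (at t)"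
proof -
  have [measurable]: "F \<in> borel_measurable M" using F by auto
  have main: "((\<lambda>t. expectation (\<lambda>\<omega>. g (t * F \<omega>))) has_real_derivative expectation (\<lambda>\<omega>. F \<omega> * g' (t * F \<omega>))) (at t)"
    if D: "\<And>x. (g has_real_derivative g' x) (at x)" and b: "\<And>x. \<bar>g x\<bar> \<le> 1" and b': "\<And>x. \<bar>g' x\<bar> \<le> 1"
      and [measurable]: "g \<in> borel_measurable borel" "g' \<in> borel_measurable borel"
    for g g' :: "real \<Rightarrow> real"
  proof -
    have lip: "\<bar>g x - g y\<bar> \<le> \<bar>x - y\<bar>" for x y
      using field_differentiable_bound[of UNIV g g' 1 x y] D b' by simp
    have ig: "integrable M (\<lambda>\<omega>. g (s * F \<omega>))" for s
      using b by (intro integrable_const_bound[where B=1]) auto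
    show ?thesis
      unfolding DERIV_def tendsto_at_iff_sequentially o_def
    proof (intro allI impI)
      fix h :: "nat \<Rightarrow> real" assume h0: "\<forall>i. h i \<in> UNIV - {0}" and h: "h \<longlonglongrightarrow> 0"
      have e: "(expectation (\<lambda>\<omega>. g ((t + h n) * F \<omega>)) - expectation (\<lambda>\<omega>. g (t * F \<omega>))) / h n =
          expectation (\<lambda>\<omega>. (g ((t + h n) * F \<omega>) - g (t * F \<omega>)) / h n)" for n
        using ig by simp
      show "(\<lambda>n. (expectation (\<lambda>\<omega>. g ((t + h n) * F \<omega>)) - expectation (\<lambda>\<omega>. g (t * F \<omega>))) / h n)
         \<longlonglongrightarrow> expectation (\<lambda>\<omega>. F \<omega> * g' (t * F \<omega>))"
        unfolding e
      proof (rule integral_dominated_convergence[where w="\<lambda>\<omega>. \<bar>F \<omega>\<bar>"])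
        show "integrable M (\<lambda>\<omega>. \<bar>F \<omega>\<bar>)" using F by simp
        show "AE \<omega> in M. norm ((g ((t + h n) * F \<omega>) - g (t * F \<omega>)) / h n) \<le> \<bar>F \<omega>\<bar>" for n
        proof (rule AE_I2)
          fix \<omega>
          have "h n \<noteq> 0" using h0 by auto
          moreover have "\<bar>g ((t + h n) * F \<omega>) - g (t * F \<omega>)\<bar> \<le> \<bar>h n\<bar> * \<bar>F \<omega>\<bar>"
            using lip[of "(t + h n) * F \<omega>" "t * F \<omega>"] by (simp add: abs_mult[symmetric] algebra_simps)
          ultimately show "norm ((g ((t + h n) * F \<omega>) - g (t * F \<omega>)) / h n) \<le> \<bar>F \<omega>\<bar>"
            by (simp add: divide_le_eq mult.commute)
        qed
        show "AE \<omega> in M. (\<lambda>n. (g ((t + h n) * F \<omega>) - g (t * F \<omega>)) / h n) \<longlonglongrightarrow> F \<omega> * g' (t * F \<omega>)"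
        proof (rule AE_I2)
          fix \<omega>
          have "((\<lambda>s. g (s * F \<omega>)) has_real_derivative F \<omega> * g' (t * F \<omega>)) (at t)"
            by (rule DERIV_cong[OF DERIV_chain2[OF D DERIV_cmult_right[OF DERIV_ident]]]) simp
          then show "(\<lambda>n. (g ((t + h n) * F \<omega>) - g (t * F \<omega>)) / h n) \<longlonglongrightarrow> F \<omega> * g' (t * F \<omega>)"
            unfolding DERIV_def tendsto_at_iff_sequentially o_def using h0 h by blast
        qed
      qed simp_all
    qed
  qed
  show "((\<lambda>t. expectation (\<lambda>\<omega>. cos (t * F \<omega>))) has_real_derivative - expectation (\<lambda>\<omega>. F \<omega> * sin (t * F \<omega>))) (at t)"
    using main[of cos "\<lambda>x. - sin x"] by (simp add: DERIV_cos)
  show "((\<lambda>t. expectation (\<lambda>\<omega>. sin (t * F \<omega>))) has_real_derivative expectation (\<lambda>\<omega>. F \<omega> * cos (t * F \<omega>))) (at t)"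
    using main[of sin cos] by (simp add: DERIV_sin)
qed

text \<open>Gronwall step: \<open>u t = exp (v t\<^sup>2 / 2) * G t\<close> has small derivative.\<close>

lemma gaussian_ode_bound:
  fixes G :: "real \<Rightarrow> real"
  assumes D: "\<And>t. (G has_real_derivative G' t) (at t)"
    and b: "\<And>t. \<bar>G' t + v * t * G t\<bar> \<le> \<bar>t\<bar> * e" and v: "0 \<le> v" and e: "0 \<le> e"
  shows "\<bar>G t - exp (- v * t\<^sup>2 / 2) * G 0\<bar> \<le> t\<^sup>2 * e"
proof -
  let ?u = "\<lambda>s. exp (v * s\<^sup>2 / 2) * G s"
  let ?u' = "\<lambda>s. exp (v * s\<^sup>2 / 2) * (G' s + v * s * G s)"
  \<comment> \<open>The exponential is majorised by its value at \<open>t\<close>. Multiplication by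
    \<open>Q\<close> below cancels it exactly, so the final error does not involve
    \<open>v\<close>.\<close>
  let ?B = "exp (v * t\<^sup>2 / 2) * (\<bar>t\<bar> * e)"
  have "norm (?u t - ?u 0) \<le> ?B * norm (t - 0)"
  proof (rule field_differentiable_bound[where S="{-\<bar>t\<bar>..\<bar>t\<bar>}"])
    fix s assume s: "s \<in> {-\<bar>t\<bar>..\<bar>t\<bar>}"
    show "(?u has_real_derivative ?u' s) (at s within {-\<bar>t\<bar>..\<bar>t\<bar>})"
      by (rule has_field_derivative_at_within) (auto intro!: derivative_eq_intros D simp: algebra_simps)
    have st: "\<bar>s\<bar> \<le> \<bar>t\<bar>" using s by auto
    then have "s\<^sup>2 \<le> t\<^sup>2" by (simp add: abs_le_square_iff)
    then have "exp (v * s\<^sup>2 / 2) \<le> exp (v * t\<^sup>2 / 2)" using v by (simp add: mult_left_mono)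
    moreover have "\<bar>G' s + v * s * G s\<bar> \<le> \<bar>t\<bar> * e"
      using b[of s] mult_right_mono[OF st e] by linarith
    ultimately show "norm (?u' s) \<le> ?B" unfolding real_norm_def abs_mult[of "exp _"] by (intro mult_mono) auto
  qed auto
  then have "\<bar>exp (v * t\<^sup>2 / 2) * G t - G 0\<bar> \<le> exp (v * t\<^sup>2 / 2) * (t\<^sup>2 * e)"
    by (simp add: power2_eq_square abs_mult_self_eq mult_ac)
  note u = this
  define P Q where "P = exp (v * t\<^sup>2 / 2)" and "Q = exp (- v * t\<^sup>2 / 2)"
  have PQ: "Q * P = 1" "0 \<le> Q" by (simp_all add: P_def Q_def exp_add[symmetric])
  have "\<bar>G t - Q * G 0\<bar> = \<bar>Q * (P * G t - G 0)\<bar>"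
    using PQ(1) by (simp add: right_diff_distrib mult.assoc[symmetric])
  also have "\<dots> = Q * \<bar>P * G t - G 0\<bar>" using PQ(2) by (simp add: abs_mult)
  also have "\<dots> \<le> Q * (P * (t\<^sup>2 * e))" using u PQ(2) unfolding P_def by (intro mult_left_mono)
  also have "\<dots> = t\<^sup>2 * e" using PQ(1) by (simp add: mult.assoc[symmetric])
  finally show ?thesis by (simp add: Q_def)
qed

context std_gaussian_field
begin

text \<open>\<open>stein\<close> is applied to the first term of \<open>poly_hermite_Suc\<close>;
  where the derivative falls on \<open>hermite p\<close> it cancels the second term, since
  \<open>R j j = 1\<close>.\<close>

lemma stein_hermite:
  assumes "stein_pair j \<psi> d\<psi>"
  shows "expectation (\<lambda>\<omega>. poly (hermite (Suc p)) (X j \<omega>) * \<psi> (\<lambda>i. X i \<omega>)) =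
    expectation (\<lambda>\<omega>. poly (hermite p) (X j \<omega>) * d\<psi> (\<lambda>i. X i \<omega>))"
proof -
  have t: "tame j \<psi>" "tame j d\<psi>" using assms by (auto simp: stein_pair_def)
  have i1: "integrable M (\<lambda>\<omega>. X j \<omega> * (poly (hermite p) (X j \<omega>) * \<psi> (\<lambda>i. X i \<omega>)))"
    by (rule tame_integrable[OF tame_mult[OF tame_coord tame_mult[OF tame_hermite t(1)]]])
  have i2: "integrable M (\<lambda>\<omega>. poly (hermite n) (X j \<omega>) * \<psi> (\<lambda>i. X i \<omega>))" for n
    by (rule tame_integrable[OF tame_mult[OF tame_hermite t(1)]])
  have i3: "integrable M (\<lambda>\<omega>. poly (hermite n) (X j \<omega>) * d\<psi> (\<lambda>i. X i \<omega>))" for n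
    by (rule tame_integrable[OF tame_mult[OF tame_hermite t(2)]])
  have "expectation (\<lambda>\<omega>. poly (hermite (Suc p)) (X j \<omega>) * \<psi> (\<lambda>i. X i \<omega>)) =
     expectation (\<lambda>\<omega>. X j \<omega> * (poly (hermite p) (X j \<omega>) * \<psi> (\<lambda>i. X i \<omega>)) -
       real p * (poly (hermite (p - 1)) (X j \<omega>) * \<psi> (\<lambda>i. X i \<omega>)))"
    unfolding poly_hermite_Suc by (simp only: left_diff_distrib mult.assoc)
  also have "\<dots> = expectation (\<lambda>\<omega>. X j \<omega> * (poly (hermite p) (X j \<omega>) * \<psi> (\<lambda>i. X i \<omega>))) -
       real p * expectation (\<lambda>\<omega>. poly (hermite (p - 1)) (X j \<omega>) * \<psi> (\<lambda>i. X i \<omega>))"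
    using i1 i2 by simp
  also have "expectation (\<lambda>\<omega>. X j \<omega> * (poly (hermite p) (X j \<omega>) * \<psi> (\<lambda>i. X i \<omega>))) =
     expectation (\<lambda>\<omega>. real p * (poly (hermite (p - 1)) (X j \<omega>) * \<psi> (\<lambda>i. X i \<omega>)) + poly (hermite p) (X j \<omega>) * d\<psi> (\<lambda>i. X i \<omega>))"
    using stein[OF stein_pair_mult[OF stein_pair_hermite[of j p j] assms]] by (simp add: mult.assoc)
  also have "\<dots> = real p * expectation (\<lambda>\<omega>. poly (hermite (p - 1)) (X j \<omega>) * \<psi> (\<lambda>i. X i \<omega>)) +
      expectation (\<lambda>\<omega>. poly (hermite p) (X j \<omega>) * d\<psi> (\<lambda>i. X i \<omega>))"
    using i2 i3 by simp
  finally show ?thesis by simp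
qed

definition chaos :: "nat \<Rightarrow> 'i set \<Rightarrow> ('i \<Rightarrow> real) \<Rightarrow> ('i \<Rightarrow> real) \<Rightarrow> real" where
  "chaos q J a x = (\<Sum>k\<in>J. a k * poly (hermite q) (x k))"

text \<open>In Malliavin calculus this is \<open>|D F|\<^sup>2 / (p + 1)\<close> for \<open>F = chaos (p + 1) J a\<close>.\<close>

definition gamma :: "nat \<Rightarrow> 'i set \<Rightarrow> ('i \<Rightarrow> real) \<Rightarrow> ('i \<Rightarrow> real) \<Rightarrow> real" where
  "gamma p J a x = (\<Sum>j\<in>J. \<Sum>k\<in>J. real (Suc p) * (a j * a k * R j k) *
     (poly (hermite p) (x j) * poly (hermite p) (x k)))"

lemma tame_chaos: "tame i (chaos q J a)"
  unfolding chaos_def[abs_def] by (intro tame_sum tame_mult tame_const tame_hermite)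

lemma tame_gamma: "tame i (gamma p J a)"
  unfolding gamma_def[abs_def] by (intro tame_sum tame_mult tame_const tame_hermite)

lemma stein_pair_const: "stein_pair j (\<lambda>_. c) (\<lambda>_. 0)"
  by (auto simp: stein_pair_def tame_const)

lemma stein_pair_chaos:
  "stein_pair j (chaos (Suc p) J a) (\<lambda>x. \<Sum>k\<in>J. real (Suc p) * (a k * R j k) * poly (hermite p) (x k))"
  unfolding chaos_def[abs_def]
  by (rule stein_pair_cong[OF stein_pair_sum[OF stein_pair_mult[OF stein_pair_const stein_pair_hermite]]])
    (simp add: mult_ac del: hermite.simps of_nat_Suc)

text \<open>Meant for \<open>\<psi>\<close> = g(F) with F the chaos, and \<open>c * \<eta>\<close> =
  g'(F). The derivatives of F in the directions \<open>R j\<close>, weighted with \<open>a j\<close>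
  and \<open>hermite p\<close>, add up to \<open>gamma\<close>. The constant \<open>c\<close>
  carries frequency and sign, so that one lemma serves sine and cosine.\<close>

lemma stein_chaos:
  assumes ps: "\<And>j. stein_pair j \<psi> (\<lambda>x. c * (\<eta> x * (\<Sum>k\<in>J. real (Suc p) * (a k * R j k) * poly (hermite p) (x k))))"
    and t: "\<And>j. tame j \<psi>" "\<And>j. tame j \<eta>"
  shows "expectation (\<lambda>\<omega>. chaos (Suc p) J a (\<lambda>i. X i \<omega>) * \<psi> (\<lambda>i. X i \<omega>)) =
    c * expectation (\<lambda>\<omega>. gamma p J a (\<lambda>i. X i \<omega>) * \<eta> (\<lambda>i. X i \<omega>))"
proof -
  let ?d = "\<lambda>j x. c * (\<eta> x * (\<Sum>k\<in>J. real (Suc p) * (a k * R j k) * poly (hermite p) (x k)))"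
  have i1: "integrable M (\<lambda>\<omega>. poly (hermite (Suc p)) (X j \<omega>) * \<psi> (\<lambda>i. X i \<omega>))" for j
    by (rule tame_integrable[OF tame_mult[OF tame_hermite t(1)]])
  have i2: "integrable M (\<lambda>\<omega>. poly (hermite p) (X j \<omega>) * ?d j (\<lambda>i. X i \<omega>))" for j
    using ps[of j] by (intro tame_integrable[OF tame_mult[OF tame_hermite], of j]) (simp add: stein_pair_def)
  have "expectation (\<lambda>\<omega>. chaos (Suc p) J a (\<lambda>i. X i \<omega>) * \<psi> (\<lambda>i. X i \<omega>)) =
    expectation (\<lambda>\<omega>. \<Sum>j\<in>J. a j * (poly (hermite (Suc p)) (X j \<omega>) * \<psi> (\<lambda>i. X i \<omega>)))"
    unfolding chaos_def sum_distrib_right by (simp only: mult.assoc)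
  also have "\<dots> = (\<Sum>j\<in>J. a j * expectation (\<lambda>\<omega>. poly (hermite (Suc p)) (X j \<omega>) * \<psi> (\<lambda>i. X i \<omega>)))"
    using i1 by (simp del: hermite.simps)
  also have "\<dots> = (\<Sum>j\<in>J. a j * expectation (\<lambda>\<omega>. poly (hermite p) (X j \<omega>) * ?d j (\<lambda>i. X i \<omega>)))"
    unfolding stein_hermite[OF ps] ..
  also have "\<dots> = expectation (\<lambda>\<omega>. \<Sum>j\<in>J. a j * (poly (hermite p) (X j \<omega>) * ?d j (\<lambda>i. X i \<omega>)))"
    using i2 by (simp del: hermite.simps)
  also have "\<dots> = expectation (\<lambda>\<omega>. c * (gamma p J a (\<lambda>i. X i \<omega>) * \<eta> (\<lambda>i. X i \<omega>)))"
  proof -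
    have "(\<Sum>j\<in>J. a j * (poly (hermite p) (x j) * ?d j x)) = c * (gamma p J a x * \<eta> x)" for x
      unfolding gamma_def sum_distrib_right sum_distrib_left
      by (intro sum.cong refl) (simp only: mult_ac)
    then show ?thesis by simp
  qed
  finally show ?thesis by simp
qed

lemma chaos_variance:
  "expectation (\<lambda>\<omega>. (chaos q J a (\<lambda>i. X i \<omega>))\<^sup>2) = fact q * (\<Sum>j\<in>J. \<Sum>k\<in>J. a j * a k * R j k ^ q)"
proof -
  have i: "integrable M (\<lambda>\<omega>. poly (hermite q) (X j \<omega>) * poly (hermite q) (X k \<omega>))" for j k
    by (rule tame_integrable[OF tame_mult[OF tame_hermite tame_hermite]])
  have "(chaos q J a x)\<^sup>2 = (\<Sum>j\<in>J. \<Sum>k\<in>J. a j * a k * (poly (hermite q) (x j) * poly (hermite q) (x k)))" for x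
    unfolding chaos_def power2_eq_square sum_product by (intro sum.cong refl) (simp only: mult_ac)
  then have "expectation (\<lambda>\<omega>. (chaos q J a (\<lambda>i. X i \<omega>))\<^sup>2) = (\<Sum>j\<in>J. \<Sum>k\<in>J. a j * a k * (fact q * R j k ^ q))"
    using i by (simp add: hermite_orthogonality)
  also have "\<dots> = fact q * (\<Sum>j\<in>J. \<Sum>k\<in>J. a j * a k * R j k ^ q)"
    unfolding sum_distrib_left by (intro sum.cong refl) (simp only: mult_ac)
  finally show ?thesis .
qed

lemma chaos_mean: "0 < q \<Longrightarrow> expectation (\<lambda>\<omega>. chaos q J a (\<lambda>i. X i \<omega>)) = 0"
  using tame_integrable[OF tame_hermite] unfolding chaos_def by (simp add: hermite_mean)

text \<open>Real and imaginary part of the characteristic function satisfy the same perturbed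
  equation, with initial values 1 and 0. By \<open>stein_chaos\<close> each derivative at s is -s
  times the transform weighted with \<open>gamma\<close>, and replacing \<open>gamma\<close> by the
  constant \<open>v\<close> costs at most \<open>|s| * e\<close>.\<close>

lemma chaos_trig_bound:
  fixes t :: real and p :: nat and J :: "'i set" and a :: "'i \<Rightarrow> real"
  defines "F \<equiv> \<lambda>\<omega>. chaos (Suc p) J a (\<lambda>i. X i \<omega>)"
  defines "v \<equiv> expectation (\<lambda>\<omega>. (F \<omega>)\<^sup>2)"
  defines "e \<equiv> expectation (\<lambda>\<omega>. \<bar>gamma p J a (\<lambda>i. X i \<omega>) - v\<bar>)"
  shows "\<bar>expectation (\<lambda>\<omega>. cos (t * F \<omega>)) - exp (- v * t\<^sup>2 / 2)\<bar> \<le> t\<^sup>2 * e"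
    and "\<bar>expectation (\<lambda>\<omega>. sin (t * F \<omega>))\<bar> \<le> t\<^sup>2 * e"
proof -
  let ?G = "\<lambda>\<omega>. gamma p J a (\<lambda>i. X i \<omega>)"
  have [measurable]: "F \<in> borel_measurable M" unfolding F_def using tame_field_measurable[OF tame_chaos] .
  have iF: "integrable M F" unfolding F_def using tame_integrable[OF tame_chaos] .
  have iG: "integrable M ?G" using tame_integrable[OF tame_gamma] .
  have [measurable]: "?G \<in> borel_measurable M" using iG by auto
  have v0: "0 \<le> v" unfolding v_def by simp
  have e0: "0 \<le> e" unfolding e_def by simp
  have ie: "integrable M (\<lambda>\<omega>. \<bar>?G \<omega> - v\<bar>)" using iG by simp
  have ib: "integrable M (\<lambda>\<omega>. h \<omega> * g (s * F \<omega>))"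
    if "integrable M h" "g = sin \<or> g = cos" for h s and g :: "real \<Rightarrow> real"
    using that by (intro Bochner_Integration.integrable_bound[OF that(1)]) (auto simp: abs_mult intro!: mult_left_le)
  have c: "expectation (\<lambda>\<omega>. F \<omega> * cos (s * F \<omega>)) = - s * expectation (\<lambda>\<omega>. ?G \<omega> * sin (s * F \<omega>))" for s
    unfolding F_def
    by (rule stein_chaos[where \<psi>="\<lambda>x. cos (s * chaos (Suc p) J a x)" and \<eta>="\<lambda>x. sin (s * chaos (Suc p) J a x)"])
      (intro stein_pair_cos stein_pair_chaos tame_cos tame_sin tame_chaos)+
  have s: "expectation (\<lambda>\<omega>. F \<omega> * sin (s * F \<omega>)) = s * expectation (\<lambda>\<omega>. ?G \<omega> * cos (s * F \<omega>))" for s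
    unfolding F_def
    by (rule stein_chaos[where \<psi>="\<lambda>x. sin (s * chaos (Suc p) J a x)" and \<eta>="\<lambda>x. cos (s * chaos (Suc p) J a x)"])
      (intro stein_pair_sin stein_pair_chaos tame_cos tame_sin tame_chaos)+
  have bound: "\<bar>- s * expectation (\<lambda>\<omega>. ?G \<omega> * g (s * F \<omega>)) + v * s * expectation (\<lambda>\<omega>. g (s * F \<omega>))\<bar> \<le> \<bar>s\<bar> * e"
    if g: "g = sin \<or> g = cos" for s and g :: "real \<Rightarrow> real"
  proof -
    have ig: "integrable M (\<lambda>\<omega>. g (s * F \<omega>))" using ib[of "\<lambda>_. 1" g s] g by simp
    have "expectation (\<lambda>\<omega>. (?G \<omega> - v) * g (s * F \<omega>)) = expectation (\<lambda>\<omega>. ?G \<omega> * g (s * F \<omega>)) - v * expectation (\<lambda>\<omega>. g (s * F \<omega>))"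
      using ib[OF iG g, of s] ig by (simp add: left_diff_distrib)
    moreover have "\<bar>expectation (\<lambda>\<omega>. (?G \<omega> - v) * g (s * F \<omega>))\<bar> \<le> e"
    proof -
      have "\<bar>expectation (\<lambda>\<omega>. (?G \<omega> - v) * g (s * F \<omega>))\<bar> \<le> expectation (\<lambda>\<omega>. \<bar>(?G \<omega> - v) * g (s * F \<omega>)\<bar>)"
        by (rule integral_abs_bound)
      also have "\<dots> \<le> e" unfolding e_def
        using iG g by (intro integral_mono integrable_abs ib ie) (auto simp: abs_mult intro!: mult_left_le)
      finally show ?thesis .
    qed
    ultimately have "\<bar>s\<bar> * \<bar>expectation (\<lambda>\<omega>. ?G \<omega> * g (s * F \<omega>)) - v * expectation (\<lambda>\<omega>. g (s * F \<omega>))\<bar> \<le> \<bar>s\<bar> * e"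
      by (intro mult_left_mono) auto
    moreover have "- s * x + v * s * y = - (s * (x - v * y))" for x y by (simp add: algebra_simps)
    ultimately show ?thesis by (simp only: abs_minus_cancel abs_mult)
  qed
  show "\<bar>expectation (\<lambda>\<omega>. cos (t * F \<omega>)) - exp (- v * t\<^sup>2 / 2)\<bar> \<le> t\<^sup>2 * e"
    using gaussian_ode_bound[OF has_derivative_expectation_trig(1)[OF iF], of v e t] bound[of cos] v0 e0
    by (simp add: s prob_space)
  show "\<bar>expectation (\<lambda>\<omega>. sin (t * F \<omega>))\<bar> \<le> t\<^sup>2 * e"
    using gaussian_ode_bound[OF has_derivative_expectation_trig(2)[OF iF], of v e t] bound[of sin] v0 e0
    by (simp add: c)
qed

text \<open>The diagrams are four-cycles through i, j, l, k in this order, with edge multiplicities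
  alternating between \<open>r\<close> and \<open>s\<close>.\<close>

definition cycle_sum :: "'i set \<Rightarrow> nat \<Rightarrow> nat \<Rightarrow> real" where
  "cycle_sum J r s = (\<Sum>i\<in>J. \<Sum>j\<in>J. \<Sum>k\<in>J. \<Sum>l\<in>J. (\<bar>R i j\<bar> * \<bar>R k l\<bar>) ^ r * (\<bar>R i k\<bar> * \<bar>R j l\<bar>) ^ s)"

lemma double_sum_square:
  fixes f :: "'i \<Rightarrow> 'i \<Rightarrow> real"
  shows "(\<Sum>i\<in>J. \<Sum>j\<in>J. f i j)\<^sup>2 = (\<Sum>i\<in>J. \<Sum>j\<in>J. \<Sum>k\<in>J. \<Sum>l\<in>J. f i j * f k l)"
  unfolding power2_eq_square sum_distrib_right unfolding sum_distrib_left ..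

text \<open>Expanding the square gives covariances of pair products. The factors
  \<open>R i j\<close> and \<open>R k l\<close> from \<open>gamma\<close> raise the exponent r of
  \<open>hermite_cov_bound\<close> to \<open>Suc r\<close>, so that \<open>Suc r\<close> and
  \<open>p - r\<close> are both positive and add up to p + 1.\<close>

lemma gamma_variance_bound:
  "\<exists>K\<ge>0. \<forall>J a b. finite J \<longrightarrow> (\<forall>j\<in>J. \<bar>a j\<bar> \<le> b) \<longrightarrow>
     expectation (\<lambda>\<omega>. (gamma p J a (\<lambda>i. X i \<omega>) - expectation (\<lambda>\<omega>. (chaos (Suc p) J a (\<lambda>i. X i \<omega>))\<^sup>2))\<^sup>2)
       \<le> K * b ^ 4 * (\<Sum>r<p. cycle_sum J (Suc r) (p - r))"
proof -
  let ?H = "\<lambda>j \<omega>. poly (hermite p) (X j \<omega>)"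
  let ?E2 = "\<lambda>j k. expectation (\<lambda>\<omega>. ?H j \<omega> * ?H k \<omega>)"
  let ?E4 = "\<lambda>i j k l. expectation (\<lambda>\<omega>. ?H i \<omega> * ?H j \<omega> * ?H k \<omega> * ?H l \<omega>)"
  let ?Y = "\<lambda>j k \<omega>. ?H j \<omega> * ?H k \<omega> - ?E2 j k"
  let ?S = "\<lambda>i j k l. \<Sum>r<p. (\<bar>R i j\<bar> * \<bar>R k l\<bar>) ^ r * (\<bar>R i k\<bar> * \<bar>R j l\<bar>) ^ (p - r) +
                  (\<bar>R i j\<bar> * \<bar>R k l\<bar>) ^ r * (\<bar>R i l\<bar> * \<bar>R j k\<bar>) ^ (p - r)"
  obtain K where K0: "K \<ge> 0" and K: "\<And>i j k l. \<bar>?E4 i j k l - ?E2 i j * ?E2 k l\<bar> \<le> K * ?S i j k l"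
    using hermite_cov_bound[of p] by blast
  define q where "q = real (Suc p)"
  have i2: "integrable M (\<lambda>\<omega>. ?H j \<omega> * ?H k \<omega>)" for j k
    by (rule tame_integrable[OF tame_mult[OF tame_hermite tame_hermite]])
  have i4: "integrable M (\<lambda>\<omega>. (?H i \<omega> * ?H j \<omega>) * (?H k \<omega> * ?H l \<omega>))" for i j k l
    by (rule tame_integrable[OF tame_mult[OF tame_mult[OF tame_hermite tame_hermite] tame_mult[OF tame_hermite tame_hermite]]])
  have YY: "?Y i j \<omega> * ?Y k l \<omega> = (?H i \<omega> * ?H j \<omega>) * (?H k \<omega> * ?H l \<omega>) - ?E2 k l * (?H i \<omega> * ?H j \<omega>)
     - ?E2 i j * (?H k \<omega> * ?H l \<omega>) + ?E2 i j * ?E2 k l" for i j k l \<omega>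
    by (simp add: algebra_simps)
  have iY: "integrable M (\<lambda>\<omega>. ?Y i j \<omega> * ?Y k l \<omega>)" for i j k l
    unfolding YY using i2 i4 by simp
  have eY: "expectation (\<lambda>\<omega>. ?Y i j \<omega> * ?Y k l \<omega>) = ?E4 i j k l - ?E2 i j * ?E2 k l" for i j k l
    unfolding YY using i2 i4 by (simp add: prob_space mult.assoc)
  show ?thesis
  \<comment> \<open>The square stems from the factor \<open>Suc p\<close> in \<open>gamma\<close>,
    the 2 from the two ways of linking the pairs, whose sums agree after exchanging \<open>k\<close>
    and \<open>l\<close>.\<close>
  proof (intro exI[of _ "2 * q\<^sup>2 * K"] conjI allI impI)
    fix J :: "'i set" and a :: "'i \<Rightarrow> real" and b :: real
    assume J: "finite J" and b: "\<forall>j\<in>J. \<bar>a j\<bar> \<le> b"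
    let ?w = "\<lambda>i j. q * (a i * a j * R i j)"
    let ?v = "expectation (\<lambda>\<omega>. (chaos (Suc p) J a (\<lambda>i. X i \<omega>))\<^sup>2)"
    \<comment> \<open>The right side is the expectation of \<open>gamma\<close>, so that a variance
      is being estimated.\<close>
    have v: "?v = (\<Sum>i\<in>J. \<Sum>j\<in>J. ?w i j * ?E2 i j)"
      unfolding chaos_variance hermite_orthogonality sum_distrib_left
      by (intro sum.cong refl) (simp add: q_def algebra_simps)
    have gv: "gamma p J a (\<lambda>i. X i \<omega>) - ?v = (\<Sum>i\<in>J. \<Sum>j\<in>J. ?w i j * ?Y i j \<omega>)" for \<omega>
      unfolding v gamma_def q_def[symmetric] by (simp add: right_diff_distrib sum_subtractf)
    have sq: "(gamma p J a (\<lambda>i. X i \<omega>) - ?v)\<^sup>2 =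
        (\<Sum>i\<in>J. \<Sum>j\<in>J. \<Sum>k\<in>J. \<Sum>l\<in>J. (?w i j * ?w k l) * (?Y i j \<omega> * ?Y k l \<omega>))" for \<omega>
      unfolding gv double_sum_square by (intro sum.cong refl) (simp only: mult_ac)
    have "expectation (\<lambda>\<omega>. (gamma p J a (\<lambda>i. X i \<omega>) - ?v)\<^sup>2) =
        (\<Sum>i\<in>J. \<Sum>j\<in>J. \<Sum>k\<in>J. \<Sum>l\<in>J. (?w i j * ?w k l) * (?E4 i j k l - ?E2 i j * ?E2 k l))"
      unfolding sq eY[symmetric] using iY
      by (simp only: Bochner_Integration.integral_sum Bochner_Integration.integrable_sum integrable_mult_right integral_mult_right_zero)
    also have "\<dots> \<le> (\<Sum>i\<in>J. \<Sum>j\<in>J. \<Sum>k\<in>J. \<Sum>l\<in>J. q\<^sup>2 * b ^ 4 * K * ((\<bar>R i j\<bar> * \<bar>R k l\<bar>) * ?S i j k l))"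
    proof (intro sum_mono)
      fix i j k l assume m: "i \<in> J" "j \<in> J" "k \<in> J" "l \<in> J"
      have "\<bar>a i\<bar> * \<bar>a j\<bar> * (\<bar>a k\<bar> * \<bar>a l\<bar>) \<le> b * b * (b * b)"
        using b m by (intro mult_mono) (auto intro: order_trans[OF abs_ge_zero])
      then have ab: "\<bar>a i\<bar> * \<bar>a j\<bar> * (\<bar>a k\<bar> * \<bar>a l\<bar>) \<le> b ^ 4" by (simp add: power4_eq_xxxx mult.assoc)
      have "(?w i j * ?w k l) * (?E4 i j k l - ?E2 i j * ?E2 k l) \<le> \<bar>?w i j * ?w k l\<bar> * \<bar>?E4 i j k l - ?E2 i j * ?E2 k l\<bar>"
        unfolding abs_mult[symmetric] by (rule abs_ge_self)
      also have "\<dots> \<le> \<bar>?w i j * ?w k l\<bar> * (K * ?S i j k l)"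
        by (intro mult_left_mono K) simp
      also have "\<bar>?w i j * ?w k l\<bar> = (\<bar>a i\<bar> * \<bar>a j\<bar> * (\<bar>a k\<bar> * \<bar>a l\<bar>)) * (q\<^sup>2 * (\<bar>R i j\<bar> * \<bar>R k l\<bar>))"
        by (simp add: abs_mult q_def power2_eq_square mult_ac)
      also have "\<dots> * (K * ?S i j k l) \<le> b ^ 4 * (q\<^sup>2 * (\<bar>R i j\<bar> * \<bar>R k l\<bar>)) * (K * ?S i j k l)"
        using K0 by (intro mult_right_mono ab mult_nonneg_nonneg sum_nonneg) auto
      also have "\<dots> = q\<^sup>2 * b ^ 4 * K * ((\<bar>R i j\<bar> * \<bar>R k l\<bar>) * ?S i j k l)" by (simp only: mult_ac)
      finally show "(?w i j * ?w k l) * (?E4 i j k l - ?E2 i j * ?E2 k l) \<le> q\<^sup>2 * b ^ 4 * K * ((\<bar>R i j\<bar> * \<bar>R k l\<bar>) * ?S i j k l)" .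
    qed
    also have "\<dots> = q\<^sup>2 * b ^ 4 * K * (\<Sum>i\<in>J. \<Sum>j\<in>J. \<Sum>k\<in>J. \<Sum>l\<in>J. (\<bar>R i j\<bar> * \<bar>R k l\<bar>) * ?S i j k l)"
      by (simp only: sum_distrib_left)
    also have "(\<Sum>i\<in>J. \<Sum>j\<in>J. \<Sum>k\<in>J. \<Sum>l\<in>J. (\<bar>R i j\<bar> * \<bar>R k l\<bar>) * ?S i j k l) =
        (\<Sum>r<p. cycle_sum J (Suc r) (p - r)) + (\<Sum>r<p. cycle_sum J (Suc r) (p - r))"
    proof -
      let ?f = "\<lambda>r i j k l. (\<bar>R i j\<bar> * \<bar>R k l\<bar>) ^ Suc r * (\<bar>R i k\<bar> * \<bar>R j l\<bar>) ^ (p - r)"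
      have "(\<Sum>i\<in>J. \<Sum>j\<in>J. \<Sum>k\<in>J. \<Sum>l\<in>J. (\<bar>R i j\<bar> * \<bar>R k l\<bar>) * ?S i j k l) =
         (\<Sum>i\<in>J. \<Sum>j\<in>J. \<Sum>k\<in>J. \<Sum>l\<in>J. \<Sum>r<p. ?f r i j k l + ?f r i j l k)"
        unfolding sum_distrib_left
        by (intro sum.cong refl) (simp add: R_commute algebra_simps)
      also have "\<dots> = (\<Sum>r<p. \<Sum>i\<in>J. \<Sum>j\<in>J. \<Sum>k\<in>J. \<Sum>l\<in>J. ?f r i j k l + ?f r i j l k)"
        by (simp only: sum.swap[where B="{..<p}"])
      also have "\<dots> = (\<Sum>r<p. cycle_sum J (Suc r) (p - r) + cycle_sum J (Suc r) (p - r))"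
      proof (intro sum.cong refl)
        fix r
        have "(\<Sum>i\<in>J. \<Sum>j\<in>J. \<Sum>k\<in>J. \<Sum>l\<in>J. ?f r i j l k) = (\<Sum>i\<in>J. \<Sum>j\<in>J. \<Sum>k\<in>J. \<Sum>l\<in>J. ?f r i j k l)"
          by (intro sum.cong refl sum.swap)
        then show "(\<Sum>i\<in>J. \<Sum>j\<in>J. \<Sum>k\<in>J. \<Sum>l\<in>J. ?f r i j k l + ?f r i j l k) =
          cycle_sum J (Suc r) (p - r) + cycle_sum J (Suc r) (p - r)"
          unfolding cycle_sum_def by (simp only: sum.distrib)
      qed
      finally show ?thesis by (simp only: sum.distrib)
    qed
    finally show "expectation (\<lambda>\<omega>. (gamma p J a (\<lambda>i. X i \<omega>) - ?v)\<^sup>2) \<le>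
       2 * q\<^sup>2 * K * b ^ 4 * (\<Sum>r<p. cycle_sum J (Suc r) (p - r))"
      by (simp add: algebra_simps)
  qed (use K0 in simp)
qed

text \<open>The variance of |Y| is nonnegative.\<close>

lemma expectation_abs_le_sqrt:
  assumes [measurable]: "Y \<in> borel_measurable M" and "integrable M Y" "integrable M (\<lambda>\<omega>. (Y \<omega>)\<^sup>2)"
  shows "expectation (\<lambda>\<omega>. \<bar>Y \<omega>\<bar>) \<le> sqrt (expectation (\<lambda>\<omega>. (Y \<omega>)\<^sup>2))"
proof (rule real_le_rsqrt)
  have "0 \<le> variance (\<lambda>\<omega>. \<bar>Y \<omega>\<bar>)" by (rule variance_positive)
  also have "\<dots> = expectation (\<lambda>\<omega>. \<bar>Y \<omega>\<bar>\<^sup>2) - (expectation (\<lambda>\<omega>. \<bar>Y \<omega>\<bar>))\<^sup>2"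
    using assms by (intro variance_eq) auto
  finally show "(expectation (\<lambda>\<omega>. \<bar>Y \<omega>\<bar>))\<^sup>2 \<le> expectation (\<lambda>\<omega>. (Y \<omega>)\<^sup>2)" by simp
qed

text \<open>\<open>K\<close> is uniform in the index set, the coefficients and the frequency, as
  required along growing boxes. The 2 adds the bounds for real and imaginary part. For p = 0 the sum
  over r is empty and the right side is 0.\<close>

lemma chaos_char_bound:
  "\<exists>K\<ge>0. \<forall>J a b t. finite J \<longrightarrow> (\<forall>j\<in>J. \<bar>a j\<bar> \<le> b) \<longrightarrow>
     cmod (char (distr M borel (\<lambda>\<omega>. chaos (Suc p) J a (\<lambda>i. X i \<omega>))) t -
        complex_of_real (exp (- expectation (\<lambda>\<omega>. (chaos (Suc p) J a (\<lambda>i. X i \<omega>))\<^sup>2) * t\<^sup>2 / 2)))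
       \<le> 2 * t\<^sup>2 * sqrt (K * b ^ 4 * (\<Sum>r<p. cycle_sum J (Suc r) (p - r)))"
proof -
  obtain K where K0: "K \<ge> 0" and K: "\<And>J a b. finite J \<Longrightarrow> \<forall>j\<in>J. \<bar>a j\<bar> \<le> b \<Longrightarrow>
     expectation (\<lambda>\<omega>. (gamma p J a (\<lambda>i. X i \<omega>) - expectation (\<lambda>\<omega>. (chaos (Suc p) J a (\<lambda>i. X i \<omega>))\<^sup>2))\<^sup>2)
       \<le> K * b ^ 4 * (\<Sum>r<p. cycle_sum J (Suc r) (p - r))"
    using gamma_variance_bound[of p] by blast
  show ?thesis
  proof (intro exI[of _ K] conjI allI impI K0)
    fix J :: "'i set" and a :: "'i \<Rightarrow> real" and b t :: real
    assume J: "finite J" and b: "\<forall>j\<in>J. \<bar>a j\<bar> \<le> b"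
    let ?F = "\<lambda>\<omega>. chaos (Suc p) J a (\<lambda>i. X i \<omega>)"
    let ?v = "expectation (\<lambda>\<omega>. (?F \<omega>)\<^sup>2)"
    let ?G = "\<lambda>x. gamma p J a x - ?v"
    let ?e = "expectation (\<lambda>\<omega>. \<bar>?G (\<lambda>i. X i \<omega>)\<bar>)"
    have tG: "tame i ?G" for i
      using tame_add[OF tame_gamma tame_const[of _ "- ?v"]] by simp
    have "?e \<le> sqrt (expectation (\<lambda>\<omega>. (?G (\<lambda>i. X i \<omega>))\<^sup>2))"
    proof (rule expectation_abs_le_sqrt)
      show "integrable M (\<lambda>\<omega>. (?G (\<lambda>i. X i \<omega>))\<^sup>2)"
        using tame_integrable[OF tame_mult[OF tG tG]] by (simp only: power2_eq_square[of "?G _"])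
    qed (rule tame_field_measurable[OF tG] tame_integrable[OF tG])+
    also have "\<dots> \<le> sqrt (K * b ^ 4 * (\<Sum>r<p. cycle_sum J (Suc r) (p - r)))"
      by (intro real_sqrt_le_mono K J b)
    finally have e: "?e \<le> sqrt (K * b ^ 4 * (\<Sum>r<p. cycle_sum J (Suc r) (p - r)))" .
    have [measurable]: "?F \<in> borel_measurable M" by (rule tame_field_measurable[OF tame_chaos])
    have "cmod (char (distr M borel ?F) t - complex_of_real (exp (- ?v * t\<^sup>2 / 2))) =
       cmod (complex_of_real (expectation (\<lambda>\<omega>. cos (t * ?F \<omega>)) - exp (- ?v * t\<^sup>2 / 2)) +
         \<i> * complex_of_real (expectation (\<lambda>\<omega>. sin (t * ?F \<omega>))))"
      by (subst char_distr_cos_sin) (auto simp: finite_measure_axioms algebra_simps)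
    also have "\<dots> \<le> \<bar>expectation (\<lambda>\<omega>. cos (t * ?F \<omega>)) - exp (- ?v * t\<^sup>2 / 2)\<bar> + \<bar>expectation (\<lambda>\<omega>. sin (t * ?F \<omega>))\<bar>"
      by (rule order_trans[OF norm_triangle_ineq]) (simp only: norm_mult norm_of_real norm_ii mult_1)
    also have "\<dots> \<le> 2 * t\<^sup>2 * ?e"
      using chaos_trig_bound[of t p J a] by linarith
    also have "\<dots> \<le> 2 * t\<^sup>2 * sqrt (K * b ^ 4 * (\<Sum>r<p. cycle_sum J (Suc r) (p - r)))"
      by (intro mult_left_mono e) simp
    finally show "cmod (char (distr M borel ?F) t - complex_of_real (exp (- ?v * t\<^sup>2 / 2))) \<le>
       2 * t\<^sup>2 * sqrt (K * b ^ 4 * (\<Sum>r<p. cycle_sum J (Suc r) (p - r)))" .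
  qed
qed

end

section \<open>Lattice sums\<close>

lemma summable_on_tail:
  fixes g :: "'u \<Rightarrow> real"
  assumes "g summable_on UNIV" "0 < e"
  obtains F where "finite F" "\<And>A. finite A \<Longrightarrow> A \<inter> F = {} \<Longrightarrow> sum g A < e"
proof -
  have "(sum g \<longlongrightarrow> infsum g UNIV) (finite_subsets_at_top UNIV)"
    using has_sum_infsum[OF assms(1)] by (simp add: has_sum_def)
  then have "\<forall>\<^sub>F A in finite_subsets_at_top UNIV. dist (sum g A) (infsum g UNIV) < e / 2"
    using assms(2) by (intro tendstoD) auto
  then obtain F where F: "finite F"
    "\<And>A. finite A \<Longrightarrow> F \<subseteq> A \<Longrightarrow> dist (sum g A) (infsum g UNIV) < e / 2"
    unfolding eventually_finite_subsets_at_top by auto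
  show ?thesis
  proof (rule that[OF F(1)])
    fix A assume A: "finite A" "A \<inter> F = {}"
    have "sum g (F \<union> A) = sum g F + sum g A" using A F(1) by (intro sum.union_disjoint) auto
    moreover have "\<bar>sum g F - infsum g UNIV\<bar> < e / 2" "\<bar>sum g (F \<union> A) - infsum g UNIV\<bar> < e / 2"
      using F(2)[of F] F(2)[of "F \<union> A"] F(1) A(1) by (simp_all add: dist_real_def)
    ultimately show "sum g A < e" by linarith
  qed
qed

text \<open>A crude form of Young's inequality: both bases are replaced by the larger one.\<close>

lemma power_mult_le_power_sum:
  fixes x y :: real
  assumes "0 \<le> x" "0 \<le> y" shows "x ^ r * y ^ s \<le> x ^ (r + s) + y ^ (r + s)"
proof -
  have "x ^ r * y ^ s \<le> max x y ^ r * max x y ^ s"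
    using assms by (intro mult_mono power_mono) auto
  also have "\<dots> = max x y ^ (r + s)" by (simp add: power_add)
  also have "\<dots> \<le> x ^ (r + s) + y ^ (r + s)" using assms by (auto simp: max_def)
  finally show ?thesis .
qed

text \<open>The function \<open>f\<close> is split at level \<open>d\<close>: above it, \<open>f\<close> is controlled by \<open>f ^ q\<close>.\<close>

lemma average_tendsto_0:
  fixes f :: "'u \<Rightarrow> real" and n :: "nat \<Rightarrow> real" and D :: "nat \<Rightarrow> 'u set"
  assumes f: "\<And>u. 0 \<le> f u" "\<And>u. f u \<le> 1" and sm: "(\<lambda>u. f u ^ q) summable_on UNIV"
    and D: "\<And>N. finite (D N)" "\<And>N. real (card (D N)) \<le> C * n N" and n: "filterlim n at_top sequentially"
  shows "(\<lambda>N. (\<Sum>u\<in>D N. f u) / n N) \<longlonglongrightarrow> 0"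
proof (rule tendstoI)
  fix e :: real assume e: "0 < e"
  define S where "S = (\<Sum>\<^sub>\<infinity>u. f u ^ q)"
  \<comment> \<open>Makes \<open>d * C\<close> at most \<open>e / 2\<close>; the added 1 keeps the
    denominator positive.\<close>
  define d where "d = e / (2 * (\<bar>C\<bar> + 1))"
  have C: "0 < \<bar>C\<bar> + 1" by linarith
  have d: "0 < d" using e C by (simp add: d_def)
  have fS: "(\<Sum>u\<in>A. f u ^ q) \<le> S" if "finite A" for A
    unfolding S_def using that f by (intro finite_sum_le_infsum sm) auto
  have le: "f u \<le> d + f u ^ q / d ^ q" for u
  proof (cases "f u \<le> d")
    case False
    then have "1 \<le> (f u / d) ^ q" using d by (intro one_le_power) simp
    then have "1 \<le> f u ^ q / d ^ q" by (simp add: power_divide)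
    then show ?thesis using f(2)[of u] d by linarith
  qed (use d f in \<open>auto intro: add_increasing2\<close>)
  have lim: "(\<lambda>N. (S / d ^ q) / n N) \<longlonglongrightarrow> 0"
    by (rule tendsto_divide_0[OF tendsto_const]) (rule filterlim_at_top_imp_at_infinity[OF n])
  have "\<forall>\<^sub>F N in sequentially. (S / d ^ q) / n N < e / 2"
    using order_tendstoD(2)[OF lim, of "e / 2"] e by simp
  moreover have "\<forall>\<^sub>F N in sequentially. n N > 0"
    using n by (simp add: filterlim_at_top_dense)
  ultimately show "\<forall>\<^sub>F N in sequentially. dist ((\<Sum>u\<in>D N. f u) / n N) 0 < e"
  proof eventually_elim
    case (elim N)
    have "(\<Sum>u\<in>D N. f u) \<le> (\<Sum>u\<in>D N. d + f u ^ q / d ^ q)" by (intro sum_mono le)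
    also have "\<dots> = d * card (D N) + (\<Sum>u\<in>D N. f u ^ q) / d ^ q"
      by (simp add: sum.distrib sum_divide_distrib)
    also have "\<dots> \<le> d * (C * n N) + S / d ^ q"
      using d D fS by (intro add_mono mult_left_mono divide_right_mono) auto
    also have "d * (C * n N) \<le> (e / 2) * n N"
    proof -
      have "d * C \<le> d * (\<bar>C\<bar> + 1)" using d by (intro mult_left_mono) auto
      also have "\<dots> = e / 2" using C by (simp add: d_def field_simps)
      finally have "d * C * n N \<le> e / 2 * n N" using elim by (intro mult_right_mono) auto
      then show ?thesis by (simp add: mult.assoc)
    qed
    finally have "(\<Sum>u\<in>D N. f u) / n N \<le> ((e / 2) * n N + S / d ^ q) / n N"
      using elim by (intro divide_right_mono) auto
    also have "\<dots> = e / 2 + (S / d ^ q) / n N" using elim by (simp add: add_divide_distrib)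
    also have "\<dots> < e" using elim by linarith
    finally have "(\<Sum>u\<in>D N. f u) / n N < e" .
    moreover have "0 \<le> (\<Sum>u\<in>D N. f u) / n N" using f elim by (intro divide_nonneg_nonneg sum_nonneg) auto
    ultimately show ?case by (simp add: dist_real_def)
  qed
qed

text \<open>The delicate case is that neither \<open>f ^ r\<close> nor \<open>f ^ s\<close> is
  summable. Outside a finite set \<open>F\<close> that carries all but \<open>d\<close> of the sum
  of \<open>f ^ (r + s)\<close>, the product of sums is at most \<open>2 * (card (D N) * d)\<close>
  by \<open>power_mult_le_power_sum\<close>. Each remaining product has one factor at most
  \<open>card F\<close>, while the other is of smaller order than \<open>n N\<close> by
  \<open>average_tendsto_0\<close>, since positive exponents give
  \<open>f ^ r \<le> f\<close>.\<close>

lemma product_average_tendsto_0: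
  fixes f :: "'u \<Rightarrow> real" and n :: "nat \<Rightarrow> real" and D :: "nat \<Rightarrow> 'u set"
  assumes f: "\<And>u. 0 \<le> f u" "\<And>u. f u \<le> 1" and sm: "(\<lambda>u. f u ^ (r + s)) summable_on UNIV"
    and D: "\<And>N. finite (D N)" "\<And>N. real (card (D N)) \<le> C * n N" and n: "filterlim n at_top sequentially"
    and rs: "0 < r" "0 < s"
  shows "(\<lambda>N. (\<Sum>u\<in>D N. f u ^ r) * (\<Sum>u\<in>D N. f u ^ s) / n N) \<longlonglongrightarrow> 0"
proof (rule tendstoI)
  fix e :: real assume e: "0 < e"
  \<comment> \<open>Half of \<open>e\<close> is reserved for the part outside \<open>F\<close>,
    which costs \<open>2 * (card (D N) * d)\<close>; hence the 4.\<close>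
  define d where "d = e / (4 * (\<bar>C\<bar> + 1))"
  have C: "0 < \<bar>C\<bar> + 1" by linarith
  have d: "0 < d" using e C by (simp add: d_def)
  obtain F where F: "finite F" "\<And>A. finite A \<Longrightarrow> A \<inter> F = {} \<Longrightarrow> (\<Sum>u\<in>A. f u ^ (r + s)) < d"
    using summable_on_tail[OF sm d] by blast
  have lim: "(\<lambda>N. 2 * card F * ((\<Sum>u\<in>D N. f u) / n N)) \<longlonglongrightarrow> 0"
    by (rule tendsto_mult_right_zero[OF average_tendsto_0[OF f sm D n]])
  have "\<forall>\<^sub>F N in sequentially. 2 * card F * ((\<Sum>u\<in>D N. f u) / n N) < e / 2"
    using order_tendstoD(2)[OF lim, of "e / 2"] e by simp
  moreover have "\<forall>\<^sub>F N in sequentially. n N > 0"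
    using n by (simp add: filterlim_at_top_dense)
  ultimately show "\<forall>\<^sub>F N in sequentially. dist ((\<Sum>u\<in>D N. f u ^ r) * (\<Sum>u\<in>D N. f u ^ s) / n N) 0 < e"
  proof eventually_elim
    case (elim N)
    let ?E = "D N - F" and ?I = "D N \<inter> F"
    have split: "(\<Sum>u\<in>D N. g u) = (\<Sum>u\<in>?E. g u) + (\<Sum>u\<in>?I. g u)" for g :: "'u \<Rightarrow> real"
      using sum.Int_Diff[OF D(1), of g N F] by (simp add: add.commute)
    have pw: "f u ^ k \<le> f u" if "0 < k" for u k
      using f[of u] power_decreasing[of 1 k "f u"] that by simp
    have I1: "(\<Sum>u\<in>?I. f u ^ k) \<le> card F" for k
    proof -
      have "(\<Sum>u\<in>?I. f u ^ k) \<le> (\<Sum>u\<in>?I. 1)" using f by (intro sum_mono power_le_one)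
      also have "\<dots> \<le> card F" using F(1) by (simp add: card_mono)
      finally show ?thesis .
    qed
    have D1: "(\<Sum>u\<in>D N. f u ^ k) \<le> (\<Sum>u\<in>D N. f u)" if "0 < k" for k
      using pw[OF that] by (intro sum_mono)
    have E1: "(\<Sum>u\<in>?E. f u ^ k) \<le> (\<Sum>u\<in>D N. f u ^ k)" for k
      using D(1) f by (intro sum_mono2) auto
    have nn: "0 \<le> (\<Sum>u\<in>A. f u ^ k)" for A k using f by (intro sum_nonneg) auto
    have EE: "(\<Sum>u\<in>?E. f u ^ r) * (\<Sum>u\<in>?E. f u ^ s) \<le> 2 * (card (D N) * d)"
    proof -
      have "(\<Sum>u\<in>?E. f u ^ r) * (\<Sum>u\<in>?E. f u ^ s) \<le> (\<Sum>u\<in>?E. \<Sum>v\<in>?E. f u ^ (r + s) + f v ^ (r + s))"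
        unfolding sum_product using f by (intro sum_mono power_mult_le_power_sum)
      also have "\<dots> = 2 * (card ?E * (\<Sum>u\<in>?E. f u ^ (r + s)))"
        by (simp add: sum.distrib sum_distrib_left)
      also have "\<dots> \<le> 2 * (card (D N) * d)"
        using F(2)[of ?E] D(1) nn[where A="?E" and k="r + s"] d by (intro mult_left_mono mult_mono) (auto intro: card_mono less_imp_le)
      finally show ?thesis .
    qed
    have "(\<Sum>u\<in>D N. f u ^ r) * (\<Sum>u\<in>D N. f u ^ s) =
       (\<Sum>u\<in>?E. f u ^ r) * (\<Sum>u\<in>?E. f u ^ s) + (\<Sum>u\<in>?E. f u ^ r) * (\<Sum>u\<in>?I. f u ^ s) + (\<Sum>u\<in>?I. f u ^ r) * (\<Sum>u\<in>D N. f u ^ s)"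
      by (simp only: split distrib_left distrib_right)
    also have "\<dots> \<le> 2 * (card (D N) * d) + (\<Sum>u\<in>D N. f u) * card F + card F * (\<Sum>u\<in>D N. f u)"
      using order_trans[OF E1 D1[OF rs(1)]] D1[OF rs(2)] nn f
      by (intro add_mono EE mult_mono I1) (auto intro!: sum_nonneg)
    also have "\<dots> \<le> (e / 2) * n N + 2 * card F * (\<Sum>u\<in>D N. f u)"
    proof -
      have "2 * (card (D N) * d) \<le> 2 * ((\<bar>C\<bar> + 1) * n N * d)"
        using D(2)[of N] d elim by (intro mult_left_mono mult_right_mono order_trans[OF D(2)]) auto
      also have "\<dots> = (e / 2) * n N" unfolding d_def using C by (simp add: field_simps)
      finally show ?thesis by simp
    qed
    finally have "(\<Sum>u\<in>D N. f u ^ r) * (\<Sum>u\<in>D N. f u ^ s) / n N \<le> ((e / 2) * n N + 2 * card F * (\<Sum>u\<in>D N. f u)) / n N"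
      using elim by (intro divide_right_mono) auto
    also have "\<dots> = e / 2 + 2 * card F * ((\<Sum>u\<in>D N. f u) / n N)" using elim by (simp add: add_divide_distrib)
    also have "\<dots> < e" using elim by linarith
    finally have "(\<Sum>u\<in>D N. f u ^ r) * (\<Sum>u\<in>D N. f u ^ s) / n N < e" .
    moreover have "0 \<le> (\<Sum>u\<in>D N. f u ^ r) * (\<Sum>u\<in>D N. f u ^ s) / n N"
      using nn elim by (intro divide_nonneg_nonneg mult_nonneg_nonneg) auto
    ultimately show ?case by (simp add: dist_real_def)
  qed
qed

text \<open>Dominated convergence for the counting measure; the majorant \<open>w\<close> makes
  every unordered sum involved an integral.\<close>

lemma infsum_dominated_convergence:
  fixes f :: "nat \<Rightarrow> 'u \<Rightarrow> real"
  assumes sm: "w summable_on UNIV" and b: "\<And>n u. \<bar>f n u\<bar> \<le> w u" and l: "\<And>u. (\<lambda>n. f n u) \<longlonglongrightarrow> g u"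
  shows "(\<lambda>n. infsum (f n) UNIV) \<longlonglongrightarrow> infsum g UNIV"
proof -
  have "0 \<le> w u" for u using b[of 0 u] by linarith
  then have "(\<lambda>u. norm (w u)) summable_on UNIV" using sm by simp
  then have w: "integrable (count_space UNIV) w"
    by (simp only: abs_summable_equivalent abs_summable_on_def)
  have gb: "\<bar>g u\<bar> \<le> w u" for u
    using b by (intro tendsto_upperbound[OF tendsto_rabs[OF l]]) auto
  have eq: "infsum h UNIV = integral\<^sup>L (count_space UNIV) h" if "\<And>u. \<bar>h u\<bar> \<le> w u" for h :: "'u \<Rightarrow> real"
  proof -
    have "integrable (count_space UNIV) h"
      using that by (intro Bochner_Integration.integrable_bound[OF w]) (auto intro: order_trans[OF _ abs_ge_self])
    then have "infsetsum h UNIV = infsum h UNIV"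
      by (intro infsetsum_infsum) (simp add: abs_summable_on_def)
    then show ?thesis by (simp add: infsetsum_def)
  qed
  have "(\<lambda>n. integral\<^sup>L (count_space UNIV) (f n)) \<longlonglongrightarrow> integral\<^sup>L (count_space UNIV) g"
    using l b by (intro integral_dominated_convergence[OF _ _ w]) auto
  then show ?thesis using b gb by (simp add: eq)
qed

section \<open>Lattice boxes, their cells and Riemann sums\<close>

lemma infnorm_le_iff_cart: "infnorm (x :: real ^ 'd) \<le> c \<longleftrightarrow> (\<forall>i. \<bar>x $ i\<bar> \<le> c)"
proof
  assume "\<forall>i. \<bar>x $ i\<bar> \<le> c"
  then show "infnorm x \<le> c" by (subst infnorm_Max) (auto simp: Basis_vec_def inner_axis)
qed (use component_le_infnorm_cart order_trans in blast)

lemma lattice_box_iff: "j \<in> lattice_box N \<longleftrightarrow> (\<forall>i. 2 * \<bar>j $ i\<bar> \<le> int N)"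
proof -
  have "\<bar>real_of_int k\<bar> \<le> real N / 2 \<longleftrightarrow> 2 * \<bar>k\<bar> \<le> int N" for k :: int
    by linarith
  then show ?thesis
    unfolding lattice_box_def infnorm_le_iff_cart lattice_vec_def vec_lambda_beta mem_Collect_eq by blast
qed

lemma finite_card_vec_box:
  fixes S :: "int set"
  assumes "finite S"
  shows "finite {j :: int ^ 'd. \<forall>i. j $ i \<in> S}" "card {j :: int ^ 'd. \<forall>i. j $ i \<in> S} \<le> card S ^ CARD('d)"
proof -
  have inj: "inj_on vec_nth {j :: int ^ 'd. \<forall>i. j $ i \<in> S}" by (auto simp: inj_on_def vec_eq_iff)
  have sub: "vec_nth ` {j :: int ^ 'd. \<forall>i. j $ i \<in> S} \<subseteq> (UNIV \<rightarrow>\<^sub>E S)" by auto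
  have fin: "finite ((UNIV :: 'd set) \<rightarrow>\<^sub>E S)" using assms by (intro finite_PiE) auto
  show "finite {j :: int ^ 'd. \<forall>i. j $ i \<in> S}"
    by (rule finite_imageD[OF finite_subset[OF sub fin] inj])
  show "card {j :: int ^ 'd. \<forall>i. j $ i \<in> S} \<le> card S ^ CARD('d)"
    using card_inj_on_le[OF inj sub fin] by (simp add: card_PiE)
qed

text \<open>Large enough for \<open>lattice_box N\<close> and for all differences of its points, so
  it serves both as the range of differences and for counting the box.\<close>

definition difference_box :: "nat \<Rightarrow> (int ^ 'd) set" where
  "difference_box N = {j. \<forall>i. j $ i \<in> {- int N..int N}}"

lemma finite_difference_box: "finite (difference_box N)"
  unfolding difference_box_def by (intro finite_card_vec_box) simp

lemma card_difference_box:
  "real (card (difference_box N :: (int ^ 'd) set)) \<le> (2 * real N + 1) ^ CARD('d)"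
proof -
  have "card (difference_box N :: (int ^ 'd) set) \<le> card {- int N..int N} ^ CARD('d)"
    unfolding difference_box_def by (intro finite_card_vec_box) simp
  also have "card {- int N..int N} = 2 * N + 1" by simp
  finally have "real (card (difference_box N :: (int ^ 'd) set)) \<le> real ((2 * N + 1) ^ CARD('d))"
    by (simp only: of_nat_le_iff)
  then show ?thesis by (simp add: add.commute)
qed

lemma lattice_box_subset_difference_box: "lattice_box N \<subseteq> difference_box N"
proof
  fix j :: "int ^ 'd" assume j: "j \<in> lattice_box N"
  show "j \<in> difference_box N"
    unfolding difference_box_def
  proof (intro CollectI allI)
    fix i show "j $ i \<in> {- int N..int N}"
      using j[unfolded lattice_box_iff, THEN spec, of i] by auto
  qed
qed

lemma finite_lattice_box: "finite (lattice_box N)"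
  using finite_subset[OF lattice_box_subset_difference_box finite_difference_box] .

lemma card_lattice_box: "real (card (lattice_box N :: (int ^ 'd) set)) \<le> (2 * real N + 1) ^ CARD('d)"
proof -
  have "card (lattice_box N :: (int ^ 'd) set) \<le> card (difference_box N :: (int ^ 'd) set)"
    by (intro card_mono finite_difference_box lattice_box_subset_difference_box)
  then show ?thesis using card_difference_box[of N] by (meson of_nat_le_iff order_trans)
qed

lemma diff_mem_difference_box:
  assumes "j \<in> lattice_box N" "k \<in> lattice_box N" shows "j - k \<in> difference_box N"
  unfolding difference_box_def
proof (intro CollectI allI)
  fix i show "(j - k) $ i \<in> {- int N..int N}"
    using assms[unfolded lattice_box_iff, THEN spec, of i] by auto
qed

text \<open>For N > 0, the half-open cube of side 1/N centred at j/N. Rounding to the nearest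
  lattice point puts every x into exactly one cell, so overlaps never arise.\<close>

definition lattice_cell :: "nat \<Rightarrow> int ^ 'd \<Rightarrow> (real ^ 'd) set" where
  "lattice_cell N j = {x. \<forall>i. \<lfloor>real N * x $ i + 1 / 2\<rfloor> = j $ i}"

lemma measurable_cart_nth[measurable]: "(\<lambda>x :: real ^ 'd. x $ i) \<in> borel_measurable borel"
  by (intro borel_measurable_continuous_onI continuous_intros)

lemma lattice_cell_sets[measurable]: "lattice_cell N j \<in> sets borel"
proof -
  have "lattice_cell N j = (\<Inter>i. {x \<in> space borel. \<lfloor>real N * x $ i + 1 / 2\<rfloor> = j $ i})"
    by (auto simp: lattice_cell_def)
  also have "\<dots> \<in> sets borel" by (intro sets.finite_INT) auto
  finally show ?thesis .
qed

text \<open>The half-open cell is squeezed between an open and a closed box of equal volume.\<close>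

lemma emeasure_lattice_cell:
  fixes j :: "int ^ 'd"
  assumes "0 < N"
  shows "emeasure lborel (lattice_cell N j) = ennreal (real N powr - real CARD('d))"
proof -
  define a b :: "real ^ 'd" where "a = (\<chi> i. (j $ i - 1 / 2) / N)" and "b = (\<chi> i. (j $ i + 1 / 2) / N)"
  have ba: "(b - a) \<bullet> v = 1 / N" if "v \<in> Basis" for v
    using that by (auto simp: a_def b_def Basis_vec_def inner_axis diff_divide_distrib[symmetric])
  then have le: "a \<bullet> v \<le> b \<bullet> v" if "v \<in> Basis" for v
    using that by (simp add: inner_diff_left) (metis diff_ge_0_iff_ge divide_nonneg_nonneg of_nat_0_le_iff zero_le_one)
  have pr: "(\<Prod>v\<in>Basis. (b - a) \<bullet> v) = real N powr - real CARD('d)"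
    using assms by (simp add: ba powr_minus powr_realpow power_inverse divide_inverse)
  have fl: "\<lfloor>real N * x + 1 / 2\<rfloor> = k \<longleftrightarrow> (k - 1 / 2) / N \<le> x \<and> x < (k + 1 / 2) / N" for x :: real and k :: int
    using assms by (auto simp: floor_eq_iff field_simps)
  have "box a b \<subseteq> lattice_cell N j" "lattice_cell N j \<subseteq> cbox a b"
    by (auto simp: lattice_cell_def fl mem_box_cart a_def b_def less_imp_le)
  then have "emeasure lborel (box a b) \<le> emeasure lborel (lattice_cell N j)"
    "emeasure lborel (lattice_cell N j) \<le> emeasure lborel (cbox a b)"
    by (auto intro!: emeasure_mono)
  then show ?thesis using le pr by (simp add: emeasure_lborel_cbox_eq emeasure_lborel_box_eq)
qed

lemma AE_not_in_cbox_boundary: "AE x in lborel. x \<notin> cbox a b - box a (b :: real ^ 'd)"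
proof (rule AE_not_in, rule null_setsI)
  have "emeasure lborel (cbox a b - box a b) = emeasure lborel (cbox a b) - emeasure lborel (box a b)"
    by (intro emeasure_Diff) (auto simp: box_subset_cbox emeasure_lborel_box_eq)
  also have "\<dots> = 0" by (simp add: emeasure_lborel_cbox_eq emeasure_lborel_box_eq)
  finally show "emeasure lborel (cbox a b - box a b) = 0" .
qed simp

lemma tendsto_floor_div:
  "(\<lambda>N. real_of_int (\<lfloor>real N * x + 1 / 2\<rfloor> - k) / real N) \<longlonglongrightarrow> x"
proof (rule LIM_zero_cancel, rule Lim_null_comparison)
  show "\<forall>\<^sub>F N in sequentially. norm (real_of_int (\<lfloor>real N * x + 1 / 2\<rfloor> - k) / real N - x) \<le> (1 + \<bar>k\<bar>) / real N"
    using eventually_gt_at_top[of 0]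
  proof eventually_elim
    case (elim N)
    have "\<bar>real_of_int (\<lfloor>real N * x + 1 / 2\<rfloor> - k) - real N * x\<bar> \<le> 1 + \<bar>k\<bar>"
      by linarith
    then have "\<bar>real_of_int (\<lfloor>real N * x + 1 / 2\<rfloor> - k) - real N * x\<bar> / real N \<le> (1 + \<bar>k\<bar>) / real N"
      by (intro divide_right_mono) auto
    moreover have "real_of_int (\<lfloor>real N * x + 1 / 2\<rfloor> - k) / real N - x = (real_of_int (\<lfloor>real N * x + 1 / 2\<rfloor> - k) - real N * x) / real N"
      using elim by (simp add: field_simps)
    ultimately show ?case by (simp only: real_norm_def abs_divide abs_of_nat)
  qed
  show "(\<lambda>N. real_of_int (1 + \<bar>k\<bar>) / real N) \<longlonglongrightarrow> 0"
    by (rule tendsto_divide_0[OF tendsto_const filterlim_at_top_imp_at_infinity[OF filterlim_real_sequentially]])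
qed

lemma lattice_vec_scaled_nth: "(lattice_vec j /\<^sub>R real N) $ i = real_of_int (j $ i) / real N"
  by (simp add: lattice_vec_def divide_inverse_commute)

lemma lattice_box_iff_unit_cube:
  assumes "0 < N"
  shows "j \<in> lattice_box N \<longleftrightarrow> lattice_vec j /\<^sub>R real N \<in> unit_cube"
proof -
  have "2 * \<bar>k\<bar> \<le> int N \<longleftrightarrow> - (1 / 2) \<le> real_of_int k / real N \<and> real_of_int k / real N \<le> 1 / 2" for k
    using assms by (auto simp: field_simps)
  then show ?thesis
    unfolding lattice_box_iff unit_cube_def mem_box_cart vec_component lattice_vec_scaled_nth by simp
qed

lemma tendsto_eventually_not_in_closed:
  assumes "(g \<longlongrightarrow> l) F" "closed S" "l \<notin> S"
  shows "\<forall>\<^sub>F x in F. g x \<notin> S"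
  using topological_tendstoD[OF assms(1), of "- S"] assms by (auto simp: open_Compl)

text \<open>Cells centred at the lattice points turn the sum into the integral of a step function.
  At the boundary of the cube the cells stick out by half their size.\<close>

lemma shifted_riemann_sum_tendsto:
  fixes f :: "real ^ 'd \<Rightarrow> real" and u :: "int ^ 'd"
  assumes f: "continuous_on unit_cube f"
  shows "(\<lambda>N. real N powr - real CARD('d) *
     (\<Sum>(j, k)\<in>{(j, k). j \<in> lattice_box N \<and> k \<in> lattice_box N \<and> j - k = u}.
        f (lattice_vec j /\<^sub>R real N) * f (lattice_vec k /\<^sub>R real N)))
     \<longlonglongrightarrow> (LINT x|lebesgue_on unit_cube. (f x)\<^sup>2)"
proof -
  let ?pt = "\<lambda>N j. lattice_vec j /\<^sub>R real N :: real ^ 'd"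
  let ?D = "unit_cube :: (real ^ 'd) set"
  \<comment> \<open>In a pair with difference \<open>u\<close> the second point is determined by the
    first.\<close>
  define h where "h N j = (if j \<in> lattice_box N \<and> j - u \<in> lattice_box N then f (?pt N j) * f (?pt N (j - u)) else 0)" for N j
  define idx :: "nat \<Rightarrow> real ^ 'd \<Rightarrow> int ^ 'd" where "idx N x = (\<chi> i. \<lfloor>real N * x $ i + 1 / 2\<rfloor>)" for N x
  define s where "s N x = (\<Sum>j\<in>lattice_box N. h N j * indicator (lattice_cell N j) x)" for N x
  have Dc: "compact ?D" by (simp add: unit_cube_def)
  have Dcl: "closed ?D" by (rule compact_imp_closed[OF Dc])
  have D[measurable]: "?D \<in> sets borel" using Dcl by simp
  obtain B where B: "\<And>x. x \<in> ?D \<Longrightarrow> \<bar>f x\<bar> \<le> B" "0 \<le> B"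
    using compact_imp_bounded[OF compact_continuous_image[OF f Dc]] unfolding bounded_iff
    by (metis abs_ge_zero imageI order_trans real_norm_def vec_0 abs_of_nonneg linorder_le_cases)
  have f2[measurable]: "(\<lambda>x. indicator ?D x * (f x)\<^sup>2) \<in> borel_measurable borel"
    using borel_measurable_continuous_on_indicator[OF D continuous_on_power[OF f, of 2]] by simp
  have cell: "x \<in> lattice_cell N j \<longleftrightarrow> idx N x = j" for N x j
    by (simp add: lattice_cell_def idx_def vec_eq_iff)
  have s_eq: "s N x = h N (idx N x)" for N x
  proof -
    have "s N x = (\<Sum>j\<in>lattice_box N. if idx N x = j then h N j else 0)"
      unfolding s_def by (intro sum.cong) (auto simp: indicator_def cell)
    also have "\<dots> = h N (idx N x)"
      by (subst sum.delta'[OF finite_lattice_box]) (simp add: h_def)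
    finally show ?thesis .
  qed
  have int_s: "(LINT x|lborel. s N x) = real N powr - real CARD('d) * (\<Sum>j\<in>lattice_box N. h N j)" if N: "0 < N" for N
  proof -
    have i: "integrable lborel (indicator (lattice_cell N j) :: real ^ 'd \<Rightarrow> real)" for j
      using emeasure_lattice_cell[OF N, of j] by (intro integrable_real_indicator) auto
    have "(LINT x|lborel. s N x) = (\<Sum>j\<in>lattice_box N. h N j * measure lborel (lattice_cell N j))"
      unfolding s_def using i by (subst Bochner_Integration.integral_sum) auto
    also have "\<dots> = (\<Sum>j\<in>lattice_box N. h N j * real N powr - real CARD('d))"
      by (simp add: measure_def emeasure_lattice_cell[OF N])
    finally show ?thesis by (simp add: sum_distrib_right[symmetric] mult.commute)
  qed
  have sum_eq: "(\<Sum>(j, k)\<in>{(j, k). j \<in> lattice_box N \<and> k \<in> lattice_box N \<and> j - k = u}.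
        f (?pt N j) * f (?pt N k)) = (\<Sum>j\<in>lattice_box N. h N j)" for N
  proof -
    have "(\<Sum>j\<in>lattice_box N. h N j) = (\<Sum>j\<in>{j \<in> lattice_box N. j - u \<in> lattice_box N}. f (?pt N j) * f (?pt N (j - u)))"
      using finite_lattice_box by (intro sum.mono_neutral_cong_right) (auto simp: h_def)
    also have "\<dots> = (\<Sum>(j, k)\<in>{(j, k). j \<in> lattice_box N \<and> k \<in> lattice_box N \<and> j - k = u}. f (?pt N j) * f (?pt N k))"
      by (rule sum.reindex_bij_witness[where i=fst and j="\<lambda>j. (j, j - u)"]) auto
    finally show ?thesis by simp
  qed
  have pt_lim: "(\<lambda>N. ?pt N (idx N x - w)) \<longlonglongrightarrow> x" for x w
    by (rule vec_tendstoI) (simp only: lattice_vec_scaled_nth idx_def vector_minus_component vec_lambda_beta tendsto_floor_div)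
  \<comment> \<open>The boundary of the cube is a null set. A point outside is eventually rounded to
    points outside, because the cube is closed; for an interior point the rounded point and its
    shift by \<open>u\<close> eventually both lie in the cube.\<close>
  have pw: "(\<lambda>N. s N x) \<longlonglongrightarrow> indicator ?D x * (f x)\<^sup>2"
    if x: "x \<notin> cbox (vec (- 1 / 2)) (vec (1 / 2)) - box (vec (- 1 / 2)) (vec (1 / 2))" for x
  proof (cases "x \<in> ?D")
    case False
    have "\<forall>\<^sub>F N in sequentially. s N x = 0"
      using tendsto_eventually_not_in_closed[OF pt_lim[of x 0] Dcl False] eventually_gt_at_top[of 0]
      by eventually_elim (simp add: s_eq h_def lattice_box_iff_unit_cube)
    then show ?thesis using False by (simp add: tendsto_eventually)
  next
    case True
    then have xb: "x \<in> box (vec (- 1 / 2)) (vec (1 / 2))" using x by (simp add: unit_cube_def)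
    have ev: "\<forall>\<^sub>F N in sequentially. ?pt N (idx N x - w) \<in> ?D" for w
      using topological_tendstoD[OF pt_lim[of x w] open_box xb] 
      by eventually_elim (auto simp: unit_cube_def intro: box_subset_cbox[THEN subsetD])
    have fl: "(\<lambda>N. f (?pt N (idx N x - w))) \<longlonglongrightarrow> f x" for w
      by (rule continuous_on_tendsto_compose[OF f pt_lim True ev])
    have "\<forall>\<^sub>F N in sequentially. f (?pt N (idx N x - 0)) * f (?pt N (idx N x - u)) = s N x"
      using ev[of 0] ev[of u] eventually_gt_at_top[of 0]
      by eventually_elim (simp add: s_eq h_def lattice_box_iff_unit_cube)
    with tendsto_mult[OF fl[of 0] fl[of u]] have "(\<lambda>N. s N x) \<longlonglongrightarrow> f x * f x"
      by (rule Lim_transform_eventually)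
    then show ?thesis using True by (simp add: power2_eq_square)
  qed
  \<comment> \<open>A cell around a point of the box leaves the cube by at most 1/(2 N), so it stays
    in [-1, 1]^d. This gives one integrable majorant for all N > 0.\<close>
  have bound: "\<bar>s N x\<bar> \<le> B * B * indicator (cbox (vec (- 1)) (vec 1)) x" if N: "0 < N" for N x
  proof (cases "idx N x \<in> lattice_box N \<and> idx N x - u \<in> lattice_box N")
    case False
    then show ?thesis using B(2) by (auto simp: s_eq h_def)
  next
    case True
    have "\<bar>f (?pt N (idx N x))\<bar> * \<bar>f (?pt N (idx N x - u))\<bar> \<le> B * B"
      using True N B by (intro mult_mono) (auto simp: lattice_box_iff_unit_cube)
    moreover have "x \<in> cbox (vec (- 1)) (vec 1)"
      unfolding mem_box_cart
    proof
      fix i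
      have k: "2 * \<bar>\<lfloor>real N * x $ i + 1 / 2\<rfloor>\<bar> \<le> int N"
        using True by (simp add: lattice_box_iff idx_def)
      have "real N * x $ i \<le> real N" "- real N \<le> real N * x $ i" using k N by linarith+
      then have "real N * x $ i \<le> real N * 1" "real N * (- 1) \<le> real N * x $ i" by simp_all
      then have "x $ i \<le> 1" "- 1 \<le> x $ i" using N by (simp_all only: mult_le_cancel_left_pos of_nat_0_less_iff)
      then show "vec (- 1) $ i \<le> x $ i \<and> x $ i \<le> vec 1 $ i" by simp
    qed
    ultimately show ?thesis using True by (simp add: s_eq h_def abs_mult)
  qed
  have [measurable]: "s N \<in> borel_measurable borel" for N unfolding s_def by measurable
  \<comment> \<open>The shift skips N = 0, where a cell is empty or the whole space.\<close>
  have "(\<lambda>N. LINT x|lborel. s (Suc N) x) \<longlonglongrightarrow> (LINT x|lborel. indicator ?D x * (f x)\<^sup>2)"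
  proof (rule integral_dominated_convergence[where w="\<lambda>x. B * B * indicator (cbox (vec (- 1)) (vec 1)) x"])
    show "integrable lborel (\<lambda>x. B * B * indicator (cbox (vec (- 1)) (vec 1)) x :: real)"
      by (intro integrable_mult_right integrable_real_indicator) (auto simp: emeasure_lborel_cbox_eq)
    show "AE x in lborel. (\<lambda>N. s (Suc N) x) \<longlonglongrightarrow> indicator ?D x * (f x)\<^sup>2"
      using AE_not_in_cbox_boundary by eventually_elim (rule LIMSEQ_Suc[OF pw])
    show "AE x in lborel. norm (s (Suc N) x) \<le> B * B * indicator (cbox (vec (- 1)) (vec 1)) x" for N
      using bound[of "Suc N"] by simp
  qed simp_all
  moreover have "(LINT x|lborel. indicator ?D x * (f x)\<^sup>2) = (LINT x|lebesgue_on ?D. (f x)\<^sup>2)"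
  proof -
    have "(LINT x|lebesgue_on ?D. (f x)\<^sup>2) = (LINT x|lebesgue. indicator ?D x * (f x)\<^sup>2)"
      using D by (subst integral_restrict_space) auto
    also have "\<dots> = (LINT x|lborel. indicator ?D x * (f x)\<^sup>2)"
      by (intro integral_completion) simp
    finally show ?thesis by simp
  qed
  ultimately show ?thesis
    by (subst filterlim_sequentially_Suc[symmetric]) (simp only: sum_eq int_s[OF zero_less_Suc])
qed

section \<open>Stationarity and sums over lattice differences\<close>

lemma stationary_field_expectation:
  fixes X :: "'i::ab_group_add \<Rightarrow> 'a \<Rightarrow> real" and g :: "('i \<Rightarrow> real) \<Rightarrow> real"
  assumes stat: "stationary_field M X" and [measurable]: "\<And>i. X i \<in> borel_measurable M"
    and J: "finite J" and g[measurable]: "g \<in> borel_measurable (PiM J (\<lambda>_. borel))"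
  shows "(LINT \<omega>|M. g (\<lambda>j\<in>J. X (j + h) \<omega>)) = (LINT \<omega>|M. g (\<lambda>j\<in>J. X j \<omega>))"
proof -
  have "distr M (PiM J (\<lambda>_. borel)) (\<lambda>\<omega>. \<lambda>j\<in>J. X (j + h) \<omega>) = distr M (PiM J (\<lambda>_. borel)) (\<lambda>\<omega>. \<lambda>j\<in>J. X j \<omega>)"
    using stat J unfolding stationary_field_def by blast
  then have "integral\<^sup>L (distr M (PiM J (\<lambda>_. borel)) (\<lambda>\<omega>. \<lambda>j\<in>J. X (j + h) \<omega>)) g =
     integral\<^sup>L (distr M (PiM J (\<lambda>_. borel)) (\<lambda>\<omega>. \<lambda>j\<in>J. X j \<omega>)) g" by simp
  then show ?thesis by (subst (asm) (1 2) integral_distr) (auto intro!: measurable_restrict)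
qed

text \<open>Summing over \<open>l\<close> first, after separating its two edges, leaves two free lattice sums.\<close>

lemma cycle_sum_le:
  fixes f :: "'u::ab_group_add \<Rightarrow> real"
  assumes f: "\<And>u. 0 \<le> f u" and sm: "(\<lambda>u. f u ^ (r + s)) summable_on UNIV"
    and J: "finite J" and D: "finite D" "\<And>j k. j \<in> J \<Longrightarrow> k \<in> J \<Longrightarrow> j - k \<in> D"
  shows "(\<Sum>i\<in>J. \<Sum>j\<in>J. \<Sum>k\<in>J. \<Sum>l\<in>J. (f (i - j) * f (k - l)) ^ r * (f (i - k) * f (j - l)) ^ s)
    \<le> 2 * (\<Sum>\<^sub>\<infinity>u. f u ^ (r + s)) * (card J * ((\<Sum>u\<in>D. f u ^ r) * (\<Sum>u\<in>D. f u ^ s)))"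
proof -
  let ?S = "\<Sum>\<^sub>\<infinity>u. f u ^ (r + s)"
  have S0: "0 \<le> ?S" using f by (intro infsum_nonneg) auto
  have re: "(\<Sum>l\<in>J. f (k - l) ^ n) = (\<Sum>u\<in>(\<lambda>l. k - l) ` J. f u ^ n)" for k n
    by (subst sum.reindex) (auto simp: inj_on_def)
  have S: "(\<Sum>l\<in>J. f (k - l) ^ (r + s)) \<le> ?S" for k
    unfolding re using f J by (intro finite_sum_le_infsum[OF sm]) auto
  have SD: "(\<Sum>l\<in>J. f (k - l) ^ n) \<le> (\<Sum>u\<in>D. f u ^ n)" if "k \<in> J" for k n
    unfolding re using f D that by (intro sum_mono2) auto
  have "(\<Sum>i\<in>J. \<Sum>j\<in>J. \<Sum>k\<in>J. \<Sum>l\<in>J. (f (i - j) * f (k - l)) ^ r * (f (i - k) * f (j - l)) ^ s)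
    \<le> (\<Sum>i\<in>J. \<Sum>j\<in>J. \<Sum>k\<in>J. (f (i - j) ^ r * f (i - k) ^ s) * (2 * ?S))"
  proof (intro sum_mono)
    fix i j k
    have "(\<Sum>l\<in>J. (f (i - j) * f (k - l)) ^ r * (f (i - k) * f (j - l)) ^ s) =
       (f (i - j) ^ r * f (i - k) ^ s) * (\<Sum>l\<in>J. f (k - l) ^ r * f (j - l) ^ s)"
      unfolding sum_distrib_left by (intro sum.cong refl) (simp add: power_mult_distrib)
    also have "\<dots> \<le> (f (i - j) ^ r * f (i - k) ^ s) * (\<Sum>l\<in>J. f (k - l) ^ (r + s) + f (j - l) ^ (r + s))"
      using f by (intro mult_left_mono sum_mono power_mult_le_power_sum mult_nonneg_nonneg zero_le_power) auto
    also have "\<dots> \<le> (f (i - j) ^ r * f (i - k) ^ s) * (?S + ?S)"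
      unfolding sum.distrib using f by (intro mult_left_mono add_mono S mult_nonneg_nonneg zero_le_power) auto
    finally show "(\<Sum>l\<in>J. (f (i - j) * f (k - l)) ^ r * (f (i - k) * f (j - l)) ^ s) \<le> (f (i - j) ^ r * f (i - k) ^ s) * (2 * ?S)"
      by (simp only: mult_2)
  qed
  also have "\<dots> = 2 * ?S * (\<Sum>i\<in>J. (\<Sum>j\<in>J. f (i - j) ^ r) * (\<Sum>k\<in>J. f (i - k) ^ s))"
    unfolding sum_product unfolding sum_distrib_left by (intro sum.cong refl) (simp only: mult_ac)
  also have "\<dots> \<le> 2 * ?S * (\<Sum>i\<in>J. (\<Sum>u\<in>D. f u ^ r) * (\<Sum>u\<in>D. f u ^ s))"
    using S0 f by (intro mult_left_mono sum_mono mult_mono SD) (auto intro!: sum_nonneg)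
  finally show ?thesis by simp
qed

lemma card_power_le:
  assumes "0 < N" shows "(2 * real N + 1) ^ d \<le> 3 ^ d * real N ^ d"
  unfolding power_mult_distrib[symmetric] using assms by (intro power_mono) auto

text \<open>Put n = (2 N + 1)^d. By \<open>cycle_sum_le\<close> the cycle sum is at most a constant
  times n times \<open>?W N\<close>, where \<open>?W N\<close> is of smaller order than n by
  \<open>product_average_tendsto_0\<close>. So it is of smaller order than n^2, and n^2 is at most
  9^d N^(2 d) for N > 0.\<close>

lemma lattice_cycle_sum_tendsto_0:
  fixes f :: "int ^ 'd \<Rightarrow> real"
  assumes f: "\<And>u. 0 \<le> f u" "\<And>u. f u \<le> 1" and sm: "(\<lambda>u. f u ^ (r + s)) summable_on UNIV"
    and rs: "0 < r" "0 < s"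
  shows "(\<lambda>N. (real N powr - real CARD('d))\<^sup>2 *
     (\<Sum>i\<in>lattice_box N. \<Sum>j\<in>lattice_box N. \<Sum>k\<in>lattice_box N. \<Sum>l\<in>lattice_box N.
        (f (i - j) * f (k - l)) ^ r * (f (i - k) * f (j - l)) ^ s)) \<longlonglongrightarrow> 0"
    (is "(\<lambda>N. _ * ?Q N) \<longlonglongrightarrow> 0")
proof -
  let ?d = "CARD('d)"
  let ?n = "\<lambda>N. (2 * real N + 1) ^ ?d"
  let ?S = "\<Sum>\<^sub>\<infinity>u. f u ^ (r + s)"
  let ?W = "\<lambda>N. (\<Sum>u\<in>difference_box N. f u ^ r) * (\<Sum>u\<in>difference_box N. f u ^ s)"
  have S0: "0 \<le> ?S" using f by (intro infsum_nonneg) auto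
  have W0: "0 \<le> ?W N" for N using f by (intro mult_nonneg_nonneg sum_nonneg) auto
  have n: "filterlim ?n at_top sequentially"
  proof (rule filterlim_at_top_mono[OF filterlim_real_sequentially], rule always_eventually, rule allI)
    fix N show "real N \<le> ?n N"
      using self_le_power[of "2 * real N + 1" ?d] by simp
  qed
  have lim: "(\<lambda>N. 9 ^ ?d * (2 * ?S) * (?W N / ?n N)) \<longlonglongrightarrow> 0"
    by (rule tendsto_mult_right_zero[OF product_average_tendsto_0[OF f sm finite_difference_box _ n rs, where C=1]])
      (simp add: card_difference_box)
  show ?thesis
  proof (rule Lim_null_comparison[OF _ lim])
    show "\<forall>\<^sub>F N in sequentially. norm ((real N powr - real ?d)\<^sup>2 * ?Q N) \<le> 9 ^ ?d * (2 * ?S) * (?W N / ?n N)"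
      using eventually_gt_at_top[of 0]
    proof eventually_elim
      case (elim N)
      have N: "0 < real N ^ ?d" "0 < ?n N" using elim by auto
      have pw: "real N powr - real ?d = 1 / real N ^ ?d"
        using elim by (simp add: powr_minus powr_realpow divide_inverse)
      have Q0: "0 \<le> ?Q N" using f by (intro sum_nonneg mult_nonneg_nonneg zero_le_power) auto
      have "?Q N \<le> 2 * ?S * (card (lattice_box N :: (int ^ 'd) set) * ?W N)"
        by (rule cycle_sum_le[OF f(1) sm finite_lattice_box finite_difference_box diff_mem_difference_box])
      also have "\<dots> \<le> 2 * ?S * (?n N * ?W N)"
        using S0 W0 card_lattice_box by (intro mult_left_mono mult_right_mono) auto
      finally have Q: "?Q N \<le> 2 * ?S * (?n N * ?W N)" .
      have "?n N \<le> 3 ^ ?d * real N ^ ?d" by (rule card_power_le[OF elim])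
      then have nn: "1 / real N ^ ?d \<le> 3 ^ ?d / ?n N"
        using N by (simp add: field_simps)
      have "(1 / real N ^ ?d)\<^sup>2 * ?Q N \<le> (3 ^ ?d / ?n N)\<^sup>2 * (2 * ?S * (?n N * ?W N))"
        using nn Q Q0 N by (intro mult_mono power_mono) auto
      also have "\<dots> = (3 ^ ?d)\<^sup>2 * (2 * ?S) * (?W N / ?n N)"
        using N by (simp add: power2_eq_square)
      also have "(3 ^ ?d)\<^sup>2 = (9 :: real) ^ ?d" by (simp add: power2_eq_square power_mult_distrib[symmetric])
      finally show ?case using Q0 by (simp only: pw real_norm_def abs_mult abs_power2 abs_of_nonneg[OF Q0])
    qed
  qed
qed

text \<open>Pairs are grouped by their difference; only finitely many u contribute to the infinite
  sum.\<close>

lemma sum_by_difference: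
  fixes g :: "'u::ab_group_add \<Rightarrow> real"
  assumes J: "finite J"
  shows "(\<Sum>j\<in>J. \<Sum>k\<in>J. g (j - k) * h j k) =
    (\<Sum>\<^sub>\<infinity>u. g u * (\<Sum>(j, k)\<in>{(j, k). j \<in> J \<and> k \<in> J \<and> j - k = u}. h j k))"
proof -
  let ?T = "(\<lambda>(j, k). j - k) ` (J \<times> J)"
  let ?P = "\<lambda>u. {(j, k). j \<in> J \<and> k \<in> J \<and> j - k = u}"
  have P: "?P u = {x \<in> J \<times> J. (case x of (j, k) \<Rightarrow> j - k) = u}" for u by auto
  have "(\<Sum>j\<in>J. \<Sum>k\<in>J. g (j - k) * h j k) = (\<Sum>x\<in>J \<times> J. case x of (j, k) \<Rightarrow> g (j - k) * h j k)"
    by (simp add: sum.cartesian_product)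
  also have "\<dots> = (\<Sum>u\<in>?T. \<Sum>x\<in>?P u. case x of (j, k) \<Rightarrow> g (j - k) * h j k)"
    unfolding P using J by (intro sum.group[symmetric]) auto
  also have "\<dots> = (\<Sum>u\<in>?T. g u * (\<Sum>(j, k)\<in>?P u. h j k))"
    unfolding sum_distrib_left by (intro sum.cong refl) auto
  also have "\<dots> = (\<Sum>\<^sub>\<infinity>u\<in>?T. g u * (\<Sum>(j, k)\<in>?P u. h j k))"
    using J by (intro infsum_finite[symmetric]) auto
  also have "\<dots> = (\<Sum>\<^sub>\<infinity>u. g u * (\<Sum>(j, k)\<in>?P u. h j k))"
  proof (rule infsum_cong_neutral)
    fix u assume "u \<in> UNIV - ?T"
    then have "?P u = {}" by auto
    then show "g u * (\<Sum>(j, k)\<in>?P u. h j k) = 0" by (simp only: sum.empty mult_zero_right)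
  qed auto
  finally show ?thesis .
qed

text \<open>Dominated convergence over u: for every fixed u the normalised inner sum is a shifted
  Riemann sum with the same limit, and it is bounded uniformly in N and u because the box has at
  most 3^d N^d points for N > 0.\<close>

lemma lattice_variance_sum_tendsto:
  fixes f :: "real ^ 'd \<Rightarrow> real" and g :: "int ^ 'd \<Rightarrow> real"
  assumes f: "continuous_on unit_cube f" and g: "(\<lambda>u. \<bar>g u\<bar>) summable_on UNIV"
  shows "(\<lambda>N. real N powr - real CARD('d) * (\<Sum>\<^sub>\<infinity>u. g u *
     (\<Sum>(j, k)\<in>{(j, k). j \<in> lattice_box N \<and> k \<in> lattice_box N \<and> j - k = u}.
        f (lattice_vec j /\<^sub>R real N) * f (lattice_vec k /\<^sub>R real N))))
     \<longlonglongrightarrow> (\<Sum>\<^sub>\<infinity>u. g u) * (LINT x|lebesgue_on unit_cube. (f x)\<^sup>2)"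
proof -
  let ?d = "CARD('d)"
  let ?P = "\<lambda>N u. {(j, k). j \<in> lattice_box N \<and> k \<in> lattice_box N \<and> j - k = (u :: int ^ 'd)}"
  let ?V = "\<lambda>N u. real N powr - real ?d * (\<Sum>(j, k)\<in>?P N u. f (lattice_vec j /\<^sub>R real N) * f (lattice_vec k /\<^sub>R real N))"
  let ?I = "LINT x|lebesgue_on unit_cube. (f x)\<^sup>2"
  have "compact (unit_cube :: (real ^ 'd) set)" by (simp add: unit_cube_def)
  then have "bounded (f ` unit_cube)" by (intro compact_imp_bounded compact_continuous_image f)
  then obtain B where B: "0 < B" "\<And>x. x \<in> unit_cube \<Longrightarrow> \<bar>f x\<bar> \<le> B"
    unfolding bounded_pos by auto
  \<comment> \<open>At N = 0 the prefactor is 0, because \<open>0 powr x = 0\<close>.\<close>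
  have Vb: "\<bar>?V N u\<bar> \<le> 3 ^ ?d * B\<^sup>2" for N u
  proof (cases "N = 0")
    case False
    then have N: "0 < N" by simp
    have inj: "inj_on fst (?P N u)" by (auto simp: inj_on_def)
    have "card (?P N u) \<le> card (lattice_box N :: (int ^ 'd) set)"
      by (rule card_inj_on_le[OF inj _ finite_lattice_box]) auto
    then have card: "real (card (?P N u)) \<le> 3 ^ ?d * real N ^ ?d"
      using card_lattice_box[of N, where ?'d='d] card_power_le[OF N, of ?d] by linarith
    have "\<bar>\<Sum>(j, k)\<in>?P N u. f (lattice_vec j /\<^sub>R real N) * f (lattice_vec k /\<^sub>R real N)\<bar> \<le> (\<Sum>x\<in>?P N u. B * B)"
      using B N by (intro order_trans[OF sum_abs] sum_mono) (auto simp: abs_mult lattice_box_iff_unit_cube intro!: mult_mono)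
    also have "\<dots> \<le> (3 ^ ?d * real N ^ ?d) * (B * B)"
      using card by (simp add: mult_right_mono)
    finally have "real N powr - real ?d * \<bar>\<Sum>(j, k)\<in>?P N u. f (lattice_vec j /\<^sub>R real N) * f (lattice_vec k /\<^sub>R real N)\<bar>
       \<le> real N powr - real ?d * ((3 ^ ?d * real N ^ ?d) * (B * B))"
      by (intro mult_left_mono) auto
    also have "\<dots> = 3 ^ ?d * B\<^sup>2"
      using N by (simp add: powr_minus powr_realpow power2_eq_square)
    finally show ?thesis by (simp add: abs_mult)
  qed simp
  have "(\<lambda>N. \<Sum>\<^sub>\<infinity>u. g u * ?V N u) \<longlonglongrightarrow> (\<Sum>\<^sub>\<infinity>u. g u * ?I)"
  proof (rule infsum_dominated_convergence)
    show "(\<lambda>u. \<bar>g u\<bar> * (3 ^ ?d * B\<^sup>2)) summable_on UNIV" by (rule summable_on_cmult_left[OF g])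
    show "\<bar>g u * ?V N u\<bar> \<le> \<bar>g u\<bar> * (3 ^ ?d * B\<^sup>2)" for N u
      unfolding abs_mult[of "g u"] by (intro mult_left_mono Vb) simp
    show "(\<lambda>N. g u * ?V N u) \<longlonglongrightarrow> g u * ?I" for u
      by (intro tendsto_mult_left shifted_riemann_sum_tendsto[OF f])
  qed
  then show ?thesis
    unfolding mult.left_commute[of "g _" "_ powr _"] infsum_cmult_right' infsum_cmult_left' .
qed

text \<open>Normalises the constant function 1, which is inserted for \<open>f\<close> in the limit
  of variances to see that \<open>limit_variance\<close> is nonnegative.\<close>

lemma integral_unit_cube_1: "(LINT x|lebesgue_on (unit_cube :: (real ^ 'd) set). 1\<^sup>2) = (1 :: real)"
proof -
  have "measure lborel (unit_cube :: (real ^ 'd) set) = (\<Prod>b\<in>Basis. ((vec (1 / 2) - vec (- 1 / 2)) :: real ^ 'd) \<bullet> b)"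
    unfolding unit_cube_def by (subst measure_lborel_cbox_eq) (auto simp: Basis_vec_def inner_axis)
  also have "\<dots> = 1" by (intro prod.neutral) (auto simp: Basis_vec_def inner_axis)
  finally have "measure lebesgue (unit_cube :: (real ^ 'd) set) = 1"
    by (simp add: measure_completion unit_cube_def)
  then show ?thesis by (simp add: measure_restrict_space unit_cube_def)
qed

section \<open>Variance formula and central limit theorem in the q-th chaos\<close>

theorem proposition1:
  fixes M :: "'a measure"
    and X :: "int ^ 'd \<Rightarrow> 'a \<Rightarrow> real"
    and \<rho> :: "int ^ 'd \<Rightarrow> real"
    and H :: "real \<Rightarrow> real" and c :: "nat \<Rightarrow> real" and m :: nat
    and eig :: "nat \<Rightarrow> real" and \<phi> :: "nat \<Rightarrow> real ^ 'd \<Rightarrow> real"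
    and \<alpha> :: real and f :: "real ^ 'd \<Rightarrow> real"
  assumes dim: "CARD('d) \<ge> 2"
    and prob: "prob_space M"
    and gauss: "gaussian_field M X"
    and stat: "stationary_field M X"
    and mean: "prob_space.expectation M (X 0) = 0"
    and unit_var: "prob_space.expectation M (\<lambda>\<omega>. (X 0 \<omega>)\<^sup>2) = 1"
    and cov: "\<And>u. \<rho> u = prob_space.expectation M (\<lambda>\<omega>. X 0 \<omega> * X u \<omega>)"
    and H_meas: "H \<in> borel_measurable borel"
    and H_sq: "integrable M (\<lambda>\<omega>. (H (X 0 \<omega>))\<^sup>2)"
    and H_mean: "prob_space.expectation M (\<lambda>\<omega>. H (X 0 \<omega>)) = 0"
    and H_exp: "hermite_expansion H c"
    and rank: "hermite_rank c m"
    and rho_sum: "(\<lambda>u. \<bar>\<rho> u\<bar> ^ m) summable_on UNIV"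
    and basis: "dirichlet_eigenbasis unit_cube eig \<phi>"
    and alpha: "\<alpha> > real CARD('d) / 2"
    and f_sob: "f \<in> sobolev_space unit_cube eig \<phi> \<alpha>"
    and f_cont: "continuous_on unit_cube f"
  shows "\<forall>q\<ge>m.
      (\<forall>N\<ge>2. prob_space.variance M (chaos_sum X c f N q) =
         fact q * (c q)\<^sup>2 * real N powr (- real CARD('d)) *
         (\<Sum>\<^sub>\<infinity>u. \<rho> u ^ q *
            (\<Sum>(j, k)\<in>{(j, k). j \<in> lattice_box N \<and> k \<in> lattice_box N \<and> j - k = u}.
               f (lattice_vec j /\<^sub>R real N) * f (lattice_vec k /\<^sub>R real N)))) \<and>
      (\<lambda>u. \<rho> u ^ q) summable_on UNIV \<and> 0 \<le> limit_variance \<rho> c q \<and>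
      weak_conv_m (\<lambda>N. distr M borel (chaos_sum X c f N q))
        (gaussian_law 0 (limit_variance \<rho> c q * (LINT x|lebesgue_on unit_cube. (f x)\<^sup>2)))"
proof (intro allI impI)
  fix q assume "m \<le> q"
  interpret P: prob_space M by fact
  have Xm[measurable]: "X i \<in> borel_measurable M" for i
    using gauss by (simp add: gaussian_field_def)
  interpret G: std_gaussian_field M X
  proof
    fix i
    show "P.expectation (X i) = 0"
      using stationary_field_expectation[OF stat Xm, of "{0}" "\<lambda>x. x 0" i] mean by simp
    show "P.expectation (\<lambda>\<omega>. (X i \<omega>)\<^sup>2) = 1"
      using stationary_field_expectation[OF stat Xm, of "{0}" "\<lambda>x. (x 0)\<^sup>2" i] unit_var by simp
  qed (rule gauss)
  \<comment> \<open>Translation by \<open>k\<close> carries the indices 0 and \<open>j - k\<close>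
    to \<open>k\<close> and \<open>j\<close>.\<close>
  have R: "G.R j k = \<rho> (j - k)" for j k
    using stationary_field_expectation[OF stat Xm, of "{0, j - k}" "\<lambda>x. x 0 * x (j - k)" k]
    by (simp add: G.R_def cov mult.commute)
  have \<rho>1: "\<bar>\<rho> u\<bar> \<le> 1" for u
    using G.abs_R_le_1[of u 0] by (simp add: R)
  \<comment> \<open>As \<open>|\<rho>| \<le> 1\<close>, the q-th powers are dominated by the
    m-th.\<close>
  have abs_sm: "(\<lambda>u. \<bar>\<rho> u\<bar> ^ q) summable_on UNIV"
    by (rule summable_on_comparison_test[OF rho_sum]) (auto intro!: power_decreasing \<open>m \<le> q\<close> \<rho>1)
  then have abs_sm': "(\<lambda>u. \<bar>\<rho> u ^ q\<bar>) summable_on UNIV" by (simp add: power_abs)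
  then have sm: "(\<lambda>u. \<rho> u ^ q) summable_on UNIV"
    using abs_summable_summable[of "\<lambda>u. \<rho> u ^ q" UNIV] by simp
  have "1 \<le> m" using rank by (simp add: hermite_rank_def)
  then obtain p where q: "q = Suc p" using \<open>m \<le> q\<close> by (cases q) auto
  let ?d = "CARD('d)"
  let ?V = "\<lambda>f N. \<Sum>\<^sub>\<infinity>u. \<rho> u ^ q * (\<Sum>(j, k)\<in>{(j, k). j \<in> lattice_box N \<and> k \<in> lattice_box N \<and> j - k = u}.
               f (lattice_vec j /\<^sub>R real N) * f (lattice_vec k /\<^sub>R real N))"
  \<comment> \<open>\<open>f\<close> is a bound variable here, in \<open>var\<close> and in
    \<open>var_lim\<close>, because the constant function 1 takes its place in
    \<open>lv\<close>.\<close>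
  define a where "a f N j = real N powr (- real ?d / 2) * c q * f (lattice_vec j /\<^sub>R real N)"
    for f :: "real ^ 'd \<Rightarrow> real" and N and j :: "int ^ 'd"
  have chaos: "chaos_sum X c f N q = (\<lambda>\<omega>. G.chaos q (lattice_box N) (a f N) (\<lambda>i. X i \<omega>))" for N
    by (rule ext) (simp add: chaos_sum_def G.chaos_def a_def sum_distrib_left mult_ac)
  have pw: "(real N powr (- real ?d / 2))\<^sup>2 = real N powr - real ?d" for N
    by (simp add: power2_eq_square powr_add[symmetric])
  have var: "P.expectation (\<lambda>\<omega>. (G.chaos q (lattice_box N) (a f N) (\<lambda>i. X i \<omega>))\<^sup>2) =
     fact q * (c q)\<^sup>2 * real N powr - real ?d * ?V f N" for f :: "real ^ 'd \<Rightarrow> real" and N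
  proof -
    have "(\<Sum>j\<in>lattice_box N. \<Sum>k\<in>lattice_box N. a f N j * a f N k * \<rho> (j - k) ^ q) =
       ((c q)\<^sup>2 * real N powr - real ?d) * (\<Sum>j\<in>lattice_box N. \<Sum>k\<in>lattice_box N.
          \<rho> (j - k) ^ q * (f (lattice_vec j /\<^sub>R real N) * f (lattice_vec k /\<^sub>R real N)))"
      unfolding sum_distrib_left pw[symmetric] a_def
      by (intro sum.cong refl) (simp only: power2_eq_square mult_ac)
    then show ?thesis
      unfolding G.chaos_variance R sum_by_difference[OF finite_lattice_box, symmetric] by simp
  qed
  have var_lim: "(\<lambda>N. P.expectation (\<lambda>\<omega>. (G.chaos q (lattice_box N) (a f N) (\<lambda>i. X i \<omega>))\<^sup>2))
     \<longlonglongrightarrow> limit_variance \<rho> c q * (LINT x|lebesgue_on unit_cube. (f x)\<^sup>2)"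
    if "continuous_on unit_cube f" for f :: "real ^ 'd \<Rightarrow> real"
    using tendsto_mult_left[OF lattice_variance_sum_tendsto[OF that abs_sm'], of "fact q * (c q)\<^sup>2"]
    unfolding var limit_variance_def by (simp only: mult.assoc)
  \<comment> \<open>Not evident from the series, whose terms may be negative: for \<open>f\<close> =
    1 the limit of the variances is \<open>limit_variance\<close> itself, and limits of variances
    are nonnegative.\<close>
  have lv: "0 \<le> limit_variance \<rho> c q"
    using LIMSEQ_le_const[OF var_lim[of "\<lambda>_. 1"]] integral_unit_cube_1[where ?'d='d] by simp
  have cs: "P.expectation (chaos_sum X c f N q) = 0" for N
    unfolding chaos by (rule G.chaos_mean) (simp add: q)
  have csm[measurable]: "chaos_sum X c f N q \<in> borel_measurable M" for N
    unfolding chaos by (rule G.tame_field_measurable[OF G.tame_chaos])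
  have variance: "P.variance (chaos_sum X c f N q) = fact q * (c q)\<^sup>2 * real N powr - real ?d * ?V f N" for N
    unfolding cs by (simp add: chaos var)
  let ?v = "\<lambda>N. P.expectation (\<lambda>\<omega>. (G.chaos q (lattice_box N) (a f N) (\<lambda>i. X i \<omega>))\<^sup>2)"
  let ?I = "LINT x|lebesgue_on unit_cube. (f x)\<^sup>2"
  have vI: "0 \<le> limit_variance \<rho> c q * ?I"
    using lv by (intro mult_nonneg_nonneg Bochner_Integration.integral_nonneg) auto
  have "compact (unit_cube :: (real ^ 'd) set)" by (simp add: unit_cube_def)
  then have "bounded (f ` unit_cube)" by (intro compact_imp_bounded compact_continuous_image f_cont)
  then obtain B where B: "0 < B" "\<And>x. x \<in> unit_cube \<Longrightarrow> \<bar>f x\<bar> \<le> B"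
    unfolding bounded_pos by auto
  \<comment> \<open>The fourth power of this coefficient bound is a constant times N^(-2 d), the
    normalisation under which the cycle sums vanish.\<close>
  define b where "b N = real N powr (- real ?d / 2) * (\<bar>c q\<bar> * B)" for N
  have ab: "\<bar>a f N j\<bar> \<le> b N" if "j \<in> lattice_box N" for N j
  proof (cases "N = 0")
    case False
    then have "\<bar>f (lattice_vec j /\<^sub>R real N)\<bar> \<le> B"
      using that by (intro B) (simp add: lattice_box_iff_unit_cube[symmetric])
    then show ?thesis unfolding a_def b_def by (simp add: abs_mult mult_left_mono mult.assoc)
  qed (simp add: a_def b_def)
  obtain K where K: "0 \<le> K" "\<And>J a b t. finite J \<Longrightarrow> \<forall>j\<in>J. \<bar>a j\<bar> \<le> b \<Longrightarrow>
     cmod (char (distr M borel (\<lambda>\<omega>. G.chaos (Suc p) J a (\<lambda>i. X i \<omega>))) t -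
        complex_of_real (exp (- P.expectation (\<lambda>\<omega>. (G.chaos (Suc p) J a (\<lambda>i. X i \<omega>))\<^sup>2) * t\<^sup>2 / 2)))
       \<le> 2 * t\<^sup>2 * sqrt (K * b ^ 4 * (\<Sum>r<p. G.cycle_sum J (Suc r) (p - r)))"
    using G.chaos_char_bound[of p] by blast
  have cycle: "(\<lambda>N. K * b N ^ 4 * (\<Sum>r<p. G.cycle_sum (lattice_box N) (Suc r) (p - r))) \<longlonglongrightarrow> 0"
  proof -
    have b4: "b N ^ 4 = (\<bar>c q\<bar> * B) ^ 4 * (real N powr - real ?d)\<^sup>2" for N
      unfolding pw[symmetric] b_def by (simp add: power_mult_distrib)
    have e: "K * b N ^ 4 * (\<Sum>r<p. G.cycle_sum (lattice_box N) (Suc r) (p - r)) =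
      K * (\<bar>c q\<bar> * B) ^ 4 * (\<Sum>r<p. (real N powr - real ?d)\<^sup>2 * G.cycle_sum (lattice_box N) (Suc r) (p - r))" for N
      unfolding b4 sum_distrib_left[symmetric] by (simp only: mult.assoc)
    show ?thesis
      unfolding e
    proof (intro tendsto_mult_right_zero tendsto_null_sum)
      fix r assume "r \<in> {..<p}"
      \<comment> \<open>The exponents add up to \<open>q\<close>, the power for which summability is
        at hand, and both are positive.\<close>
      then have "Suc r + (p - r) = q" "r < p" using q by auto
      then show "(\<lambda>N. (real N powr - real ?d)\<^sup>2 * G.cycle_sum (lattice_box N) (Suc r) (p - r)) \<longlonglongrightarrow> 0"
        unfolding G.cycle_sum_def R using \<rho>1 abs_sm
        by (intro lattice_cycle_sum_tendsto_0[of "\<lambda>u. \<bar>\<rho> u\<bar>"]) (simp_all only: abs_ge_zero zero_less_Suc zero_less_diff)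
    qed
  qed
  have "weak_conv_m (\<lambda>N. distr M borel (chaos_sum X c f N q)) (gaussian_law 0 (limit_variance \<rho> c q * ?I))"
  proof (rule levy_continuity)
    show "real_distribution (distr M borel (chaos_sum X c f N q))" for N
      by (rule P.real_distribution_distr) simp
    show "real_distribution (gaussian_law 0 (limit_variance \<rho> c q * ?I))"
      by (rule real_distribution_gaussian_law[OF vI])
    fix t
    \<comment> \<open>The comparison goes through the Gaussian law with the exact variance at N,
      which converges by \<open>var_lim\<close>.\<close>
    let ?g = "\<lambda>N. complex_of_real (exp (- ?v N * t\<^sup>2 / 2))"
    have lim: "(\<lambda>N. 2 * t\<^sup>2 * sqrt (K * b N ^ 4 * (\<Sum>r<p. G.cycle_sum (lattice_box N) (Suc r) (p - r)))) \<longlonglongrightarrow> 0"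
      using tendsto_real_sqrt[OF cycle] by (intro tendsto_mult_right_zero) (simp only: real_sqrt_zero)
    have le: "norm (char (distr M borel (chaos_sum X c f N q)) t - ?g N) \<le>
        2 * t\<^sup>2 * sqrt (K * b N ^ 4 * (\<Sum>r<p. G.cycle_sum (lattice_box N) (Suc r) (p - r)))" for N
      unfolding chaos unfolding q by (rule K(2)[OF finite_lattice_box]) (use ab in blast)
    have "(\<lambda>N. char (distr M borel (chaos_sum X c f N q)) t - ?g N) \<longlonglongrightarrow> 0"
      by (rule Lim_null_comparison[OF always_eventually[OF allI, OF le] lim])
    moreover have "?g \<longlonglongrightarrow> complex_of_real (exp (- (limit_variance \<rho> c q * ?I) * t\<^sup>2 / 2))"
      by (intro tendsto_of_real tendsto_exp tendsto_divide tendsto_mult tendsto_minus tendsto_const var_lim f_cont) simp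
    ultimately have "(\<lambda>N. (char (distr M borel (chaos_sum X c f N q)) t - ?g N) + ?g N) \<longlonglongrightarrow>
       0 + complex_of_real (exp (- (limit_variance \<rho> c q * ?I) * t\<^sup>2 / 2))"
      by (rule tendsto_add)
    then show "(\<lambda>N. char (distr M borel (chaos_sum X c f N q)) t) \<longlonglongrightarrow> char (gaussian_law 0 (limit_variance \<rho> c q * ?I)) t"
      by (simp add: char_gaussian_law[OF vI])
  qed
  with variance sm lv show "(\<forall>N\<ge>2. P.variance (chaos_sum X c f N q) =
         fact q * (c q)\<^sup>2 * real N powr (- real CARD('d)) * ?V f N) \<and>
      (\<lambda>u. \<rho> u ^ q) summable_on UNIV \<and> 0 \<le> limit_variance \<rho> c q \<and>
      weak_conv_m (\<lambda>N. distr M borel (chaos_sum X c f N q)) (gaussian_law 0 (limit_variance \<rho> c q * ?I))"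
    by blast
qed

end
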